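(* Let $\mathfrak h$ be an abelian Lie algebra over $\mathbb C$ of finite dimension $r$ with a nondegenerate symmetric bilinear form and orthonormal basis $e_1,\dots,e_r$, and let $V=V^0(\mathfrak h)$ be the Heisenberg vertex operator algebra of level $l=0$. Then $H^2_{1/2}(V,V)$ is in one-to-one correspondence with the space of families of complex numbers $(a_{ij})_{1\le i,j\le r}$, $(M_{ij}^k)_{1\le i,j,k\le r}$ satisfying $a_{ij}=a_{ji}$ and $M_{ij}^k=-M_{ji}^k$, the family attached to the class of a cocycle $Y_1$ being given by the singular part $$Y_1(e_i,x)e_j=a_{ij}\mathbf 1x^{-2}+\sum_{k=1}^rM_{ij}^k\,e_k\,x^{-1}+(\text{nonnegative powers of }x).$$ Consequently $$\dim H^2_{1/2}(V^0(\mathfrak h),V^0(\mathfrak h))=\binom r2+\binom r2\cdot r=3\binom{r+1}3.$$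
   Context: All vector spaces are over $\mathbb C$. $V^l(\mathfrak h)$ is the vertex algebra freely generated by (a basis of) $\mathfrak h$, identified with the weight-$1$ subspace, with $a_1b=l\langle a,b\rangle\mathbf 1$ and $a_nb=0$ for $n=0$ and $n\ge2$, $a,b\in\mathfrak h$; as a vector space it is $\mathrm{Sym}(\mathfrak h\otimes t^{-1}\mathbb C[t^{-1}])$ with $a\otimes t^{-m}$ of weight $m$. For a grading-restricted vertex algebra $(V,Y,\mathbf 1)$ ($V=\coprod_{n\in\mathbb Z}V_{(n)}$, $Y(u,x)v=\sum u_nvx^{-n-1}$, $Dv=v_{-2}\mathbf 1$, $V'=\coprod V_{(n)}^*$), cocycles are linear maps $Y_1:V\otimes V\to V((x))$, $Y_1(u,x)v=\sum_n u^{def}_nv\,x^{-n-1}$, such that (1) $\mathrm{wt}(u^{def}_nv)=\mathrm{wt}\,u+\mathrm{wt}\,v-n-1$; (2) $Y_1(\mathbf 1,x)v=0$; (3) $Y_1(u,x)\mathbf 1=0$; (4) $[D,Y_1(u,x)]=Y_1(Du,x)=\frac{d}{dx}Y_1(u,x)$; (5) for $v'\in V'$, $u_1,u_2,v\in V$, the series $\langle v',Y_1(u_1,z_1)Y(u_2,z_2)v\rangle+\langle v',Y(u_1,z_1)Y_1(u_2,z_2)v\rangle$ and $\langle v',Y_1(Y(u_1,z_1-z_2)u_2,z_2)v\rangle+\langle v',Y(Y_1(u_1,z_1-z_2)u_2,z_2)v\rangle$ (only the sums) converge absolutely in $|z_1|>|z_2|>0$, resp. $|z_2|>|z_1-z_2|>0$,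 to a common rational function with only possible poles at $z_1=0,z_2=0,z_1=z_2$; (6) $Y_1(u,x)v=e^{xD}Y_1(v,-x)u$. Equivalently, $Y+tY_1$ is a first-order deformation of $V$ over $\mathbb C[t]/(t^2)$ with vacuum $\mathbf 1$ and the same grading. Coboundaries are $Y_\phi(u,x)v=Y(\phi(u),x)v-\phi(Y(u,x)v)+Y(u,x)\phi(v)$ for $\phi:V\to V$ linear, grading-preserving, commuting with $D$, $\phi(\mathbf 1)=0$. $H^2_{1/2}(V,V)$ is the space of cocycles modulo the space of coboundaries.
   Formalization: The printed dimension counts the symmetric a_ij as binom(r,2) and is false for every r ≥ 1 (r = 1 gives 0, but the dimension is 1); the formal statement proves dim = binom(r+1,2) + binom(r,2)·r = 3·binom(r+1,3) + r. *)

theory Defs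
  imports "HOL-Analysis.Analysis" "HOL-Library.Function_Algebras"
begin

text \<open>
  A vertex operator \<open>Y(u, x) v = \<Sum>\<^sub>n u\<^sub>n v x\<^bsup>-n-1\<^esup>\<close> is represented by its modes: \<open>Y u n v\<close> is \<open>u\<^sub>n v\<close>.
  All vector spaces are over the complex numbers.
\<close>

section \<open>Double series and rational functions in two variables\<close>

text \<open>
  Over the complex numbers \<open>has_sum\<close> is absolute (unconditional) convergence. The series is
  \<open>\<Sum>\<^sub>m\<^sub>,\<^sub>n P m n w\<^sub>1\<^bsup>-m-1\<^esup> w\<^sub>2\<^bsup>-n-1\<^esup>\<close>.
\<close>

definition double_series_sums ::
    "(int \<Rightarrow> int \<Rightarrow> complex) \<Rightarrow> complex \<Rightarrow> complex \<Rightarrow> complex \<Rightarrow> bool" where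
  "double_series_sums P w1 w2 s \<longleftrightarrow>
     ((\<lambda>(m, n). P m n * w1 powi (- m - 1) * w2 powi (- n - 1)) has_sum s) UNIV"

text \<open>
  Rational functions whose only possible poles are at \<open>z\<^sub>1 = 0\<close>, \<open>z\<^sub>2 = 0\<close> and \<open>z\<^sub>1 = z\<^sub>2\<close>; an element
  of \<open>complex poly poly\<close> is a polynomial in \<open>z\<^sub>2\<close> with coefficients in the polynomials in \<open>z\<^sub>1\<close>.
\<close>

definition rational_functions :: "(complex \<Rightarrow> complex \<Rightarrow> complex) set" where
  "rational_functions =
     {R. \<exists>(p :: complex poly poly) (a :: nat) (b :: nat) (c :: nat).
           \<forall>z1 z2. R z1 z2 = poly (poly p [:z2:]) z1 / (z1 ^ a * z2 ^ b * (z1 - z2) ^ c)}"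

definition product_converges_to ::
    "(int \<Rightarrow> int \<Rightarrow> complex) \<Rightarrow> (complex \<Rightarrow> complex \<Rightarrow> complex) \<Rightarrow> bool" where
  "product_converges_to P R \<longleftrightarrow>
     (\<forall>z1 z2. norm z1 > norm z2 \<and> norm z2 > 0 \<longrightarrow> double_series_sums P z1 z2 (R z1 z2))"

definition iterate_converges_to ::
    "(int \<Rightarrow> int \<Rightarrow> complex) \<Rightarrow> (complex \<Rightarrow> complex \<Rightarrow> complex) \<Rightarrow> bool" where
  "iterate_converges_to P R \<longleftrightarrow>
     (\<forall>z1 z2. norm z2 > norm (z1 - z2) \<and> norm (z1 - z2) > 0 \<longrightarrow>
        double_series_sums P (z1 - z2) z2 (R z1 z2))"


section \<open>Grading-restricted vertex algebras\<close>

locale grading_restricted_vertex_algebra = vector_space scale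
  for scale :: "complex \<Rightarrow> 'v :: ab_group_add \<Rightarrow> 'v" (infixr "*s" 75) +
  fixes G :: "int \<Rightarrow> 'v set"
    and Y :: "'v \<Rightarrow> int \<Rightarrow> 'v \<Rightarrow> 'v"
    and vac :: 'v
  assumes grading_subspace: "subspace (G n)"
    and grading_direct_sum:
      "\<exists>!f. (\<forall>n. f n \<in> G n) \<and> finite {n. f n \<noteq> 0} \<and> v = (\<Sum>n | f n \<noteq> 0. f n)"
    and grading_finite_dim: "\<exists>B. finite B \<and> G n \<subseteq> span B"
    and grading_bounded_below: "\<exists>N. \<forall>n < N. G n = {0}"
    and Y_linear_left: "Vector_Spaces.linear scale scale (\<lambda>u. Y u n v)"
    and Y_linear_right: "Vector_Spaces.linear scale scale (\<lambda>v. Y u n v)"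
    and Y_truncation: "\<exists>N. \<forall>n \<ge> N. Y u n v = 0"
    and Y_weight: "u \<in> G p \<Longrightarrow> v \<in> G q \<Longrightarrow> Y u n v \<in> G (p + q - n - 1)"
    and vac_weight: "vac \<in> G 0"
    and Y_vac: "Y vac n v = (if n = -1 then v else 0)"
    and creation: "Y u (-1) vac = u" "n \<ge> 0 \<Longrightarrow> Y u n vac = 0"
    \<comment> \<open>with \<open>D v = v\<^sub>-\<^sub>2 vac\<close>: \<open>[D, Y(u, x)] = Y(D u, x) = d/dx Y(u, x)\<close>\<close>
    and D_bracket: "Y (Y u n v) (-2) vac - Y u n (Y v (-2) vac) = Y (Y u (-2) vac) n v"
    and D_derivative: "Y (Y u (-2) vac) n v = (- of_int n) *s Y u (n - 1) v"
    \<comment> \<open>for \<open>v'\<close> in the graded dual: rationality, commutativity and associativity\<close>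
    and duality:
      "Vector_Spaces.linear scale (*) v' \<Longrightarrow> finite {n. \<exists>w \<in> G n. v' w \<noteq> 0} \<Longrightarrow>
       \<exists>R \<in> rational_functions.
          product_converges_to (\<lambda>m n. v' (Y u1 m (Y u2 n v))) R \<and>
          product_converges_to (\<lambda>m n. v' (Y u2 m (Y u1 n v))) (\<lambda>z2 z1. R z1 z2) \<and>
          iterate_converges_to (\<lambda>m n. v' (Y (Y u1 m u2) n v)) R"
begin

definition D :: "'v \<Rightarrow> 'v" where
  "D v = Y v (-2) vac"

text \<open>The graded dual \<open>V' = \<Coprod> V\<^sub>(\<^sub>n\<^sub>)\<^sup>*\<close>, as functionals that vanish on almost all \<open>V\<^sub>(\<^sub>n\<^sub>)\<close>.\<close>

definition graded_dual :: "('v \<Rightarrow> complex) set" where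
  "graded_dual = {v'. Vector_Spaces.linear scale (*) v' \<and> finite {n. \<exists>w \<in> G n. v' w \<noteq> 0}}"

text \<open>
  In the last condition, \<open>Y\<^sub>1(u, x) v = e\<^bsup>xD\<^esup> Y\<^sub>1(v, -x) u\<close> is compared coefficient by coefficient.
\<close>

definition cocycles :: "('v \<Rightarrow> int \<Rightarrow> 'v \<Rightarrow> 'v) set" where
  "cocycles = {Y1.
     (\<forall>n v. Vector_Spaces.linear scale scale (\<lambda>u. Y1 u n v)) \<and>
     (\<forall>u n. Vector_Spaces.linear scale scale (\<lambda>v. Y1 u n v)) \<and>
     (\<forall>u v. \<exists>N. \<forall>n \<ge> N. Y1 u n v = 0) \<and>
     (\<forall>p q. \<forall>u \<in> G p. \<forall>v \<in> G q. \<forall>n. Y1 u n v \<in> G (p + q - n - 1)) \<and>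
     (\<forall>n v. Y1 vac n v = 0) \<and>
     (\<forall>u n. Y1 u n vac = 0) \<and>
     (\<forall>u n v. D (Y1 u n v) - Y1 u n (D v) = Y1 (D u) n v \<and>
              Y1 (D u) n v = (- of_int n) *s Y1 u (n - 1) v) \<and>
     (\<forall>v' \<in> graded_dual. \<forall>u1 u2 v. \<exists>R \<in> rational_functions.
        product_converges_to (\<lambda>m n. v' (Y1 u1 m (Y u2 n v)) + v' (Y u1 m (Y1 u2 n v))) R \<and>
        iterate_converges_to (\<lambda>m n. v' (Y1 (Y u1 m u2) n v) + v' (Y (Y1 u1 m u2) n v)) R) \<and>
     (\<forall>u n v. Y1 u n v =
        (\<Sum>j | Y1 v (n + int j) u \<noteq> 0.
           ((-1) powi (n + int j + 1) / fact j) *s (D ^^ j) (Y1 v (n + int j) u)))}"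

definition coboundaries :: "('v \<Rightarrow> int \<Rightarrow> 'v \<Rightarrow> 'v) set" where
  "coboundaries =
     {\<lambda>u n v. Y (\<phi> u) n v - \<phi> (Y u n v) + Y u n (\<phi> v) | \<phi>.
        Vector_Spaces.linear scale scale \<phi> \<and> (\<forall>n. \<phi> ` G n \<subseteq> G n) \<and>
        (\<forall>v. \<phi> (D v) = D (\<phi> v)) \<and> \<phi> vac = 0}"

definition cohomologous ::
    "(('v \<Rightarrow> int \<Rightarrow> 'v \<Rightarrow> 'v) \<times> ('v \<Rightarrow> int \<Rightarrow> 'v \<Rightarrow> 'v)) set" where
  "cohomologous = {(Y1, Y2). Y1 \<in> cocycles \<and> Y2 \<in> cocycles \<and> Y1 - Y2 \<in> coboundaries}"

definition H2_half :: "('v \<Rightarrow> int \<Rightarrow> 'v \<Rightarrow> 'v) set set" where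
  "H2_half = cocycles // cohomologous"

text \<open>
  \<open>dim H2_half = d\<close>: there are \<open>d\<close> cocycles whose classes form a basis of the quotient of
  the cocycles by the coboundaries.
\<close>

definition H2_half_has_dim :: "nat \<Rightarrow> bool" where
  "H2_half_has_dim d \<longleftrightarrow>
     (\<exists>b :: nat \<Rightarrow> 'v \<Rightarrow> int \<Rightarrow> 'v \<Rightarrow> 'v. (\<forall>i < d. b i \<in> cocycles) \<and>
        (\<forall>Y1 \<in> cocycles. \<exists>!c :: nat \<Rightarrow> complex. (\<forall>i \<ge> d. c i = 0) \<and>
           Y1 - (\<Sum>i < d. (\<lambda>u n v. c i *s b i u n v)) \<in> coboundaries))"

end


section \<open>Heisenberg vertex algebras\<close>

text \<open>
  The space \<open>\<hh>\<close> with its form. An abelian Lie algebra is just a vector space: its bracket is zero.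
\<close>

locale orthonormal_basis = vector_space scaleH
  for scaleH :: "complex \<Rightarrow> 'h :: ab_group_add \<Rightarrow> 'h" +
  fixes form :: "'h \<Rightarrow> 'h \<Rightarrow> complex"
    and r :: nat
    and e :: "nat \<Rightarrow> 'h"
  assumes form_linear: "Vector_Spaces.linear scaleH (*) (form a)"
    and form_sym: "form a b = form b a"
    and form_nondegenerate: "(\<And>b. form a b = 0) \<Longrightarrow> a = 0"
    and e_inj: "inj_on e {1..r}"
    and e_independent: "independent (e ` {1..r})"
    and e_span: "span (e ` {1..r}) = UNIV"
    and e_orthonormal:
      "i \<in> {1..r} \<Longrightarrow> j \<in> {1..r} \<Longrightarrow> form (e i) (e j) = (if i = j then 1 else 0)"

text \<open>
  The pair \<open>(i, m)\<close> stands for the mode \<open>e\<^sub>i(-m) = e\<^sub>i \<otimes> t\<^bsup>-m\<^esup>\<close>, and sorted lists of such pairs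
  index the monomial basis of \<open>Sym (\<hh> \<otimes> t\<^bsup>-1\<^esup> \<complex>[t\<^bsup>-1\<^esup>])\<close>.
\<close>

definition monomial_indices :: "nat \<Rightarrow> (nat \<times> nat) list set" where
  "monomial_indices r =
     {xs. set xs \<subseteq> {1..r} \<times> {1..} \<and>
          sorted_wrt (\<lambda>(i, m) (j, n). i < j \<or> i = j \<and> m \<le> n) xs}"

locale heisenberg_vertex_algebra =
  H: orthonormal_basis scaleH form r e +
  grading_restricted_vertex_algebra scale G Y vac
  for scaleH :: "complex \<Rightarrow> 'h :: ab_group_add \<Rightarrow> 'h"
    and form :: "'h \<Rightarrow> 'h \<Rightarrow> complex"
    and r :: nat
    and e :: "nat \<Rightarrow> 'h"
    and scale :: "complex \<Rightarrow> 'v :: ab_group_add \<Rightarrow> 'v" (infixr "*s" 75)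
    and G :: "int \<Rightarrow> 'v set"
    and Y :: "'v \<Rightarrow> int \<Rightarrow> 'v \<Rightarrow> 'v"
    and vac :: 'v +
  fixes \<iota> :: "'h \<Rightarrow> 'v"
    and l :: complex
  assumes \<iota>_linear: "Vector_Spaces.linear scaleH scale \<iota>"
    and \<iota>_bij: "bij_betw \<iota> UNIV (G 1)"
    and ope_1: "Y (\<iota> a) 1 (\<iota> b) = (l * form a b) *s vac"
    and ope_0: "Y (\<iota> a) 0 (\<iota> b) = 0"
    and ope_ge_2: "n \<ge> 2 \<Longrightarrow> Y (\<iota> a) n (\<iota> b) = 0"
    \<comment> \<open>freely generated by \<open>e\<^sub>1, \<dots>, e\<^sub>r\<close>: the monomials in the creation modes form a basis\<close>
    and monomials_inj:
      "inj_on (\<lambda>xs. foldr (\<lambda>(i, m) w. Y (\<iota> (e i)) (- int m) w) xs vac) (monomial_indices r)"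
    and monomials_independent:
      "independent ((\<lambda>xs. foldr (\<lambda>(i, m) w. Y (\<iota> (e i)) (- int m) w) xs vac) ` monomial_indices r)"
    and monomials_span:
      "span ((\<lambda>xs. foldr (\<lambda>(i, m) w. Y (\<iota> (e i)) (- int m) w) xs vac) ` monomial_indices r) = UNIV"
begin

text \<open>
  \<open>Y\<^sub>1(e\<^sub>i, x) e\<^sub>j = a\<^sub>i\<^sub>j vac x\<^bsup>-2\<^esup> + \<Sum>\<^sub>k M\<^sub>i\<^sub>j\<^sup>k e\<^sub>k x\<^bsup>-1\<^esup> + (nonnegative powers of x)\<close>, where \<open>M i j k\<close> is \<open>M\<^sub>i\<^sub>j\<^sup>k\<close>.
\<close>

definition has_singular_part ::
    "('v \<Rightarrow> int \<Rightarrow> 'v \<Rightarrow> 'v) \<Rightarrow> (nat \<Rightarrow> nat \<Rightarrow> complex) \<times> (nat \<Rightarrow> nat \<Rightarrow> nat \<Rightarrow> complex) \<Rightarrow> bool" where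
  "has_singular_part Y1 = (\<lambda>(a, M). \<forall>i \<in> {1..r}. \<forall>j \<in> {1..r}.
     (\<forall>n \<ge> 2. Y1 (\<iota> (e i)) n (\<iota> (e j)) = 0) \<and>
     Y1 (\<iota> (e i)) 1 (\<iota> (e j)) = a i j *s vac \<and>
     Y1 (\<iota> (e i)) 0 (\<iota> (e j)) = (\<Sum>k = 1..r. M i j k *s \<iota> (e k)))"

end

text \<open>Families indexed by \<open>{1..r}\<close> are functions on the naturals that vanish outside the index range.\<close>

definition structure_families ::
    "nat \<Rightarrow> ((nat \<Rightarrow> nat \<Rightarrow> complex) \<times> (nat \<Rightarrow> nat \<Rightarrow> nat \<Rightarrow> complex)) set" where
  "structure_families r =
     {(a, M). (\<forall>i \<in> {1..r}. \<forall>j \<in> {1..r}. a i j = a j i) \<and>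
              (\<forall>i \<in> {1..r}. \<forall>j \<in> {1..r}. \<forall>k \<in> {1..r}. M i j k = - M j i k) \<and>
              (\<forall>i j. \<not> {i, j} \<subseteq> {1..r} \<longrightarrow> a i j = 0) \<and>
              (\<forall>i j k. \<not> {i, j, k} \<subseteq> {1..r} \<longrightarrow> M i j k = 0)}"

end

theory Submission
  imports Defs
begin

text \<open>
  At level zero every mode \<open>u\<^sub>n\<close> with \<open>n \<ge> 0\<close> vanishes, so \<open>V\<close> is the differential polynomial algebra in
  the \<open>e\<^sub>i\<close>. Suppose that a cocycle has no singular part on the generators. The rationality condition for
  \<open>(a, b, w)\<close> then leaves no pole at \<open>z\<^sub>1 = z\<^sub>2\<close>, which together with translation covariance spreads the
  vanishing of the singular part from generators to products. What remains is a symmetric Hochschild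
  2-cocycle on a polynomial algebra, and this is the coboundary of a map that kills the generators.

  Conversely, every singular part occurs: if \<open>\<alpha>\<close> and \<open>\<beta>\<close> are sequences of derivations with
  \<open>[\<alpha>\<^sub>s, D] = \<alpha>\<^sub>s\<^sub>-\<^sub>1\<close> and \<open>[\<beta>\<^sub>s, D] = \<beta>\<^sub>s\<^sub>-\<^sub>1\<close>, contracting \<open>u(z)\<close> and \<open>v(w)\<close> once by means of the derivatives of
  \<open>(z - w)\<^bsup>-1\<^esup>\<close> and antisymmetrizing in \<open>\<alpha>\<close>, \<open>\<beta>\<close> gives a cocycle.
\<close>

section \<open>Double series\<close>

text \<open>Condition (5) controls only sums of two correlators, and nothing is assumed of a single
  summand. At level zero the summands still separate: in a product coefficient with
  \<open>m >= 0\<close> the term \<open>Y u1 m (Y1 u2 n v)\<close> is zero, so these coefficients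
  show the singular modes of \<open>Y1\<close> alone. Coboundaries have no singular modes for the
  same reason, hence the singular part depends only on the class. Weights restrict the singular
  part: on two generators, mode n has weight 1 - n, and V has nothing in negative weight, only
  multiples of \<open>vac\<close> in weight 0 and combinations of generators in weight 1. Skew
  symmetry makes a symmetric, diagonal included, and M antisymmetric in its lower indices. M is
  subject to no Jacobi identity, because the cocycle condition is linear in \<open>Y1\<close>. The
  diagonal entries of a account for the summand r by which the dimension exceeds 3 binom(r+1,
  3).\<close>

lemma has_sum_finite_sum:
  fixes f :: "'i \<Rightarrow> 'a \<Rightarrow> complex"
  assumes "\<And>j. j \<in> J \<Longrightarrow> (f j has_sum s j) A"
  shows "((\<lambda>x. \<Sum>j\<in>J. f j x) has_sum (\<Sum>j\<in>J. s j)) A"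
  using assms
proof (induction J rule: infinite_finite_induct)
  case (insert j J)
  then have "((\<lambda>x. f j x + (\<Sum>j\<in>J. f j x)) has_sum (s j + (\<Sum>j\<in>J. s j))) A"
    by (intro has_sum_add) auto
  with insert show ?case by simp
qed auto

text \<open>Averaging over the N-th roots of unity replaces integration over the circle. The kernel
  \<open>K\<close> is 1 at \<open>k\<close>, has modulus at most 1, and vanishes at the other
  indices of a finite set carrying all but less than \<open>norm (c k)\<close> of the absolute sum;
  so \<open>c k\<close> would be bounded by a smaller tail.\<close>

lemma fourier_coefficients_zero:
  fixes c :: "int \<Rightarrow> complex"
  assumes "\<And>\<omega>. norm \<omega> = 1 \<Longrightarrow> ((\<lambda>m. c m * \<omega> powi m) has_sum 0) UNIV"
  shows "c k = 0"
proof (rule ccontr)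
  assume nz: "c k \<noteq> 0"
  have "c summable_on UNIV" using assms[of 1] by (auto simp: summable_on_def)
  then have abs: "(\<lambda>m. norm (c m)) summable_on UNIV" by (simp add: summable_on_iff_abs_summable_on_complex)
  define S where "S = infsum (\<lambda>m. norm (c m)) UNIV"
  have "((\<lambda>m. norm (c m)) has_sum S) UNIV" unfolding S_def using abs by (rule has_sum_infsum)
  then have "\<forall>\<^sub>F F in finite_subsets_at_top UNIV. dist (\<Sum>m\<in>F. norm (c m)) S < norm (c k)"
    unfolding has_sum_def tendsto_iff using nz by simp
  then obtain F where F: "finite F" and Fd: "\<And>F'. finite F' \<Longrightarrow> F \<subseteq> F' \<Longrightarrow> dist (\<Sum>m\<in>F'. norm (c m)) S < norm (c k)"
    unfolding eventually_finite_subsets_at_top by auto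
  \<comment> \<open>N exceeds every distance from \<open>k\<close> within F, so N divides no nonzero
    \<open>m - k\<close> with \<open>m\<close> in F and the geometric sum in \<open>K m\<close>
    vanishes there.\<close>
  define N :: nat where "N = Suc (\<Sum>m\<in>F. nat \<bar>m - k\<bar>)"
  have N: "\<bar>m - k\<bar> < int N" if "m \<in> F" for m
  proof -
    have "nat \<bar>m - k\<bar> \<le> (\<Sum>m\<in>F. nat \<bar>m - k\<bar>)" using F that by (intro member_le_sum) auto
    then show ?thesis unfolding N_def by linarith
  qed
  have N0: "N > 0" by (simp add: N_def)
  define \<omega> where "\<omega> j = cis (2 * pi * real j / real N)" for j :: nat
  have om_powi: "\<omega> j powi d = (cis (2 * pi * of_int d / real N)) ^ j" for j d
    by (simp add: \<omega>_def cis_power_int Complex.DeMoivre mult_ac)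
  define K where "K m = (\<Sum>j<N. \<omega> j powi (m - k)) / of_nat N" for m
  have norm_om: "norm (\<omega> j) = 1" for j by (simp add: \<omega>_def)
  have om0: "\<omega> j \<noteq> 0" for j using norm_om[of j] by auto
  have Kk: "K k = 1" using N0 by (simp add: K_def)
  have Kle: "norm (K m) \<le> 1" for m
  proof -
    have "norm (\<Sum>j<N. \<omega> j powi (m - k)) \<le> (\<Sum>j<N. norm (\<omega> j powi (m - k)))" by (rule norm_sum)
    also have "\<dots> = real N" by (simp add: norm_power_int norm_om)
    finally show ?thesis using N0 by (simp add: K_def norm_divide)
  qed
  have K0: "K m = 0" if "m \<in> F" "m \<noteq> k" for m
  proof -
    define z where "z = cis (2 * pi * of_int (m - k) / real N)"
    have "z \<noteq> 1"
    proof
      assume "z = 1"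
      then have "cos (2 * pi * of_int (m - k) / real N) = 1" by (metis z_def cis.simps(1) one_complex.simps(1))
      then obtain i where "2 * pi * of_int (m - k) / real N = of_int i * 2 * pi"
        by (auto simp: cos_one_2pi_int)
      then have "pi * of_int (m - k) = pi * (of_int i * real N)" using N0 by (simp add: field_simps)
      then have "of_int (m - k) = (of_int i * real N)" by simp
      then have "real_of_int (m - k) = real_of_int (i * int N)" by simp
      then have "m - k = i * int N" by (simp only: of_int_eq_iff)
      then have "int N dvd \<bar>m - k\<bar>" by simp
      then have "int N \<le> \<bar>m - k\<bar>" using \<open>m \<noteq> k\<close> by (intro zdvd_imp_le) auto
      then show False using N[OF \<open>m \<in> F\<close>] by simp
    qed
    moreover have "z ^ N = 1"
      using N0 by (simp add: z_def Complex.DeMoivre cis_multiple_2pi)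
    ultimately have "(\<Sum>j<N. z ^ j) = 0" by (simp add: geometric_sum)
    then show ?thesis by (simp add: K_def om_powi z_def)
  qed
  have "((\<lambda>m. \<Sum>j<N. (\<omega> j powi (-k) / of_nat N) * (c m * \<omega> j powi m)) has_sum (\<Sum>j<N. (\<omega> j powi (-k) / of_nat N) * 0)) UNIV"
    by (intro has_sum_finite_sum has_sum_cmult_right assms norm_om) 
  moreover have "(\<Sum>j<N. (\<omega> j powi (-k) / of_nat N) * (c m * \<omega> j powi m)) = c m * K m" for m
  proof -
    have "(\<omega> j powi (-k) / of_nat N) * (c m * \<omega> j powi m) = c m * (\<omega> j powi (m - k) / of_nat N)" for j
      by (simp add: power_int_diff om0 power_int_minus divide_inverse)
    then show ?thesis by (simp only: K_def sum_distrib_left sum_divide_distrib)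
  qed
  ultimately have hs: "((\<lambda>m. c m * K m) has_sum 0) UNIV" by simp
  define F' where "F' = insert k F"
  have F': "finite F'" "F \<subseteq> F'" using F by (auto simp: F'_def)
  have "(\<Sum>m\<in>F'. c m * K m) = (\<Sum>m\<in>{k}. c m * K m)"
    by (rule sum.mono_neutral_right) (use F' K0 F'_def in auto)
  then have "(\<Sum>m\<in>F'. c m * K m) = c k" by (simp add: Kk)
  then have t1: "((\<lambda>m. c m * K m) has_sum (0 - c k)) (- F')"
    unfolding Compl_eq_Diff_UNIV using hs has_sum_finite[OF F'(1), of "\<lambda>m. c m * K m"]
    by (intro has_sum_Diff) simp_all
  have t2: "((\<lambda>m. norm (c m)) has_sum (S - (\<Sum>m\<in>F'. norm (c m)))) (- F')"
    unfolding Compl_eq_Diff_UNIV S_def using has_sum_infsum[OF abs] has_sum_finite[OF F'(1)]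
    by (rule has_sum_Diff) simp
  have "norm (0 - c k) \<le> S - (\<Sum>m\<in>F'. norm (c m))"
    by (rule norm_infsum_le[OF t1 t2]) (use Kle in \<open>simp add: norm_mult mult_left_le\<close>)
  then show False using Fd[OF F'] by (simp add: dist_real_def)
qed

lemma double_series_swap:
  "double_series_sums P w1 w2 s \<longleftrightarrow> double_series_sums (\<lambda>n m. P m n) w2 w1 s"
  unfolding double_series_sums_def UNIV_Times_UNIV[symmetric]
  by (subst has_sum_swap) (simp add: case_prod_unfold mult_ac)

lemma double_series_add:
  assumes "double_series_sums P w1 w2 s" "double_series_sums P' w1 w2 s'"
  shows "double_series_sums (\<lambda>m n. P m n + P' m n) w1 w2 (s + s')"
  using has_sum_add[OF assms[unfolded double_series_sums_def]]
  unfolding double_series_sums_def by (simp add: case_prod_unfold algebra_simps)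

lemma double_series_scale:
  assumes "double_series_sums P w1 w2 s"
  shows "double_series_sums (\<lambda>m n. c * P m n) w1 w2 (c * s)"
  using has_sum_cmult_right[OF assms[unfolded double_series_sums_def], of c]
  unfolding double_series_sums_def by (simp add: case_prod_unfold mult.assoc)

lemma double_series_shift:
  assumes "double_series_sums P w1 w2 s" "w1 \<noteq> 0" "w2 \<noteq> 0"
  shows "double_series_sums (\<lambda>m n. P (m - i) (n - j)) w1 w2 (s * w1 powi (- i) * w2 powi (- j))"
proof -
  have bij: "bij_betw (\<lambda>(m, n). (m - i, n - j)) UNIV (UNIV :: (int \<times> int) set)"
    by (rule bij_betwI[of _ _ _ "\<lambda>(m, n). (m + i, n + j)"]) auto
  have "((\<lambda>(m, n). P m n * w1 powi (- m - 1) * w2 powi (- n - 1)) has_sum s) UNIV"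
    using assms(1) by (simp add: double_series_sums_def)
  then have "((\<lambda>x. case (case x of (m, n) \<Rightarrow> (m - i, n - j)) of (m, n) \<Rightarrow> P m n * w1 powi (- m - 1) * w2 powi (- n - 1)) has_sum s) UNIV"
    by (subst has_sum_reindex_bij_betw[OF bij])
  then have *: "((\<lambda>(m, n). P (m - i) (n - j) * w1 powi (- (m - i) - 1) * w2 powi (- (n - j) - 1)) has_sum s) UNIV"
    by (simp add: case_prod_unfold)
  have w1: "w1 powi (- (m - i) - 1) * w1 powi (- i) = w1 powi (- m - 1)" for m
    using assms(2) by (subst power_int_add[symmetric]) auto
  have w2: "w2 powi (- (n - j) - 1) * w2 powi (- j) = w2 powi (- n - 1)" for n
    using assms(3) by (subst power_int_add[symmetric]) auto
  have "P (m - i) (n - j) * w1 powi (- (m - i) - 1) * w2 powi (- (n - j) - 1) * (w1 powi (- i) * w2 powi (- j))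
      = P (m - i) (n - j) * (w1 powi (- (m - i) - 1) * w1 powi (- i)) * (w2 powi (- (n - j) - 1) * w2 powi (- j))" for m n
    by (simp only: mult_ac)
  then have "P (m - i) (n - j) * w1 powi (- m - 1) * w2 powi (- n - 1)
      = P (m - i) (n - j) * w1 powi (- (m - i) - 1) * w2 powi (- (n - j) - 1) * (w1 powi (- i) * w2 powi (- j))" for m n
    by (simp only: w1 w2)
  then have "(\<lambda>(m, n). P (m - i) (n - j) * w1 powi (- m - 1) * w2 powi (- n - 1))
      = (\<lambda>x. (case x of (m, n) \<Rightarrow> P (m - i) (n - j) * w1 powi (- (m - i) - 1) * w2 powi (- (n - j) - 1)) * (w1 powi (- i) * w2 powi (- j)))"
    by (simp only: fun_eq_iff split_paired_all prod.case) simp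
  with has_sum_cmult_left[OF *, of "w1 powi (- i) * w2 powi (- j)"]
  show ?thesis
    unfolding double_series_sums_def by (simp only: mult.assoc)
qed

text \<open>One torus is enough: after rescaling to unit circles both series become absolutely
  convergent double Fourier series, and the one-variable result applies to the difference, once in
  each variable.\<close>

lemma double_series_unique:
  assumes "\<And>w1 w2. norm w1 = \<rho>1 \<Longrightarrow> norm w2 = \<rho>2 \<Longrightarrow> double_series_sums P w1 w2 (s w1 w2)"
    and "\<And>w1 w2. norm w1 = \<rho>1 \<Longrightarrow> norm w2 = \<rho>2 \<Longrightarrow> double_series_sums P' w1 w2 (s w1 w2)"
    and \<rho>: "\<rho>1 > 0" "\<rho>2 > 0"
  shows "P m n = P' m n"
proof -
  \<comment> \<open>The reflection (m, n) -> (-m-1, -n-1) turns mode indices into exponents, and the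
    radii are absorbed into the coefficients.\<close>
  define c where "c m n = (P (-m-1) (-n-1) - P' (-m-1) (-n-1)) * of_real \<rho>1 powi m * of_real \<rho>2 powi n" for m n :: int
  have bij: "bij_betw (\<lambda>(m, n). (-m-1, -n-1)) UNIV (UNIV :: (int \<times> int) set)"
    by (rule bij_betwI[of _ _ _ "\<lambda>(m, n). (-m-1, -n-1)"]) auto
  have *: "((\<lambda>(m, n). c m n * \<omega> powi m * \<eta> powi n) has_sum 0) UNIV" if "norm \<omega> = 1" "norm \<eta> = 1" for \<omega> \<eta>
  proof -
    have "norm (\<rho>1 * \<omega>) = \<rho>1" "norm (\<rho>2 * \<eta>) = \<rho>2" using that \<rho> by (auto simp: norm_mult)
    note w = this
    have "double_series_sums (\<lambda>m n. P m n + (-1) * P' m n) (\<rho>1 * \<omega>) (\<rho>2 * \<eta>) (s (\<rho>1 * \<omega>) (\<rho>2 * \<eta>) + (-1) * s (\<rho>1 * \<omega>) (\<rho>2 * \<eta>))"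
      using assms(1,2)[OF w] by (intro double_series_add double_series_scale)
    then have "((\<lambda>(m, n). (P m n - P' m n) * (\<rho>1 * \<omega>) powi (- m - 1) * (\<rho>2 * \<eta>) powi (- n - 1)) has_sum 0) UNIV"
      by (simp add: double_series_sums_def)
    from has_sum_reindex_bij_betw[OF bij, THEN iffD2, OF this]
    show ?thesis unfolding case_prod_unfold c_def by (simp add: power_int_mult_distrib mult.assoc mult.left_commute)
  qed
  have "c m n = 0" for m n
  proof -
    have inner: "((\<lambda>n. c m n * \<eta> powi n) has_sum 0) UNIV" if "norm \<eta> = 1" for \<eta> m
    proof -
      have s: "(\<lambda>n. c m n * \<eta> powi n) summable_on UNIV" for m
      proof -
        have "(\<lambda>(m, n). c m n * 1 powi m * \<eta> powi n) summable_on UNIV \<times> UNIV"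
          using *[OF _ that, of 1] by (auto simp: summable_on_def)
        from summable_on_SigmaD1[OF this, of m] show ?thesis by simp
      qed
      have "(\<Sum>\<^sub>\<infinity>n. c m n * \<eta> powi n) = 0"
      proof (rule fourier_coefficients_zero)
        fix \<omega> :: complex assume om: "norm \<omega> = 1"
        have "((\<lambda>(m, n). c m n * \<omega> powi m * \<eta> powi n) has_sum 0) (UNIV \<times> UNIV)" using *[OF om that] by simp
        then show "((\<lambda>m. (\<Sum>\<^sub>\<infinity>n. c m n * \<eta> powi n) * \<omega> powi m) has_sum 0) UNIV"
        proof (rule has_sum_SigmaD)
          fix m
          show "((\<lambda>n. case (m, n) of (m, n) \<Rightarrow> c m n * \<omega> powi m * \<eta> powi n) has_sum (\<Sum>\<^sub>\<infinity>n. c m n * \<eta> powi n) * \<omega> powi m) UNIV"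
            using has_sum_cmult_left[OF has_sum_infsum[OF s[of m]], where c = "\<omega> powi m"] by (simp add: mult_ac)
        qed
      qed
      with has_sum_infsum[OF s[of m]] show ?thesis by simp
    qed
    show ?thesis
      by (rule fourier_coefficients_zero[where c = "c m"]) (rule inner)
  qed
  from this[of "-m-1" "-n-1"] \<rho> show ?thesis by (simp add: c_def)
qed

section \<open>Laurent polynomials and the absence of poles on the diagonal\<close>

lemma poly_poly_const: "poly (poly p q) z = poly (poly p [:poly q z:]) z"
  by (induction p) auto

definition finite_laurent :: "(complex \<Rightarrow> complex \<Rightarrow> complex) \<Rightarrow> bool" where
  "finite_laurent f \<longleftrightarrow> (\<exists>C. finite {(m, n). C m n \<noteq> 0} \<and>
     (\<forall>z1 z2. z1 \<noteq> 0 \<longrightarrow> z2 \<noteq> 0 \<longrightarrow> double_series_sums C z1 z2 (f z1 z2)))"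

lemma finite_laurentI:
  assumes "finite {(m, n). C m n \<noteq> 0}"
    and "\<And>z1 z2. z1 \<noteq> 0 \<Longrightarrow> z2 \<noteq> 0 \<Longrightarrow> double_series_sums C z1 z2 (f z1 z2)"
  shows "finite_laurent f"
  using assms unfolding finite_laurent_def by blast

lemma finite_laurent_cong:
  assumes "finite_laurent f" "\<And>z1 z2. z1 \<noteq> 0 \<Longrightarrow> z2 \<noteq> 0 \<Longrightarrow> f z1 z2 = g z1 z2"
  shows "finite_laurent g"
  using assms unfolding finite_laurent_def by metis

lemma finite_laurent_add:
  assumes "finite_laurent f" "finite_laurent g"
  shows "finite_laurent (\<lambda>z1 z2. f z1 z2 + g z1 z2)"
proof -
  obtain C where C: "finite {(m, n). C m n \<noteq> 0}"
    "\<And>z1 z2. z1 \<noteq> 0 \<Longrightarrow> z2 \<noteq> 0 \<Longrightarrow> double_series_sums C z1 z2 (f z1 z2)"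
    using assms(1) unfolding finite_laurent_def by blast
  obtain C' where C': "finite {(m, n). C' m n \<noteq> 0}"
    "\<And>z1 z2. z1 \<noteq> 0 \<Longrightarrow> z2 \<noteq> 0 \<Longrightarrow> double_series_sums C' z1 z2 (g z1 z2)"
    using assms(2) unfolding finite_laurent_def by blast
  show ?thesis
  proof (rule finite_laurentI)
    show "finite {(m, n). C m n + C' m n \<noteq> 0}"
      by (rule finite_subset[OF _ finite_UnI[OF C(1) C'(1)]]) auto
  qed (intro double_series_add C C')
qed

lemma finite_laurent_shift:
  assumes "finite_laurent f"
  shows "finite_laurent (\<lambda>z1 z2. f z1 z2 * z1 powi i * z2 powi j)"
proof -
  obtain C where C: "finite {(m, n). C m n \<noteq> 0}"
    "\<And>z1 z2. z1 \<noteq> 0 \<Longrightarrow> z2 \<noteq> 0 \<Longrightarrow> double_series_sums C z1 z2 (f z1 z2)"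
    using assms unfolding finite_laurent_def by blast
  show ?thesis
  proof (rule finite_laurentI)
    have "{(m, n). C (m - (-i)) (n - (-j)) \<noteq> 0} \<subseteq> (\<lambda>(m, n). (m - i, n - j)) ` {(m, n). C m n \<noteq> 0}"
    proof clarsimp
      fix m n assume "C (m + i) (n + j) \<noteq> 0"
      then show "(m, n) \<in> (\<lambda>(m, n). (m - i, n - j)) ` {(m, n). C m n \<noteq> 0}"
        by (intro image_eqI[of _ _ "(m + i, n + j)"]) auto
    qed
    then show "finite {(m, n). C (m - (-i)) (n - (-j)) \<noteq> 0}"
      by (rule finite_subset) (use C(1) in auto)
    show "double_series_sums (\<lambda>m n. C (m - (-i)) (n - (-j))) z1 z2 (f z1 z2 * z1 powi i * z2 powi j)"
      if "z1 \<noteq> 0" "z2 \<noteq> 0" for z1 z2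
      using double_series_shift[OF C(2)[OF that] that, of "-i" "-j"] by simp
  qed
qed

lemma finite_laurent_const: "finite_laurent (\<lambda>z1 z2. c)"
proof (rule finite_laurentI)
  show "finite {(m, n). (if m = -1 \<and> n = -1 then c else (0::complex)) \<noteq> 0}"
    by (rule finite_subset[of _ "{(-1, -1)}"]) auto
  show "double_series_sums (\<lambda>m n. if m = -1 \<and> n = -1 then c else 0) z1 z2 c" for z1 z2
    unfolding double_series_sums_def
    by (rule has_sum_finite_neutralI[of "{(-1, -1)}"]) (auto split: if_splits)
qed

lemma finite_laurent_poly:
  "finite_laurent (\<lambda>z1 z2. poly (poly p [:z2:]) z1 / (z1 ^ a * z2 ^ b))"
proof -
  have 1: "finite_laurent (\<lambda>z1 z2. poly q z1)" for q
  proof (induction q)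
    case (pCons c q)
    from finite_laurent_add[OF finite_laurent_const[of c] finite_laurent_shift[OF pCons(2), of 1 0]]
    show ?case by (simp add: mult.commute)
  qed (simp add: finite_laurent_const)
  have "finite_laurent (\<lambda>z1 z2. poly (poly p [:z2:]) z1)"
  proof (induction p)
    case (pCons c p)
    from finite_laurent_add[OF 1[of c] finite_laurent_shift[OF pCons(2), of 0 1]]
    show ?case by (simp add: mult.commute)
  qed (simp add: finite_laurent_const)
  from finite_laurent_shift[OF this, of "- int a" "- int b"] show ?thesis
    by (rule finite_laurent_cong) (simp add: power_int_minus divide_inverse)
qed

text \<open>By \<open>Q0\<close> the iterate contains only nonnegative powers of z1 - z2, so R stays
  bounded as z1 tends to z2. The numerator must then vanish on the diagonal, and one factor z1 - z2
  after the other cancels, by induction on its exponent.\<close>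

lemma rational_no_pole_at_diagonal:
  assumes "R \<in> rational_functions" "iterate_converges_to Q R"
    and Q0: "\<And>m n. m \<ge> 0 \<Longrightarrow> Q m n = 0"
  obtains p a b where "\<And>z1 z2. z1 \<noteq> 0 \<Longrightarrow> z2 \<noteq> 0 \<Longrightarrow> z1 \<noteq> z2 \<Longrightarrow>
    R z1 z2 = poly (poly p [:z2:]) z1 / (z1 ^ a * z2 ^ b)"
proof -
  obtain p a b c where R: "\<And>z1 z2. R z1 z2 = poly (poly p [:z2:]) z1 / (z1 ^ a * z2 ^ b * (z1 - z2) ^ c)"
    using assms(1) unfolding rational_functions_def by blast
  have "(\<forall>z1 z2. z1 \<noteq> 0 \<longrightarrow> z2 \<noteq> 0 \<longrightarrow> z1 \<noteq> z2 \<longrightarrow> R z1 z2 = poly (poly p [:z2:]) z1 / (z1 ^ a * z2 ^ b * (z1 - z2) ^ c))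
    \<Longrightarrow> \<exists>p. \<forall>z1 z2. z1 \<noteq> 0 \<longrightarrow> z2 \<noteq> 0 \<longrightarrow> z1 \<noteq> z2 \<longrightarrow> R z1 z2 = poly (poly p [:z2:]) z1 / (z1 ^ a * z2 ^ b)" for c p
  proof (induction c arbitrary: p)
    case 0
    then show ?case by auto
  next
    case (Suc c)
    have van: "poly (poly p [:z:]) z = 0" if z: "z \<noteq> 0" for z
    proof -
      define f where "f w m n = norm (Q m n * w powi (- m - 1) * z powi (- n - 1))" for w m n
      have sums: "double_series_sums Q w z (R (z + w) z)" if "w \<noteq> 0" "norm w \<le> norm z / 2" for w
      proof -
        have "norm z > 0" "norm w > 0" using z that by simp_all
        with that have "norm z > norm ((z + w) - z) \<and> norm ((z + w) - z) > 0"
          unfolding add_diff_cancel_left' by linarith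
        with assms(2) have "double_series_sums Q ((z + w) - z) z (R (z + w) z)"
          unfolding iterate_converges_to_def by blast
        then show ?thesis by simp
      qed
      \<comment> \<open>The absolute series at w = z/2 dominates those at all smaller w, because w
        occurs with nonnegative exponents only; its sum K bounds R near the diagonal.\<close>
      have "double_series_sums Q (z/2) z (R (z + z/2) z)" using z by (intro sums) (auto simp: norm_divide)
      then have "(\<lambda>(m, n). Q m n * (z/2) powi (- m - 1) * z powi (- n - 1)) summable_on UNIV"
        unfolding double_series_sums_def by (auto simp: summable_on_def)
      then have "(\<lambda>x. norm (case x of (m, n) \<Rightarrow> Q m n * (z/2) powi (- m - 1) * z powi (- n - 1))) summable_on UNIV"
        by (simp only: summable_on_iff_abs_summable_on_complex)
      then obtain K where "((\<lambda>x. norm (case x of (m, n) \<Rightarrow> Q m n * (z/2) powi (- m - 1) * z powi (- n - 1))) has_sum K) UNIV"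
        unfolding summable_on_def by blast
      then have K: "((\<lambda>(m, n). f (z/2) m n) has_sum K) UNIV"
        by (simp add: f_def case_prod_unfold)
      have bound: "norm (R (z + w) z) \<le> K" if w: "w \<noteq> 0" "norm w \<le> norm z / 2" for w
      proof (rule norm_infsum_le[OF sums[OF w, unfolded double_series_sums_def] K])
        fix x :: "int \<times> int"
        obtain m n where x: "x = (m, n)" by fastforce
        have "f w m n \<le> f (z/2) m n"
        proof (cases "m \<ge> 0")
          case False
          then have "norm w powi (- m - 1) \<le> norm (z/2) powi (- m - 1)"
            using w by (intro power_int_mono) (auto simp: norm_divide)
          then have "norm (w powi (- m - 1)) \<le> norm ((z/2) powi (- m - 1))" by (simp add: norm_power_int)
          then show ?thesis unfolding f_def norm_mult by (intro mult_right_mono mult_left_mono) auto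
        qed (simp add: f_def Q0)
        then show "norm (case x of (m, n) \<Rightarrow> Q m n * w powi (- m - 1) * z powi (- n - 1)) \<le> (case x of (m, n) \<Rightarrow> f (z/2) m n)"
          by (simp add: x f_def)
      qed
      \<comment> \<open>The denominator of R on the line z1 = z + w. It tends to 0 with w, since the
        exponent \<open>Suc c\<close> is positive.\<close>
      define h where "h w = (z + w) ^ a * z ^ b * w ^ Suc c" for w
      have near: "\<forall>\<^sub>F w in at 0. w \<noteq> 0 \<and> norm w < norm z / 2"
        unfolding eventually_at using z by (intro exI[of _ "norm z / 2"]) auto
      have "((\<lambda>w. K * norm (h w)) \<longlongrightarrow> K * norm (h 0)) (at 0)"
        unfolding h_def by (intro tendsto_intros)
      then have "((\<lambda>w. K * norm (h w)) \<longlongrightarrow> 0) (at 0)" by (simp add: h_def)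
      moreover have "\<forall>\<^sub>F w in at 0. norm (poly (poly p [:z:]) (z + w)) \<le> K * norm (h w)"
        using near
      proof eventually_elim
        case (elim w)
        have "norm z > 0" using z by simp
        with elim norm_diff_ineq[of z w] have "norm (z + w) > 0" by linarith
        then have zw: "z + w \<noteq> 0" by auto
        have "R (z + w) z = poly (poly p [:z:]) (z + w) / ((z + w) ^ a * z ^ b * ((z + w) - z) ^ Suc c)"
          using Suc.prems zw z elim by simp
        then have "poly (poly p [:z:]) (z + w) = R (z + w) z * h w"
          using zw z elim by (simp add: h_def)
        moreover have "norm (R (z + w) z) \<le> K" using bound elim by simp
        ultimately show ?case by (simp add: norm_mult mult_right_mono)
      qed
      ultimately have "((\<lambda>w. poly (poly p [:z:]) (z + w)) \<longlongrightarrow> 0) (at 0)"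
        by (rule Lim_null_comparison[rotated])
      moreover have "((\<lambda>w. poly (poly p [:z:]) (z + w)) \<longlongrightarrow> poly (poly p [:z:]) (z + 0)) (at 0)"
        by (intro tendsto_intros)
      ultimately have "0 = poly (poly p [:z:]) (z + 0)" by (rule LIM_unique)
      then show ?thesis by simp
    qed
    \<comment> \<open>Evaluating the outer variable at the inner one restricts p to the diagonal.
      The result has infinitely many roots, so it is zero and z2 - z1 divides p.\<close>
    have "poly p [:0, 1:] = 0"
    proof (rule ccontr)
      assume "poly p [:0, 1:] \<noteq> 0"
      then have "finite {z. poly (poly p [:0, 1:]) z = 0}" by (rule poly_roots_finite)
      moreover have "UNIV - {0} \<subseteq> {z. poly (poly p [:0, 1:]) z = 0}"
        using van by (auto simp: poly_poly_const[of p "[:0, 1:]"])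
      ultimately have "finite (UNIV - {0 :: complex})" by (rule rev_finite_subset)
      then have "finite (UNIV :: complex set)" by simp
      then show False using infinite_UNIV_char_0 by blast
    qed
    then obtain p' where p': "p = [:- [:0, 1:], 1:] * p'" unfolding poly_eq_0_iff_dvd by (auto simp: dvd_def)
    have "poly (poly p [:z2:]) z1 = (z1 - z2) * poly (poly (- p') [:z2:]) z1" for z1 z2
      by (simp add: p' algebra_simps)
    with Suc.prems have "\<forall>z1 z2. z1 \<noteq> 0 \<longrightarrow> z2 \<noteq> 0 \<longrightarrow> z1 \<noteq> z2 \<longrightarrow>
      R z1 z2 = poly (poly (- p') [:z2:]) z1 / (z1 ^ a * z2 ^ b * (z1 - z2) ^ c)"
      by simp
    then show ?case by (rule Suc.IH)
  qed
  with R show thesis using that by metis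
qed

text \<open>Without a pole on the diagonal R is a Laurent polynomial, whose expansion is finite and
  the same for |z1| > |z2| and for |z2| > |z1|. The second part is how vanishing singular modes
  yield commuting modes.\<close>

lemma product_coefficients_no_pole:
  assumes R: "R \<in> rational_functions" "iterate_converges_to Q R"
    and Q0: "\<And>m n. m \<ge> 0 \<Longrightarrow> Q m n = 0"
    and P: "product_converges_to P R"
  shows "finite {(m, n). P m n \<noteq> 0}"
    and "product_converges_to P' (\<lambda>z2 z1. R z1 z2) \<Longrightarrow> P' n m = P m n"
proof -
  obtain p a b where R': "\<And>z1 z2. z1 \<noteq> 0 \<Longrightarrow> z2 \<noteq> 0 \<Longrightarrow> z1 \<noteq> z2 \<Longrightarrow>
    R z1 z2 = poly (poly p [:z2:]) z1 / (z1 ^ a * z2 ^ b)"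
    using rational_no_pole_at_diagonal[OF R Q0] by blast
  obtain C where C: "finite {(m, n). C m n \<noteq> 0}"
    "\<And>z1 z2. z1 \<noteq> 0 \<Longrightarrow> z2 \<noteq> 0 \<Longrightarrow> double_series_sums C z1 z2 (poly (poly p [:z2:]) z1 / (z1 ^ a * z2 ^ b))"
    using finite_laurent_poly unfolding finite_laurent_def by meson
  have PC: "P m n = C m n" for m n
  proof (rule double_series_unique[of 2 1])
    fix z1 z2 :: complex assume z: "norm z1 = 2" "norm z2 = 1"
    have z0: "z1 \<noteq> 0" "z2 \<noteq> 0" "z1 \<noteq> z2" using z by auto
    with z show "double_series_sums P z1 z2 (R z1 z2)"
      using P unfolding product_converges_to_def by simp
    from z0 show "double_series_sums C z1 z2 (R z1 z2)" using C(2) R' by simp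
  qed simp_all
  then show "finite {(m, n). P m n \<noteq> 0}" using C(1) by simp
  assume P': "product_converges_to P' (\<lambda>z2 z1. R z1 z2)"
  have "(\<lambda>n m. C m n) n m = P' n m" for m n
  proof (rule double_series_unique[of 2 1, symmetric])
    fix z2 z1 :: complex assume z: "norm z2 = 2" "norm z1 = 1"
    have z0: "z1 \<noteq> 0" "z2 \<noteq> 0" "z1 \<noteq> z2" using z by auto
    with z show "double_series_sums P' z2 z1 (R z1 z2)"
      using P' unfolding product_converges_to_def by simp
    from z0 show "double_series_sums (\<lambda>n m. C m n) z2 z1 (R z1 z2)"
      using C(2) R' by (subst double_series_swap) simp
  qed simp_all
  then show "P' n m = P m n" by (simp add: PC)
qed

section \<open>Comparison of constant coefficients\<close>

text \<open>Only nonnegative powers occur, so scaling both variables by t multiplies each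
  nonconstant term by a positive power of t. The rest is at most t times the absolute sum at t =
  1.\<close>

lemma double_series_limit:
  assumes P0: "\<And>m n. m \<ge> 0 \<or> n \<ge> 0 \<Longrightarrow> P m n = 0"
    and sums: "\<And>t. 0 < t \<Longrightarrow> t \<le> 1 \<Longrightarrow> double_series_sums P (of_real t * x) (of_real t * y) (f t)"
  shows "(f \<longlongrightarrow> P (-1) (-1)) (at_right (0::real))"
proof -
  define g where "g t m n = P m n * (of_real t * x) powi (- m - 1) * (of_real t * y) powi (- n - 1)" for t :: real and m n
  have g: "((\<lambda>(m, n). g t m n) has_sum f t) UNIV" if "0 < t" "t \<le> 1" for t
    using sums[OF that] by (simp add: double_series_sums_def g_def)
  have "(\<lambda>(m, n). g 1 m n) summable_on UNIV" using g[of 1] by (auto simp: summable_on_def)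
  then have "(\<lambda>x. norm (case x of (m, n) \<Rightarrow> g 1 m n)) summable_on UNIV"
    by (simp only: summable_on_iff_abs_summable_on_complex)
  then obtain S where S: "((\<lambda>x. norm (case x of (m, n) \<Rightarrow> g 1 m n)) has_sum S) (UNIV - {(-1, -1)})"
    using summable_on_subset_banach[of _ UNIV "UNIV - {(-1, -1)}"] unfolding summable_on_def by blast
  have bound: "norm (f t - P (-1) (-1)) \<le> t * S" if t: "0 < t" "t \<le> 1" for t
  proof (rule norm_infsum_le)
    show "((\<lambda>(m, n). g t m n) has_sum (f t - P (-1) (-1))) (UNIV - {(-1, -1)})"
      by (rule has_sum_Diff[OF g[OF t]]) (auto intro!: has_sum_finiteI simp: g_def)
    show "((\<lambda>x. t * norm (case x of (m, n) \<Rightarrow> g 1 m n)) has_sum t * S) (UNIV - {(-1, -1)})"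
      by (rule has_sum_cmult_right[OF S])
    fix z :: "int \<times> int" assume "z \<in> UNIV - {(-1, -1)}"
    then obtain m n where z: "z = (m, n)" "\<not> (m = -1 \<and> n = -1)" by (cases z) auto
    have "norm (g t m n) \<le> t * norm (g 1 m n)"
    proof (cases "m \<ge> 0 \<or> n \<ge> 0")
      case False
      define i j where "i = nat (- m - 1)" and "j = nat (- n - 1)"
      have ij: "- m - 1 = int i" "- n - 1 = int j" "i + j \<ge> 1"
        using False z(2) by (auto simp: i_def j_def)
      have "norm (g t m n) = t ^ (i + j) * norm (g 1 m n)"
        using t by (simp add: g_def ij norm_mult norm_power power_mult_distrib power_add)
      also have "\<dots> \<le> t * norm (g 1 m n)"
        using power_decreasing[OF ij(3), of t] t by (intro mult_right_mono) auto
      finally show ?thesis .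
    qed (use P0 in \<open>auto simp: g_def\<close>)
    then show "norm (case z of (m, n) \<Rightarrow> g t m n) \<le> t * norm (case z of (m, n) \<Rightarrow> g 1 m n)" by (simp add: z)
  qed
  have "((\<lambda>t. t * S) \<longlongrightarrow> 0 * S) (at_right 0)" by (intro tendsto_intros)
  then have lim: "((\<lambda>t. t * S) \<longlongrightarrow> 0) (at_right 0)" by simp
  have "\<forall>\<^sub>F t in at_right 0. norm (f t - P (-1) (-1)) \<le> t * S"
    unfolding eventually_at_right_field by (intro exI[of _ 1]) (simp add: bound)
  then have "((\<lambda>t. f t - P (-1) (-1)) \<longlongrightarrow> 0) (at_right 0)"
    using lim by (rule Lim_null_comparison)
  then show ?thesis by (simp add: LIM_zero_iff)
qed

text \<open>The ray (3t/2, t) lies in both domains, as its difference t/2 is smaller than t. Letting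
  t tend to 0 along it, R has both constant coefficients as its limit.\<close>

lemma constant_coefficients_agree:
  assumes P: "product_converges_to P R" "\<And>m n. m \<ge> 0 \<or> n \<ge> 0 \<Longrightarrow> P m n = 0"
    and Q: "iterate_converges_to Q R" "\<And>m n. m \<ge> 0 \<or> n \<ge> 0 \<Longrightarrow> Q m n = 0"
  shows "P (-1) (-1) = Q (-1) (-1)"
proof -
  have "((\<lambda>t. R (of_real t * (3/2)) (of_real t * 1)) \<longlongrightarrow> P (-1) (-1)) (at_right (0::real))"
  proof (rule double_series_limit, erule P(2))
    fix t :: real assume "0 < t" "t \<le> 1"
    then show "double_series_sums P (of_real t * (3/2)) (of_real t * 1) (R (of_real t * (3/2)) (of_real t * 1))"
      using P(1) unfolding product_converges_to_def by (auto simp: norm_mult)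
  qed
  moreover have "((\<lambda>t. R (of_real t * (3/2)) (of_real t * 1)) \<longlongrightarrow> Q (-1) (-1)) (at_right (0::real))"
  proof (rule double_series_limit, erule Q(2))
    fix t :: real assume t: "0 < t" "t \<le> 1"
    have eq: "of_real t * (3/2) - of_real t * 1 = of_real t * (1/2 :: complex)" by simp
    have "norm (of_real t * (1/2) :: complex) = t / 2" using t by (simp add: norm_mult)
    then have "norm (of_real t * 1 :: complex) > norm (of_real t * (3/2) - of_real t * 1 :: complex)
      \<and> norm (of_real t * (3/2) - of_real t * 1 :: complex) > 0"
      unfolding eq using t by simp
    then have "double_series_sums Q (of_real t * (3/2) - of_real t * 1) (of_real t * 1) (R (of_real t * (3/2)) (of_real t * 1))"
      using Q(1) unfolding iterate_converges_to_def by blast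
    then show "double_series_sums Q (of_real t * (1/2)) (of_real t * 1) (R (of_real t * (3/2)) (of_real t * 1))"
      unfolding eq .
  qed
  ultimately show ?thesis by (rule tendsto_unique[rotated]) simp
qed

section \<open>Dividing double series by powers of a linear form\<close>

text \<open>This is the binomial series with exponent -(k+1). Its coefficients are nonnegative, so
  convergence at the real point \<open>norm y\<close> gives the absolute convergence required for
  \<open>has_sum\<close>.\<close>

lemma negative_binomial_has_sum:
  fixes y :: complex
  assumes "norm y < 1"
  shows "((\<lambda>i. of_nat (k + i choose i) * y ^ i) has_sum (1 / (1 - y) ^ Suc k)) UNIV"
proof (rule norm_summable_imp_has_sum)
  have *: "(\<lambda>i. of_nat (k + i choose i) * y ^ i) sums (1 / (1 - y) ^ Suc k)" if "norm y < 1" for y :: complex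
  proof -
    have "(\<lambda>n. (- of_nat (Suc k) gchoose n) * (- y) ^ n) sums (1 + (- y)) powr (- of_nat (Suc k))"
      using that by (intro gen_binomial_complex) simp
    moreover have "(- of_nat (Suc k) gchoose n) * (- y) ^ n = of_nat (k + n choose n) * y ^ n" for n
    proof -
      have "(- of_nat (Suc k) gchoose n :: complex) = (-1) ^ n * (of_nat (k + n) gchoose n)"
        by (subst gbinomial_minus) (simp add: algebra_simps)
      moreover have "(-1) ^ n * (- y) ^ n = y ^ n" by (simp add: power_mult_distrib[symmetric])
      moreover have "(-1) ^ n * (of_nat (k + n) gchoose n) * (- y) ^ n = (of_nat (k + n) gchoose n) * ((-1) ^ n * (- y) ^ n)"
        by (simp only: mult_ac)
      ultimately show ?thesis by (simp only: binomial_gbinomial)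
    qed
    moreover have "(1 + (- y)) powr (- of_nat (Suc k)) = 1 / (1 - y) ^ Suc k"
    proof -
      have "1 - y \<noteq> 0" using that by auto
      then have "(1 - y) powr of_nat (Suc k) = (1 - y) ^ Suc k" by (intro powr_nat') simp
      then show ?thesis unfolding powr_minus by (simp add: divide_inverse)
    qed
    ultimately show ?thesis by simp
  qed
  show "(\<lambda>i. of_nat (k + i choose i) * y ^ i) sums (1 / (1 - y) ^ Suc k)" using *[OF assms] .
  have "summable (\<lambda>i. of_nat (k + i choose i) * (of_real (norm y) :: complex) ^ i)"
    using *[of "of_real (norm y)"] assms by (simp add: sums_iff)
  then have "summable (\<lambda>i. complex_of_real (of_nat (k + i choose i) * norm y ^ i))" by simp
  then show "summable (\<lambda>i. norm (of_nat (k + i choose i) * y ^ i))"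
    unfolding summable_complex_of_real by (simp add: norm_mult norm_power)
qed

lemma has_sum_times:
  fixes f :: "'a \<Rightarrow> complex" and g :: "'b \<Rightarrow> complex"
  assumes "(f has_sum s) A" "(g has_sum t) B"
  shows "((\<lambda>(x, y). f x * g y) has_sum (s * t)) (A \<times> B)"
proof (rule has_sum_SigmaI)
  show "((\<lambda>y. case (x, y) of (x, y) \<Rightarrow> f x * g y) has_sum f x * t) B" for x
    using has_sum_cmult_right[OF assms(2), of "f x"] by simp
  show "((\<lambda>x. f x * t) has_sum s * t) A" by (rule has_sum_cmult_left[OF assms(1)])
  have f: "(\<lambda>x. norm (f x)) summable_on A" and g: "(\<lambda>y. norm (g y)) summable_on B"
    using assms unfolding summable_on_iff_abs_summable_on_complex[symmetric] by (auto simp: summable_on_def)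
  have "(\<lambda>z. norm (case z of (x, y) \<Rightarrow> f x * g y)) summable_on A \<times> B"
  proof (rule summable_on_SigmaI)
    show "((\<lambda>y. norm (case (x, y) of (x, y) \<Rightarrow> f x * g y)) has_sum norm (f x) * infsum (\<lambda>y. norm (g y)) B) B" for x
      using has_sum_cmult_right[OF has_sum_infsum[OF g], of "norm (f x)"] by (simp add: norm_mult)
    show "(\<lambda>x. norm (f x) * infsum (\<lambda>y. norm (g y)) B) summable_on A"
      by (rule summable_on_cmult_left[OF f])
  qed simp
  then show "(\<lambda>(x, y). f x * g y) summable_on A \<times> B"
    by (simp only: summable_on_iff_abs_summable_on_complex)
qed

text \<open>Expansion of the quotient in powers of w2/w1; \<open>P0\<close> leaves finitely many
  terms in each coefficient. The parameter \<epsilon> is 1 for division by z1 - z2 in the product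
  and -1 for division by z1 = z2 + (z1 - z2) in the iterate.\<close>

lemma double_series_binomial:
  assumes P: "double_series_sums P w1 w2 s" and P0: "\<And>m n. n \<ge> 0 \<Longrightarrow> P m n = 0"
    and w: "norm w1 > norm w2" "norm w2 > 0" and \<epsilon>: "norm \<epsilon> = 1"
  shows "double_series_sums
    (\<lambda>m n. \<Sum>i<nat (- n). of_nat (k + i choose i) * \<epsilon> ^ i * P (m - int k - int i - 1) (n + int i))
    w1 w2 (s / (w1 - \<epsilon> * w2) ^ Suc k)"
proof -
  define y where "y = \<epsilon> * w2 / w1"
  have w0: "w1 \<noteq> 0" "w2 \<noteq> 0" using w by auto
  have "norm w1 > 0" using w0 by simp
  then have y: "norm y < 1" using w \<epsilon> by (simp add: y_def norm_mult norm_divide)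
  define T where "T m n i = P m n * w1 powi (- m - 1) * w2 powi (- n - 1)
    * (of_nat (k + i choose i) * y ^ i) * w1 powi (- int k - 1)" for m n i
  have "((\<lambda>(x, i). (case x of (m, n) \<Rightarrow> P m n * w1 powi (- m - 1) * w2 powi (- n - 1)) *
     (of_nat (k + i choose i) * y ^ i)) has_sum (s * (1 / (1 - y) ^ Suc k))) (UNIV \<times> UNIV)"
    using has_sum_times[OF P[unfolded double_series_sums_def] negative_binomial_has_sum[OF y]] .
  from has_sum_cmult_left[OF this, of "w1 powi (- int k - 1)"]
  have "((\<lambda>((m, n), i). T m n i) has_sum (s * (1 / (1 - y) ^ Suc k)) * w1 powi (- int k - 1)) UNIV"
    by (simp add: case_prod_unfold T_def)
  also have "(s * (1 / (1 - y) ^ Suc k)) * w1 powi (- int k - 1) = s / (w1 - \<epsilon> * w2) ^ Suc k"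
  proof -
    have "w1 powi (- int k - 1) = inverse (w1 ^ Suc k)"
      by (simp add: power_int_minus[of _ "int (Suc k)", simplified] power_int_diff w0 power_int_minus divide_inverse)
    moreover have "w1 - \<epsilon> * w2 = w1 * (1 - y)" using w0 by (simp add: y_def algebra_simps)
    ultimately show ?thesis by (simp only: power_mult_distrib divide_inverse inverse_mult_distrib mult_ac mult_1_right mult_1_left)
  qed
  finally have T: "((\<lambda>((m, n), i). T m n i) has_sum s / (w1 - \<epsilon> * w2) ^ Suc k) UNIV" .
  \<comment> \<open>Collects equal monomials: the i-th binomial term lowers the exponent of w1 by k
    + i + 1 and raises that of w2 by i.\<close>
  have bij: "bij_betw (\<lambda>((m, n), i). ((m - int k - int i - 1, n + int i), i)) UNIV (UNIV :: ((int \<times> int) \<times> nat) set)"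
    by (rule bij_betwI[of _ _ _ "\<lambda>((m, n), i). ((m + int k + int i + 1, n - int i), i)"]) auto
  have "((\<lambda>((m, n), i). T (m - int k - int i - 1) (n + int i) i) has_sum s / (w1 - \<epsilon> * w2) ^ Suc k) (UNIV \<times> UNIV)"
    using has_sum_reindex_bij_betw[OF bij, THEN iffD2, OF T] by (simp add: case_prod_unfold)
  then have "((\<lambda>(m, n). \<Sum>i<nat (- n). T (m - int k - int i - 1) (n + int i) i) has_sum s / (w1 - \<epsilon> * w2) ^ Suc k) UNIV"
  proof (rule has_sum_SigmaD)
    fix x :: "int \<times> int"
    obtain m n where x: "x = (m, n)" by fastforce
    show "((\<lambda>i. case (x, i) of (x, i) \<Rightarrow> (case x of (m, n) \<Rightarrow> \<lambda>i. T (m - int k - int i - 1) (n + int i) i) i) has_sum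
      (case x of (m, n) \<Rightarrow> \<Sum>i<nat (- n). T (m - int k - int i - 1) (n + int i) i)) UNIV"
      unfolding x by (rule has_sum_finite_neutralI[of "{..<nat (- n)}"]) (auto simp: T_def P0)
  qed
  moreover have "(\<Sum>i<nat (- n). T (m - int k - int i - 1) (n + int i) i) =
    (\<Sum>i<nat (- n). of_nat (k + i choose i) * \<epsilon> ^ i * P (m - int k - int i - 1) (n + int i)) * w1 powi (- m - 1) * w2 powi (- n - 1)" for m n
  proof -
    have "T (m - int k - int i - 1) (n + int i) i =
       of_nat (k + i choose i) * \<epsilon> ^ i * P (m - int k - int i - 1) (n + int i) * w1 powi (- m - 1) * w2 powi (- n - 1)" for i
    proof -
      have 1: "w1 powi (- (m - int k - int i - 1) - 1) * w1 powi (- int i) * w1 powi (- int k - 1) = w1 powi (- m - 1)"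
        using w0 by (simp add: power_int_add[symmetric])
      have 2: "w2 powi (- (n + int i) - 1) * w2 powi (int i) = w2 powi (- n - 1)"
        using w0 by (simp add: power_int_add[symmetric] del: power_int_of_nat)
      have 3: "y ^ i = \<epsilon> ^ i * w2 powi (int i) * w1 powi (- int i)"
        by (simp add: y_def power_divide power_mult_distrib power_int_minus divide_inverse power_inverse)
      have "T (m - int k - int i - 1) (n + int i) i = of_nat (k + i choose i) * \<epsilon> ^ i * P (m - int k - int i - 1) (n + int i)
        * (w1 powi (- (m - int k - int i - 1) - 1) * w1 powi (- int i) * w1 powi (- int k - 1))
        * (w2 powi (- (n + int i) - 1) * w2 powi (int i))"
        unfolding T_def 3 by (simp only: mult_ac)
      then show ?thesis unfolding 1 2 .
    qed
    then show ?thesis by (simp only: sum_distrib_right)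
  qed
  ultimately show ?thesis unfolding double_series_sums_def by simp
qed

text \<open>Off the poles the representation is the same; on them \<open>x / 0 = 0\<close> would spoil closure under addition.\<close>

definition rational_off_poles :: "(complex \<Rightarrow> complex \<Rightarrow> complex) set" where
  "rational_off_poles = {f. \<exists>R \<in> rational_functions. \<forall>z1 z2. z1 \<noteq> 0 \<longrightarrow> z2 \<noteq> 0 \<longrightarrow> z1 \<noteq> z2 \<longrightarrow> f z1 z2 = R z1 z2}"

lemma rational_off_poles_iff:
  "f \<in> rational_off_poles \<longleftrightarrow> (\<exists>(p :: complex poly poly) a b c. \<forall>z1 z2. z1 \<noteq> 0 \<longrightarrow> z2 \<noteq> 0 \<longrightarrow> z1 \<noteq> z2 \<longrightarrow>
     f z1 z2 * (z1 ^ a * z2 ^ b * (z1 - z2) ^ c) = poly (poly p [:z2:]) z1)" (is "_ \<longleftrightarrow> ?R")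
proof
  assume "f \<in> rational_off_poles"
  then show ?R
  proof -
    obtain R where R: "R \<in> rational_functions" "\<And>z1 z2. z1 \<noteq> 0 \<Longrightarrow> z2 \<noteq> 0 \<Longrightarrow> z1 \<noteq> z2 \<Longrightarrow> f z1 z2 = R z1 z2"
      using \<open>f \<in> rational_off_poles\<close> unfolding rational_off_poles_def by blast
    obtain p :: "complex poly poly" and a b c where p: "\<And>z1 z2. R z1 z2 = poly (poly p [:z2:]) z1 / (z1 ^ a * z2 ^ b * (z1 - z2) ^ c)"
      using R(1) unfolding rational_functions_def by blast
    have "\<forall>z1 z2. z1 \<noteq> 0 \<longrightarrow> z2 \<noteq> 0 \<longrightarrow> z1 \<noteq> z2 \<longrightarrow> f z1 z2 * (z1 ^ a * z2 ^ b * (z1 - z2) ^ c) = poly (poly p [:z2:]) z1"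
      by (simp add: R(2) p)
    then show ?thesis by blast
  qed
next
  assume ?R
  then obtain p :: "complex poly poly" and a b c where p: "\<And>z1 z2. z1 \<noteq> 0 \<Longrightarrow> z2 \<noteq> 0 \<Longrightarrow> z1 \<noteq> z2 \<Longrightarrow>
     f z1 z2 * (z1 ^ a * z2 ^ b * (z1 - z2) ^ c) = poly (poly p [:z2:]) z1" by blast
  show "f \<in> rational_off_poles"
    unfolding rational_off_poles_def mem_Collect_eq
  proof (intro bexI allI impI)
    show "(\<lambda>z1 z2. poly (poly p [:z2:]) z1 / (z1 ^ a * z2 ^ b * (z1 - z2) ^ c)) \<in> rational_functions"
      unfolding rational_functions_def by blast
    show "f z1 z2 = poly (poly p [:z2:]) z1 / (z1 ^ a * z2 ^ b * (z1 - z2) ^ c)"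
      if "z1 \<noteq> 0" "z2 \<noteq> 0" "z1 \<noteq> z2" for z1 z2
      unfolding p[OF that, symmetric] using that by simp
  qed
qed

lemma rational_off_polesI:
  assumes "\<And>z1 z2. z1 \<noteq> 0 \<Longrightarrow> z2 \<noteq> 0 \<Longrightarrow> z1 \<noteq> z2 \<Longrightarrow>
     f z1 z2 * (z1 ^ a * z2 ^ b * (z1 - z2) ^ c) = poly (poly p [:z2:]) z1"
  shows "f \<in> rational_off_poles"
  using assms unfolding rational_off_poles_iff by blast

lemma rational_off_poles_add:
  assumes "f \<in> rational_off_poles" "g \<in> rational_off_poles"
  shows "(\<lambda>z1 z2. f z1 z2 + g z1 z2) \<in> rational_off_poles"
proof -
  obtain p :: "complex poly poly" and a b c where p: "\<And>z1 z2. z1 \<noteq> 0 \<Longrightarrow> z2 \<noteq> 0 \<Longrightarrow> z1 \<noteq> z2 \<Longrightarrow>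
     f z1 z2 * (z1 ^ a * z2 ^ b * (z1 - z2) ^ c) = poly (poly p [:z2:]) z1"
    using assms(1) unfolding rational_off_poles_iff by blast
  obtain q :: "complex poly poly" and a' b' c' where q: "\<And>z1 z2. z1 \<noteq> 0 \<Longrightarrow> z2 \<noteq> 0 \<Longrightarrow> z1 \<noteq> z2 \<Longrightarrow>
     g z1 z2 * (z1 ^ a' * z2 ^ b' * (z1 - z2) ^ c') = poly (poly q [:z2:]) z1"
    using assms(2) unfolding rational_off_poles_iff by blast
  define Z1 Z2 :: "complex poly poly" where "Z1 = [:[:0, 1:]:]" and "Z2 = [:0, 1:]"
  have Z: "poly (poly Z1 [:z2:]) z1 = z1" "poly (poly Z2 [:z2:]) z1 = z2" for z1 z2
    by (simp_all add: Z1_def Z2_def)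
  show ?thesis
  proof (rule rational_off_polesI[where a = "a + a'" and b = "b + b'" and c = "c + c'"])
    fix z1 z2 :: complex assume z: "z1 \<noteq> 0" "z2 \<noteq> 0" "z1 \<noteq> z2"
    have "(f z1 z2 + g z1 z2) * (z1 ^ (a + a') * z2 ^ (b + b') * (z1 - z2) ^ (c + c'))
      = f z1 z2 * (z1 ^ a * z2 ^ b * (z1 - z2) ^ c) * (z1 ^ a' * z2 ^ b' * (z1 - z2) ^ c')
      + g z1 z2 * (z1 ^ a' * z2 ^ b' * (z1 - z2) ^ c') * (z1 ^ a * z2 ^ b * (z1 - z2) ^ c)"
      by (simp add: power_add algebra_simps)
    also have "\<dots> = poly (poly (p * (Z1 ^ a' * Z2 ^ b' * (Z1 - Z2) ^ c') + q * (Z1 ^ a * Z2 ^ b * (Z1 - Z2) ^ c)) [:z2:]) z1"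
      by (simp add: p[OF z] q[OF z] Z)
    finally show "(f z1 z2 + g z1 z2) * (z1 ^ (a + a') * z2 ^ (b + b') * (z1 - z2) ^ (c + c')) = \<dots>" .
  qed
qed

lemma rational_off_poles_mult:
  assumes "f \<in> rational_off_poles"
  shows "(\<lambda>z1 z2. c * f z1 z2) \<in> rational_off_poles"
    and "(\<lambda>z1 z2. f z1 z2 / z1 ^ k) \<in> rational_off_poles"
    and "(\<lambda>z1 z2. f z1 z2 / z2 ^ k) \<in> rational_off_poles"
    and "(\<lambda>z1 z2. f z1 z2 / (z1 - z2) ^ k) \<in> rational_off_poles"
proof -
  obtain p :: "complex poly poly" and a b d where p: "\<And>z1 z2. z1 \<noteq> 0 \<Longrightarrow> z2 \<noteq> 0 \<Longrightarrow> z1 \<noteq> z2 \<Longrightarrow>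
     f z1 z2 * (z1 ^ a * z2 ^ b * (z1 - z2) ^ d) = poly (poly p [:z2:]) z1"
    using assms(1) unfolding rational_off_poles_iff by blast
  show "(\<lambda>z1 z2. c * f z1 z2) \<in> rational_off_poles"
    by (rule rational_off_polesI[of _ a b d "[:[:c:]:] * p"]) (simp add: p[symmetric] mult.assoc)
  show "(\<lambda>z1 z2. f z1 z2 / z1 ^ k) \<in> rational_off_poles"
    by (rule rational_off_polesI[of _ "a + k" b d p]) (simp add: p[symmetric] power_add)
  show "(\<lambda>z1 z2. f z1 z2 / z2 ^ k) \<in> rational_off_poles"
    by (rule rational_off_polesI[of _ a "b + k" d p]) (simp add: p[symmetric] power_add)
  show "(\<lambda>z1 z2. f z1 z2 / (z1 - z2) ^ k) \<in> rational_off_poles"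
    by (rule rational_off_polesI[of _ a b "d + k" p]) (simp add: p[symmetric] power_add)
qed

section \<open>Pairs of expansions of one rational function\<close>

definition dual_series :: "(int \<Rightarrow> int \<Rightarrow> complex) \<Rightarrow> (int \<Rightarrow> int \<Rightarrow> complex) \<Rightarrow> bool" where
  "dual_series P Q \<longleftrightarrow> (\<exists>R \<in> rational_functions. product_converges_to P R \<and> iterate_converges_to Q R)"

lemma dual_series_iff:
  "dual_series P Q \<longleftrightarrow> (\<exists>R \<in> rational_off_poles. product_converges_to P R \<and> iterate_converges_to Q R)"
proof
  assume "dual_series P Q"
  moreover have "rational_functions \<subseteq> rational_off_poles"
    unfolding rational_off_poles_def by blast
  ultimately show "\<exists>R \<in> rational_off_poles. product_converges_to P R \<and> iterate_converges_to Q R"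
    unfolding dual_series_def by blast
next
  assume "\<exists>R \<in> rational_off_poles. product_converges_to P R \<and> iterate_converges_to Q R"
  then obtain f where f: "f \<in> rational_off_poles" "product_converges_to P f" "iterate_converges_to Q f" by blast
  then obtain R where R: "R \<in> rational_functions"
    "\<And>z1 z2. z1 \<noteq> 0 \<Longrightarrow> z2 \<noteq> 0 \<Longrightarrow> z1 \<noteq> z2 \<Longrightarrow> f z1 z2 = R z1 z2"
    unfolding rational_off_poles_def by blast
  have "product_converges_to P R"
    unfolding product_converges_to_def
  proof (intro allI impI)
    fix z1 z2 :: complex assume z: "norm z1 > norm z2 \<and> norm z2 > 0"
    then have z0: "z1 \<noteq> 0" "z2 \<noteq> 0" "z1 \<noteq> z2" by auto
    from f(2) z have "double_series_sums P z1 z2 (f z1 z2)" unfolding product_converges_to_def by blast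
    then show "double_series_sums P z1 z2 (R z1 z2)" unfolding R(2)[OF z0] .
  qed
  moreover have "iterate_converges_to Q R"
    unfolding iterate_converges_to_def
  proof (intro allI impI)
    fix z1 z2 :: complex assume z: "norm z2 > norm (z1 - z2) \<and> norm (z1 - z2) > 0"
    then have z0: "z1 \<noteq> 0" "z2 \<noteq> 0" "z1 \<noteq> z2" by auto
    from f(3) z have "double_series_sums Q (z1 - z2) z2 (f z1 z2)" unfolding iterate_converges_to_def by blast
    then show "double_series_sums Q (z1 - z2) z2 (R z1 z2)" unfolding R(2)[OF z0] .
  qed
  ultimately show "dual_series P Q" unfolding dual_series_def using R(1) by blast
qed

lemma dual_series_zero: "dual_series (\<lambda>m n. 0) (\<lambda>m n. 0)"
  unfolding dual_series_iff
proof (intro bexI conjI)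
  show "(\<lambda>z1 z2. 0) \<in> rational_off_poles" by (rule rational_off_polesI[of _ 0 0 0 0]) simp
qed (simp_all add: product_converges_to_def iterate_converges_to_def double_series_sums_def case_prod_unfold)

lemma dual_series_add:
  assumes "dual_series P Q" "dual_series P' Q'"
  shows "dual_series (\<lambda>m n. P m n + P' m n) (\<lambda>m n. Q m n + Q' m n)"
proof -
  obtain R where R: "R \<in> rational_off_poles" "product_converges_to P R" "iterate_converges_to Q R"
    using assms(1) unfolding dual_series_iff by blast
  obtain R' where R': "R' \<in> rational_off_poles" "product_converges_to P' R'" "iterate_converges_to Q' R'"
    using assms(2) unfolding dual_series_iff by blast
  show ?thesis
    unfolding dual_series_iff
    by (rule bexI[OF _ rational_off_poles_add[OF R(1) R'(1)]])
       (use R R' in \<open>auto simp: product_converges_to_def iterate_converges_to_def intro!: double_series_add\<close>)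
qed

lemma dual_series_scale:
  assumes "dual_series P Q"
  shows "dual_series (\<lambda>m n. c * P m n) (\<lambda>m n. c * Q m n)"
proof -
  obtain R where R: "R \<in> rational_off_poles" "product_converges_to P R" "iterate_converges_to Q R"
    using assms(1) unfolding dual_series_iff by blast
  show ?thesis
    unfolding dual_series_iff
    by (rule bexI[OF _ rational_off_poles_mult(1)[OF R(1)]])
       (use R in \<open>auto simp: product_converges_to_def iterate_converges_to_def intro!: double_series_scale\<close>)
qed

lemma dual_series_sum:
  assumes "\<And>j. j \<in> J \<Longrightarrow> dual_series (P j) (Q j)"
  shows "dual_series (\<lambda>m n. \<Sum>j\<in>J. P j m n) (\<lambda>m n. \<Sum>j\<in>J. Q j m n)"
  using assms by (induction J rule: infinite_finite_induct) (auto intro: dual_series_zero dual_series_add)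

lemma powi_neg: "w * z powi (- int (Suc k)) = w / z ^ Suc k" for z :: complex
  by (simp only: power_int_minus power_int_of_nat divide_inverse)

text \<open>z2 is an expansion variable in both domains, so dividing by its power
  \<open>Suc k\<close> is an index shift on both sides.\<close>

lemma dual_series_divide_second:
  assumes "dual_series P Q"
  shows "dual_series (\<lambda>m n. P m (n - int k - 1)) (\<lambda>m n. Q m (n - int k - 1))"
proof -
  obtain R where R: "R \<in> rational_off_poles" "product_converges_to P R" "iterate_converges_to Q R"
    using assms(1) unfolding dual_series_iff by blast
  have *: "double_series_sums (\<lambda>m n. P m (n - int k - 1)) w1 w2 (s / w2 ^ Suc k)"
    if "double_series_sums P w1 w2 s" "w1 \<noteq> 0" "w2 \<noteq> 0" for P w1 w2 s
    using double_series_shift[OF that, of 0 "int (Suc k)"]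
    unfolding powi_neg by (simp add: algebra_simps del: power_Suc)
  show ?thesis
    unfolding dual_series_iff
  proof (rule bexI[OF _ rational_off_poles_mult(3)[OF R(1), of "Suc k"]], intro conjI)
    show "product_converges_to (\<lambda>m n. P m (n - int k - 1)) (\<lambda>z1 z2. R z1 z2 / z2 ^ Suc k)"
      using R(2) unfolding product_converges_to_def by (intro allI impI *) auto
    show "iterate_converges_to (\<lambda>m n. Q m (n - int k - 1)) (\<lambda>z1 z2. R z1 z2 / z2 ^ Suc k)"
      using R(3) unfolding iterate_converges_to_def by (intro allI impI *) auto
  qed
qed

text \<open>Division by the power \<open>Suc k\<close> of z1 - z2: an index shift in the iterate,
  where z1 - z2 is a variable, and a binomial expansion in z2/z1 in the product.\<close>

lemma dual_series_divide_diff: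
  assumes "dual_series P Q" and P0: "\<And>m n. n \<ge> 0 \<Longrightarrow> P m n = 0"
  shows "dual_series (\<lambda>m n. \<Sum>i<nat (- n). of_nat (k + i choose i) * P (m - int k - int i - 1) (n + int i))
    (\<lambda>m n. Q (m - int k - 1) n)"
proof -
  obtain R where R: "R \<in> rational_off_poles" "product_converges_to P R" "iterate_converges_to Q R"
    using assms(1) unfolding dual_series_iff by blast
  have *: "double_series_sums (\<lambda>m n. Q (m - int k - 1) n) w1 w2 (s / w1 ^ Suc k)"
    if "double_series_sums Q w1 w2 s" "w1 \<noteq> 0" "w2 \<noteq> 0" for w1 w2 s
    using double_series_shift[OF that, of "int (Suc k)" 0]
    unfolding powi_neg by (simp add: algebra_simps del: power_Suc)
  show ?thesis
    unfolding dual_series_iff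
  proof (rule bexI[OF _ rational_off_poles_mult(4)[OF R(1), of "Suc k"]], intro conjI)
    show "product_converges_to (\<lambda>m n. \<Sum>i<nat (- n). of_nat (k + i choose i) * P (m - int k - int i - 1) (n + int i))
      (\<lambda>z1 z2. R z1 z2 / (z1 - z2) ^ Suc k)"
      unfolding product_converges_to_def
    proof (intro allI impI)
      fix z1 z2 :: complex assume z: "norm z1 > norm z2 \<and> norm z2 > 0"
      with R(2) have "double_series_sums P z1 z2 (R z1 z2)" unfolding product_converges_to_def by blast
      from double_series_binomial[OF this P0, of 1 k] z
      show "double_series_sums (\<lambda>m n. \<Sum>i<nat (- n). of_nat (k + i choose i) * P (m - int k - int i - 1) (n + int i)) z1 z2
        (R z1 z2 / (z1 - z2) ^ Suc k)" by simp
    qed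
    show "iterate_converges_to (\<lambda>m n. Q (m - int k - 1) n) (\<lambda>z1 z2. R z1 z2 / (z1 - z2) ^ Suc k)"
      using R(3) unfolding iterate_converges_to_def by (intro allI impI *) auto
  qed
qed

text \<open>Division by the power \<open>Suc k\<close> of z1: an index shift in the product, and in
  the iterate an expansion of z1 = z2 + (z1 - z2) in powers of (z1 - z2)/z2, whence the
  signs.\<close>

lemma dual_series_divide_first:
  assumes "dual_series P Q" and Q0: "\<And>m n. m \<ge> 0 \<Longrightarrow> Q m n = 0"
  shows "dual_series (\<lambda>m n. P (m - int k - 1) n)
    (\<lambda>m n. \<Sum>i<nat (- m). of_nat (k + i choose i) * (-1) ^ i * Q (m + int i) (n - int k - int i - 1))"
proof -
  obtain R where R: "R \<in> rational_off_poles" "product_converges_to P R" "iterate_converges_to Q R"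
    using assms(1) unfolding dual_series_iff by blast
  have *: "double_series_sums (\<lambda>m n. P (m - int k - 1) n) w1 w2 (s / w1 ^ Suc k)"
    if "double_series_sums P w1 w2 s" "w1 \<noteq> 0" "w2 \<noteq> 0" for w1 w2 s
    using double_series_shift[OF that, of "int (Suc k)" 0]
    unfolding powi_neg by (simp add: algebra_simps del: power_Suc)
  show ?thesis
    unfolding dual_series_iff
  proof (rule bexI[OF _ rational_off_poles_mult(2)[OF R(1), of "Suc k"]], intro conjI)
    show "product_converges_to (\<lambda>m n. P (m - int k - 1) n) (\<lambda>z1 z2. R z1 z2 / z1 ^ Suc k)"
      using R(2) unfolding product_converges_to_def by (intro allI impI *) auto
    show "iterate_converges_to
      (\<lambda>m n. \<Sum>i<nat (- m). of_nat (k + i choose i) * (-1) ^ i * Q (m + int i) (n - int k - int i - 1))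
      (\<lambda>z1 z2. R z1 z2 / z1 ^ Suc k)"
      unfolding iterate_converges_to_def
    proof (intro allI impI)
      fix z1 z2 :: complex assume z: "norm z2 > norm (z1 - z2) \<and> norm (z1 - z2) > 0"
      \<comment> \<open>In the iterate domain z2 is the larger variable, so the two indices exchange
        roles before the binomial expansion.\<close>
      with R(3) have "double_series_sums (\<lambda>n m. Q m n) z2 (z1 - z2) (R z1 z2)"
        unfolding iterate_converges_to_def by (subst double_series_swap) simp
      from double_series_binomial[OF this, of "-1" k] Q0 z
      have "double_series_sums (\<lambda>n m. \<Sum>i<nat (- m). of_nat (k + i choose i) * (-1) ^ i * Q (m + int i) (n - int k - int i - 1))
        z2 (z1 - z2) (R z1 z2 / z1 ^ Suc k)" by simp
      then show "double_series_sums (\<lambda>m n. \<Sum>i<nat (- m). of_nat (k + i choose i) * (-1) ^ i * Q (m + int i) (n - int k - int i - 1))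
        (z1 - z2) z2 (R z1 z2 / z1 ^ Suc k)" by (subst double_series_swap)
    qed
  qed
qed

section \<open>The level zero Heisenberg vertex algebra as a differential polynomial algebra\<close>

text \<open>Swaps of the two leading letters, carried under a prefix by \<open>cons\<close>,
  generate all permutations. This will make a recursion along words of generators depend on the
  monomial only.\<close>

lemma list_function_of_mset:
  assumes swap: "\<And>a b xs. set (a # b # xs) \<subseteq> I \<Longrightarrow> f (a # b # xs) = f (b # a # xs)"
    and cons: "\<And>a xs ys. set (a # xs) \<subseteq> I \<Longrightarrow> f xs = f ys \<Longrightarrow> f (a # xs) = f (a # ys)"
  shows "mset xs = mset ys \<Longrightarrow> set xs \<subseteq> I \<Longrightarrow> f xs = f ys"
proof (induction xs arbitrary: ys)
  case (Cons k xs)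
  \<comment> \<open>Any occurrence of a letter can be moved to the front by successive
    swaps.\<close>
  have front: "f zs = f (k # remove1 k zs)" if "k \<in> set zs" "set zs \<subseteq> I" for zs
    using that
  proof (induction zs)
    case (Cons a zs)
    show ?case
    proof (cases "a = k")
      case False
      with Cons have "f (a # zs) = f (a # k # remove1 k zs)" by (intro cons) auto
      also have "\<dots> = f (k # a # remove1 k zs)"
        using Cons.prems set_remove1_subset[of k zs] by (intro swap) auto
      finally show ?thesis using False by simp
    qed simp
  qed simp
  have k: "k \<in> set ys" "set ys \<subseteq> I" using Cons.prems by (metis list.set_intros(1) set_mset_mset, metis set_mset_mset)
  have "f xs = f (remove1 k ys)"
  proof (rule Cons.IH)
    show "mset xs = mset (remove1 k ys)" by (simp add: Cons.prems(1)[symmetric])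
    show "set xs \<subseteq> I" using Cons.prems(2) by simp
  qed
  then have "f (k # xs) = f (k # remove1 k ys)" using Cons.prems by (intro cons) auto
  also have "\<dots> = f ys" using front k by simp
  finally show ?case .
qed simp

lemma exists_sorted_index_list:
  fixes xs :: "(nat \<times> nat) list"
  shows "\<exists>ys. mset ys = mset xs \<and> sorted_wrt (\<lambda>(i, m) (j, n). i < j \<or> i = j \<and> m \<le> n) ys"
proof (induction xs)
  case (Cons k xs)
  define le :: "nat \<times> nat \<Rightarrow> nat \<times> nat \<Rightarrow> bool" where "le = (\<lambda>(i, m) (j, n). i < j \<or> i = j \<and> m \<le> n)"
  obtain ys where ys: "mset ys = mset xs" "sorted_wrt le ys" using Cons unfolding le_def by blast
  define zs where "zs = filter (\<lambda>y. le y k) ys @ k # filter (\<lambda>y. \<not> le y k) ys"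
  have "mset zs = mset (k # xs)" by (simp add: zs_def ys(1)[symmetric])
  moreover have "sorted_wrt le zs"
    using ys(2) by (auto simp: zs_def sorted_wrt_append sorted_wrt_filter) (auto simp: le_def split: prod.splits)
  ultimately show ?case unfolding le_def by blast
qed simp

locale heisenberg_level_zero =
  heisenberg_vertex_algebra scaleH form r e scale G Y vac \<iota> 0
  for scaleH :: "complex \<Rightarrow> 'h :: ab_group_add \<Rightarrow> 'h"
    and form :: "'h \<Rightarrow> 'h \<Rightarrow> complex"
    and r :: nat
    and e :: "nat \<Rightarrow> 'h"
    and scale :: "complex \<Rightarrow> 'v :: ab_group_add \<Rightarrow> 'v" (infixr "\<odot>" 75)
    and G :: "int \<Rightarrow> 'v set"
    and Y :: "'v \<Rightarrow> int \<Rightarrow> 'v \<Rightarrow> 'v"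
    and vac :: 'v
    and \<iota> :: "'h \<Rightarrow> 'v"
begin

abbreviation lin :: "('v \<Rightarrow> 'v) \<Rightarrow> bool" where "lin \<equiv> Vector_Spaces.linear scale scale"

lemma linI:
  assumes "\<And>u v. f (u + v) = f u + f v" "\<And>c u. f (c \<odot> u) = c \<odot> f u"
  shows "lin f"
  using assms vector_space_axioms by (auto simp: Vector_Spaces.linear_iff)

lemma linD:
  assumes "lin f"
  shows lin_add: "f (u + v) = f u + f v" and lin_scale: "f (c \<odot> u) = c \<odot> f u" and lin_0: "f 0 = 0"
    and lin_diff: "f (u - v) = f u - f v" and lin_neg: "f (- u) = - f u"
    and lin_sum: "f (sum g A) = (\<Sum>j\<in>A. f (g j))"
proof -
  interpret Vector_Spaces.linear scale scale f by fact
  show "f (u + v) = f u + f v" "f (c \<odot> u) = c \<odot> f u" "f 0 = 0" "f (u - v) = f u - f v" "f (- u) = - f u"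
    "f (sum g A) = (\<Sum>j\<in>A. f (g j))" by (fact add scale zero diff neg sum)+
qed

lemma functionalD:
  assumes "f \<in> graded_dual"
  shows fun_add: "f (u + v) = f u + f v" and fun_scale: "f (c \<odot> u) = c * f u" and fun_0: "f 0 = 0"
    and fun_diff: "f (u - v) = f u - f v" and fun_neg: "f (- u) = - f u"
    and fun_sum: "f (sum g A) = (\<Sum>j\<in>A. f (g j))"
proof -
  interpret Vector_Spaces.linear scale "(*)" f using assms by (simp add: graded_dual_def)
  show "f (u + v) = f u + f v" "f (c \<odot> u) = c * f u" "f 0 = 0" "f (u - v) = f u - f v" "f (- u) = - f u"
    "f (sum g A) = (\<Sum>j\<in>A. f (g j))" by (fact add scale zero diff neg sum)+
qed

lemmas Y_left = linD[OF Y_linear_left]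
lemmas Y_right = linD[OF Y_linear_right]

subsection \<open>Monomials\<close>

abbreviation gens :: "(nat \<times> nat) set" where "gens \<equiv> {1..r} \<times> {1..}"

definition monomial :: "(nat \<times> nat) list \<Rightarrow> 'v" where
  "monomial xs = foldr (\<lambda>(i, m) w. Y (\<iota> (e i)) (- int m) w) xs vac"

lemma monomial_Nil [simp]: "monomial [] = vac" by (simp add: monomial_def)

definition wt :: "(nat \<times> nat) list \<Rightarrow> int" where "wt xs = (\<Sum>(i, m)\<leftarrow>xs. int m)"

lemma monomials: "inj_on monomial (monomial_indices r)" "independent (monomial ` monomial_indices r)"
    "span (monomial ` monomial_indices r) = UNIV"
  using monomials_inj monomials_independent monomials_span by (simp_all add: monomial_def[abs_def])

lemma monomial_homogeneous: "monomial xs \<in> G (wt xs)"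
proof (induction xs)
  case (Cons k xs)
  have "\<iota> (e (fst k)) \<in> G 1" using \<iota>_bij by (auto simp: bij_betw_def)
  from Y_weight[OF this Cons, of "- int (snd k)"]
  show ?case by (simp add: monomial_def wt_def case_prod_unfold algebra_simps)
qed (simp add: wt_def vac_weight)

text \<open>Grouping the monomial expansion of \<open>v\<close> by weight gives a homogeneous
  decomposition; so does \<open>v\<close> alone in weight n. Uniqueness of the decomposition
  identifies the two.\<close>

lemma homogeneous_span: "v \<in> G n \<Longrightarrow> v \<in> span (monomial ` {xs \<in> monomial_indices r. wt xs = n})"
proof -
  assume v: "v \<in> G n"
  have "v \<in> span (monomial ` monomial_indices r)" by (simp add: monomials)
  then obtain t c where t: "finite t" "t \<subseteq> monomial ` monomial_indices r" "v = (\<Sum>a\<in>t. c a \<odot> a)"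
    unfolding span_explicit by blast
  obtain S where S: "S \<subseteq> monomial_indices r" "finite S" "t = monomial ` S"
    using t(1,2) by (meson finite_subset_image)
  define f where "f d = (\<Sum>xs\<in>{xs \<in> S. wt xs = d}. c (monomial xs) \<odot> monomial xs)" for d
  have f_G: "f d \<in> G d" for d unfolding f_def
    by (intro subspace_sum grading_subspace subspace_scale) (use monomial_homogeneous in auto)
  have nz: "{d. f d \<noteq> 0} \<subseteq> wt ` S"
    unfolding f_def by (auto intro: sum.neutral)
  then have fin: "finite {d. f d \<noteq> 0}" using S(2) finite_subset by blast
  have "v = (\<Sum>xs\<in>S. c (monomial xs) \<odot> monomial xs)"
    unfolding t(3) S(3) by (rule sum.reindex_cong[of monomial]) (use monomials(1) S(1) inj_on_subset in auto)
  also have "\<dots> = (\<Sum>d\<in>wt ` S. f d)" unfolding f_def using S(2) by (simp add: sum.image_gen)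
  also have "\<dots> = (\<Sum>d | f d \<noteq> 0. f d)" using nz S(2) by (intro sum.mono_neutral_right) auto
  finally have 1: "(\<forall>d. f d \<in> G d) \<and> finite {d. f d \<noteq> 0} \<and> v = (\<Sum>d | f d \<noteq> 0. f d)" using f_G fin by blast
  define g where "g d = (if d = n then v else 0)" for d
  have gnz: "{d. g d \<noteq> 0} = (if v = 0 then {} else {n})" by (auto simp: g_def)
  have 2: "(\<forall>d. g d \<in> G d) \<and> finite {d. g d \<noteq> 0} \<and> v = (\<Sum>d | g d \<noteq> 0. g d)"
    unfolding gnz using v grading_subspace by (auto simp: g_def subspace_0)
  from 1 2 grading_direct_sum[of v] have "f = g" by blast
  then have "v = f n" by (simp add: g_def)
  moreover have "f n \<in> span (monomial ` {xs \<in> monomial_indices r. wt xs = n})"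
    unfolding f_def by (intro span_sum span_scale span_base) (use S(1) in auto)
  ultimately show ?thesis by simp
qed

text \<open>The coordinate functionals of the monomial basis belong to the graded dual: each basis
  vector is homogeneous, so its coordinate vanishes on every other weight space.\<close>

lemma graded_dual_separates:
  assumes "\<And>v'. v' \<in> graded_dual \<Longrightarrow> v' u = v' w"
  shows "u = w"
proof -
  define B where "B = monomial ` monomial_indices r"
  have B: "independent B" "span B = UNIV" using monomials by (simp_all add: B_def)
  have "representation B (u - w) b = 0" for b
  proof (cases "b \<in> B")
    case True
    then obtain ys where ys: "ys \<in> monomial_indices r" "b = monomial ys" by (auto simp: B_def)
    define f where "f v = representation B v b" for v
    have lin: "Vector_Spaces.linear scale (*) f"
      unfolding Vector_Spaces.linear_iff f_def
      using B vector_space_axioms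
      by (auto simp: representation_add representation_scale vector_space_over_itself.vector_space_axioms)
    interpret f: Vector_Spaces.linear scale "(*)" f by (rule lin)
    have "f v = 0" if v: "v \<in> G n" and n: "n \<noteq> wt ys" for v n
    proof -
      have "f a = 0" if a: "a \<in> monomial ` {xs \<in> monomial_indices r. wt xs = n}" for a
      proof -
        obtain xs where xs: "xs \<in> monomial_indices r" "wt xs = n" "a = monomial xs" using a by auto
        then have "a \<noteq> b" using n ys monomials(1) by (auto dest: inj_onD)
        then show ?thesis using representation_basis[OF B(1), of a] xs by (simp add: f_def B_def)
      qed
      moreover have "subspace {v. f v = 0}"
        by (auto simp: subspace_def f.zero f.add f.scale)
      ultimately show ?thesis using span_induct[OF homogeneous_span[OF v], of "\<lambda>v. f v = 0"] by simp
    qed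
    then have "{n. \<exists>v\<in>G n. f v \<noteq> 0} \<subseteq> {wt ys}" by auto
    then have "f \<in> graded_dual" using lin finite_subset by (auto simp: graded_dual_def)
    from assms[OF this] have "f (u - w) = 0" by (simp add: f.diff)
    then show ?thesis by (simp add: f_def)
  qed (use representation_ne_zero in blast)
  then have "u - w = 0"
    using sum_nonzero_representation_eq[OF B(1), of "u - w"] B(2) by simp
  then show ?thesis by simp
qed

lemma subspace_UNIV_if_monomials:
  assumes "subspace {v. P v}" "\<And>xs. set xs \<subseteq> gens \<Longrightarrow> P (monomial xs)"
  shows "P v"
proof (rule span_induct[of v "monomial ` monomial_indices r" P])
  show "v \<in> span (monomial ` monomial_indices r)" by (simp add: monomials)
  show "P a" if "a \<in> monomial ` monomial_indices r" for a
    using that assms(2) by (auto simp: monomial_indices_def)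
qed (rule assms(1))

subsection \<open>Commutativity\<close>

text \<open>If \<open>a\<close> has no singular modes on \<open>u\<close>, their correlators have no
  pole at z1 = z2, so both orders of the product have the same coefficients under every
  functional.\<close>

lemma modes_commute_if:
  assumes "\<And>m. m \<ge> 0 \<Longrightarrow> Y a m u = 0"
  shows "Y a m (Y u n v) = Y u n (Y a m v)"
proof (rule graded_dual_separates)
  fix v' assume v': "v' \<in> graded_dual"
  then obtain R where R: "R \<in> rational_functions"
      "product_converges_to (\<lambda>m n. v' (Y a m (Y u n v))) R"
      "product_converges_to (\<lambda>m n. v' (Y u m (Y a n v))) (\<lambda>z2 z1. R z1 z2)"
      "iterate_converges_to (\<lambda>m n. v' (Y (Y a m u) n v)) R"
    using duality[of v' a u v] unfolding graded_dual_def by blast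
  show "v' (Y a m (Y u n v)) = v' (Y u n (Y a m v))"
    by (rule product_coefficients_no_pole(2)[OF R(1,4) _ R(2,3), symmetric])
       (simp add: assms Y_left(3) fun_0[OF v'])
qed

text \<open>At level zero generators have no singular modes on one another. A nonnegative mode of a
  generator therefore moves past all creation modes to the vacuum, which it kills.\<close>

lemma Y_generator_nonneg:
  assumes "n \<ge> 0"
  shows "Y (\<iota> h) n v = 0"
proof (rule subspace_UNIV_if_monomials[where P = "\<lambda>v. Y (\<iota> h) n v = 0"])
  show "subspace {v. Y (\<iota> h) n v = 0}" by (auto simp: subspace_def Y_right)
  have ope: "Y (\<iota> h) m (\<iota> k) = 0" if "m \<ge> 0" for m k
  proof -
    have "m = 0 \<or> m = 1 \<or> m \<ge> 2" using that by linarith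
    then show ?thesis by (auto simp: ope_0 ope_1 ope_ge_2)
  qed
  show "Y (\<iota> h) n (monomial xs) = 0" for xs
  proof (induction xs)
    case (Cons k xs)
    have "Y (\<iota> h) n (monomial (k # xs)) = Y (\<iota> (e (fst k))) (- int (snd k)) (Y (\<iota> h) n (monomial xs))"
      by (simp add: monomial_def case_prod_unfold modes_commute_if[OF ope])
    then show ?case by (simp add: Cons Y_right)
  qed (simp add: creation assms)
qed

text \<open>The creation modes belong to generators, which by now are known to have no singular
  modes on any vector; hence they commute with every \<open>u_n\<close>, and \<open>u_n\<close>
  reaches the vacuum as before.\<close>

lemma Y_nonneg:
  assumes "n \<ge> 0"
  shows "Y u n v = 0"
proof (rule subspace_UNIV_if_monomials[where P = "\<lambda>v. Y u n v = 0"])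
  show "subspace {v. Y u n v = 0}" by (auto simp: subspace_def Y_right)
  show "Y u n (monomial xs) = 0" for xs
  proof (induction xs)
    case (Cons k xs)
    have "Y u n (monomial (k # xs)) = Y (\<iota> (e (fst k))) (- int (snd k)) (Y u n (monomial xs))"
      by (simp add: monomial_def case_prod_unfold modes_commute_if[OF Y_generator_nonneg])
    then show ?case by (simp add: Cons Y_right)
  qed (simp add: creation assms)
qed

lemma modes_commute: "Y u m (Y w n v) = Y w n (Y u m v)"
  by (rule modes_commute_if) (rule Y_nonneg)

text \<open>The normally ordered product. Commuting modes make it commutative and associative with
  unit \<open>vac\<close>, and \<open>D\<close> is a derivation of it.\<close>

definition mult :: "'v \<Rightarrow> 'v \<Rightarrow> 'v" (infixl "\<cdot>" 77) where "u \<cdot> v = Y u (-1) v"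

lemma mult_vac [simp]: "u \<cdot> vac = u" "vac \<cdot> u = u" by (simp_all add: mult_def creation Y_vac)

lemma mult_left_commute: "u \<cdot> (w \<cdot> v) = w \<cdot> (u \<cdot> v)"
  by (simp add: mult_def modes_commute)

lemma mult_commute: "u \<cdot> v = v \<cdot> u"
  using mult_left_commute[of u v vac] by simp

lemma mult_assoc: "u \<cdot> v \<cdot> w = u \<cdot> (v \<cdot> w)"
  by (metis mult_commute mult_left_commute)

lemma lin_mult: "lin (\<lambda>v. u \<cdot> v)" "lin (\<lambda>u. u \<cdot> v)"
  by (simp_all add: mult_def Y_linear_left Y_linear_right)

lemmas mult_right = linD[OF lin_mult(1)]
lemmas mult_left = linD[OF lin_mult(2)]

text \<open>A mode commutes with multiplication by \<open>v\<close>, so it is multiplication by its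
  own value at the vacuum.\<close>

lemma Y_eq_mult: "Y u n v = Y u n vac \<cdot> v"
proof -
  have "Y u n vac \<cdot> v = v \<cdot> Y u n vac" by (rule mult_commute)
  also have "\<dots> = Y u n (v \<cdot> vac)" unfolding mult_def by (rule modes_commute)
  finally show ?thesis by simp
qed

lemma lin_D: "lin D" unfolding D_def by (rule Y_linear_left)

lemmas D_lin = linD[OF lin_D]

abbreviation skew_term :: "('v \<Rightarrow> int \<Rightarrow> 'v \<Rightarrow> 'v) \<Rightarrow> 'v \<Rightarrow> int \<Rightarrow> 'v \<Rightarrow> nat \<Rightarrow> 'v" where
  "skew_term Z u n v j \<equiv> ((-1) powi (n + int j + 1) / fact j) \<odot> (D ^^ j) (Z v (n + int j) u)"

lemma D_vac: "D vac = 0" by (simp add: D_def Y_vac)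

lemma D_Y: "D (Y u n v) = Y u n (D v) + (- of_int n) \<odot> Y u (n - 1) v"
  using D_bracket[of u n v] D_derivative[of u n v] by (simp add: D_def algebra_simps)

lemma Y_D: "Y (D u) n v = (- of_int n) \<odot> Y u (n - 1) v"
  using D_derivative[of u n v] by (simp add: D_def)

lemma D_mult: "D (u \<cdot> v) = D u \<cdot> v + u \<cdot> D v"
  using D_Y[of u "-1" v] Y_D[of u "-1" v] by (simp add: mult_def)

subsection \<open>Freeness\<close>

text \<open>For m >= 1, \<open>gen (i, m)\<close> is D^(m-1) e_i / (m-1)!, and these are the
  polynomial variables. The value at m = 0 is zero, which lets formulas in m run through the
  boundary.\<close>

definition gen :: "nat \<times> nat \<Rightarrow> 'v" where "gen k = Y (\<iota> (e (fst k))) (- int (snd k)) vac"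

lemma monomial_Cons [simp]: "monomial (k # xs) = gen k \<cdot> monomial xs"
  by (simp add: monomial_def gen_def case_prod_unfold Y_eq_mult[symmetric])

lemma gen_homogeneous: "gen (i, m) \<in> G (int m)"
  using monomial_homogeneous[of "[(i, m)]"] by (simp add: wt_def)

lemma D_gen: "D (gen (i, m)) = of_nat m \<odot> gen (i, Suc m)"
  using D_Y[of "\<iota> (e i)" "- int m" vac] by (simp add: gen_def D_vac Y_right minus_diff_commute)

lemma gen_zero: "gen (i, 0) = 0" by (simp add: gen_def Y_nonneg)

lemma gen_one: "gen (i, 1) = \<iota> (e i)" by (simp add: gen_def creation)

lemma free_induct [case_names subspace vac gen]:
  assumes "subspace {v. P v}" "P vac"
    and "\<And>k w n. k \<in> gens \<Longrightarrow> w \<in> G n \<Longrightarrow> P w \<Longrightarrow> P (gen k \<cdot> w)"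
  shows "P v"
proof (rule subspace_UNIV_if_monomials[OF assms(1)])
  show "P (monomial xs)" if "set xs \<subseteq> gens" for xs
    using that by (induction xs) (auto intro!: assms(2,3) monomial_homogeneous)
qed

text \<open>Freeness in the form used throughout: the defect \<open>F k\<close> of a map against
  multiplication by each variable is prescribed, and the symmetry in two variables makes the
  recursion along a word independent of the order. Taking \<open>F k w = h k \<cdot> w\<close> gives
  derivations; \<open>F k w = - B (gen k) w\<close> trivializes a Hochschild cocycle.\<close>

lemma free_extension:
  assumes lin: "\<And>k. k \<in> gens \<Longrightarrow> lin (F k)"
    and sym: "\<And>k l w. k \<in> gens \<Longrightarrow> l \<in> gens \<Longrightarrow> gen k \<cdot> F l w + F k (gen l \<cdot> w) = gen l \<cdot> F k w + F l (gen k \<cdot> w)"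
  obtains f where "lin f" "f vac = 0" "\<And>k w. k \<in> gens \<Longrightarrow> f (gen k \<cdot> w) = gen k \<cdot> f w + F k w"
proof -
  define g where "g = rec_list 0 (\<lambda>k xs w. gen k \<cdot> w + F k (monomial xs))"
  have g: "g [] = 0" "g (k # xs) = gen k \<cdot> g xs + F k (monomial xs)" for k xs by (simp_all add: g_def)
  \<comment> \<open>The monomial is carried along with \<open>g\<close>, because the recursion for
    \<open>g\<close> refers to the monomial of the tail.\<close>
  have perm: "(monomial xs, g xs) = (monomial ys, g ys)" if "mset xs = mset ys" "set xs \<subseteq> gens" for xs ys
    using _ _ that
  proof (rule list_function_of_mset)
    fix a b xs assume "set (a # b # xs) \<subseteq> gens"
    then have "gen a \<cdot> F b (monomial xs) + F a (gen b \<cdot> monomial xs) = gen b \<cdot> F a (monomial xs) + F b (gen a \<cdot> monomial xs)"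
      by (intro sym) auto
    then show "(monomial (a # b # xs), g (a # b # xs)) = (monomial (b # a # xs), g (b # a # xs))"
      by (simp add: g mult_right mult_left_commute[of "gen a"] add.assoc)
  qed (simp add: g)
  interpret VV: vector_space_pair scale scale ..
  obtain f where f: "lin f" "\<forall>b \<in> monomial ` monomial_indices r. f b = g (inv_into (monomial_indices r) monomial b)"
    using VV.linear_independent_extend[OF monomials(2),
        where f = "\<lambda>b. g (inv_into (monomial_indices r) monomial b)"] by blast
  have fm: "f (monomial xs) = g xs" if xs: "set xs \<subseteq> gens" for xs
  proof -
    obtain ys where ys: "mset ys = mset xs" "sorted_wrt (\<lambda>(i, m) (j, n). i < j \<or> i = j \<and> m \<le> n) ys"
      using exists_sorted_index_list by blast
    then have "set ys = set xs" by (metis set_mset_mset)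
    with ys xs have "ys \<in> monomial_indices r" by (simp add: monomial_indices_def)
    then have "f (monomial ys) = g ys" using f(2) monomials(1) by simp
    then show ?thesis using perm[OF ys(1)[symmetric] xs] by simp
  qed
  show thesis
  proof (rule that[OF f(1)])
    show "f vac = 0" using fm[of "[]"] by (simp add: g)
    fix k w assume k: "k \<in> gens"
    show "f (gen k \<cdot> w) = gen k \<cdot> f w + F k w"
    proof (rule subspace_UNIV_if_monomials[where P = "\<lambda>w. f (gen k \<cdot> w) = gen k \<cdot> f w + F k w"])
      show "subspace {w. f (gen k \<cdot> w) = gen k \<cdot> f w + F k w}"
        by (auto simp: subspace_def linD[OF f(1)] linD[OF lin[OF k]] mult_right scale_right_distrib)
      fix xs assume "set xs \<subseteq> gens"
      with k show "f (gen k \<cdot> monomial xs) = gen k \<cdot> f (monomial xs) + F k (monomial xs)"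
        using fm[of xs] fm[of "k # xs"] by (simp add: g)
    qed
  qed
qed

end

section \<open>A recurrence on the quarter plane\<close>

text \<open>From a nonzero \<open>h i j\<close>, pass to the last I >= i with \<open>h I j\<close>
  nonzero. For indices from I on, the first term on the right of the relation vanishes and the left
  factor is positive, so nonvanishing at I and vanishing beyond I both move on to j+1, j+2, and so
  on. This contradicts \<open>col\<close>.\<close>

lemma translation_relation_zero:
  fixes h :: "nat \<Rightarrow> nat \<Rightarrow> complex" and c :: int
  assumes rel: "\<And>i j. int i + int j + c + 1 \<ge> 0 \<Longrightarrow>
      of_int (int i + int j + c + 1) * h i j = of_nat (Suc i) * h (Suc i) j + of_nat (Suc j) * h i (Suc j)"
    and row: "\<And>j. \<exists>K. \<forall>i\<ge>K. h i j = 0" and col: "\<And>i. \<exists>K. \<forall>j\<ge>K. h i j = 0"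
    and ij: "int i + int j + c \<ge> 0"
  shows "h i j = 0"
proof (rule ccontr)
  assume nz: "h i j \<noteq> 0"
  obtain K where K: "\<And>i. i \<ge> K \<Longrightarrow> h i j = 0" using row by blast
  define A where "A = {i'. h i' j \<noteq> 0 \<and> i' \<ge> i}"
  have "A \<subseteq> {..<K}" using K by (auto simp: A_def not_le[symmetric])
  then have fin: "finite A" using finite_subset by blast
  have "i \<in> A" using nz by (simp add: A_def)
  define I where "I = Max A"
  have IA: "I \<in> A" unfolding I_def using fin \<open>i \<in> A\<close> by (intro Max_in) auto
  have above: "h i' j = 0" if "i' > I" for i'
  proof (rule ccontr)
    assume "h i' j \<noteq> 0"
    with that IA have "i' \<in> A" by (auto simp: A_def)
    then have "i' \<le> I" unfolding I_def using fin by simp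
    with that show False by simp
  qed
  have "h I (j + t) \<noteq> 0 \<and> (\<forall>i'>I. h i' (j + t) = 0)" for t
  proof (induction t)
    case 0
    then show ?case using IA above by (simp add: A_def)
  next
    case (Suc t)
    have ge: "int i' + int (j + t) + c + 1 > 0" if "i' \<ge> I" for i' using that IA ij by (simp add: A_def)
    have rel': "of_int (int i' + int (j + t) + c + 1) * h i' (j + t) = of_nat (Suc (j + t)) * h i' (j + Suc t)" if "i' \<ge> I" for i'
      using rel[of i' "j + t"] ge[OF that] Suc that by simp
    have "of_int (int I + int (j + t) + c + 1) * h I (j + t) \<noteq> 0"
      using ge[of I] Suc by (simp only: mult_eq_0_iff of_int_eq_0_iff) simp
    then have "h I (j + Suc t) \<noteq> 0" using rel'[of I] by (metis mult_zero_right order_refl)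
    moreover have "h i' (j + Suc t) = 0" if "i' > I" for i'
      using rel'[of i'] Suc that by (metis less_imp_le mult_eq_0_iff mult_zero_right nat.distinct(1) of_nat_eq_0_iff)
    ultimately show ?case by blast
  qed
  moreover obtain K' where "\<And>j. j \<ge> K' \<Longrightarrow> h I j = 0" using col by blast
  ultimately show False by (metis le_add2)
qed

context heisenberg_level_zero
begin

lemma homogeneous_negative: "n < 0 \<Longrightarrow> G n = {0}"
proof -
  assume n: "n < 0"
  have "wt xs \<ge> 0" for xs unfolding wt_def by (intro sum_list_nonneg) auto
  then have empty: "{xs \<in> monomial_indices r. wt xs = n} = {}" using n by (auto simp: not_le[symmetric])
  have "v = 0" if "v \<in> G n" for v
    using homogeneous_span[OF that] unfolding empty image_empty span_empty by simp
  then have "G n \<subseteq> {0}" by blast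
  then show ?thesis using subspace_0[OF grading_subspace] by auto
qed

lemma lin_maps_homogeneous:
  assumes "lin f" "\<And>xs. set xs \<subseteq> gens \<Longrightarrow> f (monomial xs) \<in> G (wt xs + d)" "v \<in> G n"
  shows "f v \<in> G (n + d)"
proof -
  have "subspace {v. f v \<in> G (n + d)}"
    using subspace_0[OF grading_subspace] subspace_add[OF grading_subspace] subspace_scale[OF grading_subspace]
    by (auto simp: subspace_def linD[OF assms(1)])
  moreover have "f a \<in> G (n + d)" if "a \<in> monomial ` {xs \<in> monomial_indices r. wt xs = n}" for a
    using that assms(2) by (auto simp: monomial_indices_def)
  ultimately show ?thesis
    using span_induct[OF homogeneous_span[OF assms(3)], of "\<lambda>v. f v \<in> G (n + d)"] by blast
qed

lemma gen_mult_homogeneous: "w \<in> G n \<Longrightarrow> gen k \<cdot> w \<in> G (int (snd k) + n)"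
  using Y_weight[OF gen_homogeneous[of "fst k" "snd k"], of w n "-1"] by (simp add: mult_def)

subsection \<open>Derivations\<close>

definition derivation :: "('v \<Rightarrow> 'v) \<Rightarrow> bool" where
  "derivation f \<longleftrightarrow> lin f \<and> (\<forall>u v. f (u \<cdot> v) = f u \<cdot> v + u \<cdot> f v)"

lemma derivation_lin: "derivation f \<Longrightarrow> lin f" by (simp add: derivation_def)

lemma derivation_mult: "derivation f \<Longrightarrow> f (u \<cdot> v) = f u \<cdot> v + u \<cdot> f v" by (simp add: derivation_def)

lemma derivation_vac: "derivation f \<Longrightarrow> f vac = 0"
  using derivation_mult[of f vac vac] by simp

lemma derivation_zeroI:
  assumes "derivation f" "\<And>k. k \<in> gens \<Longrightarrow> f (gen k) = 0"
  shows "f v = 0"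
proof (induction v rule: free_induct)
  case subspace
  show ?case by (auto simp: subspace_def linD[OF derivation_lin[OF assms(1)]])
qed (simp_all add: derivation_mult[OF assms(1)] assms(2) derivation_vac[OF assms(1)] mult_left mult_right)

lemma derivation_exists:
  obtains f where "derivation f" "\<And>k. k \<in> gens \<Longrightarrow> f (gen k) = h k"
proof -
  have sym: "gen k \<cdot> (h l \<cdot> w) + h k \<cdot> (gen l \<cdot> w) = gen l \<cdot> (h k \<cdot> w) + h l \<cdot> (gen k \<cdot> w)" for k l w
    by (simp add: mult_left_commute[of "h k" "gen l"] mult_left_commute[of "h l" "gen k"] add.commute)
  obtain f where f: "lin f" "f vac = 0" "\<And>k w. k \<in> gens \<Longrightarrow> f (gen k \<cdot> w) = gen k \<cdot> f w + h k \<cdot> w"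
    using free_extension[of "\<lambda>k w. h k \<cdot> w", OF lin_mult(1) sym] by blast
  have "f (u \<cdot> v) = f u \<cdot> v + u \<cdot> f v" for u v
  proof (induction u rule: free_induct)
    case subspace
    show ?case by (auto simp: subspace_def linD[OF f(1)] mult_left scale_right_distrib)
  next
    case (gen k w)
    then show ?case by (simp add: mult_assoc f(3) mult_left mult_right)
  qed (simp add: f(2) mult_left)
  then have "derivation f" using f(1) by (simp add: derivation_def)
  moreover have "f (gen k) = h k" if "k \<in> gens" for k
    using f(3)[OF that, of vac] by (simp add: f(2) mult_right)
  ultimately show thesis by (rule that)
qed

text \<open>The divided power D^j / j!, as \<open>D_dd\<close> and \<open>dd_0\<close> show.\<close>

definition dd :: "nat \<Rightarrow> 'v \<Rightarrow> 'v" where "dd j u = Y u (- int j - 1) vac"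

lemma dd_0: "dd 0 u = u" by (simp add: dd_def creation)

lemma D_dd: "D (dd j u) = of_nat (Suc j) \<odot> dd (Suc j) u"
  unfolding dd_def by (subst D_Y) (simp add: D_vac Y_right algebra_simps)

lemma Y_eq_dd: "Y u (- int j - 1) v = dd j u \<cdot> v"
  unfolding dd_def by (rule Y_eq_mult)

lemma dd_homogeneous: "u \<in> G n \<Longrightarrow> dd j u \<in> G (n + int j)"
  using Y_weight[OF _ vac_weight, of u n "- int j - 1"] by (simp add: dd_def)

lemma gen_eq_dd: "gen (i, Suc m) = dd m (\<iota> (e i))"
proof -
  have "- int (Suc m) = - int m - 1" by simp
  then show ?thesis unfolding gen_def dd_def by (simp only: fst_conv snd_conv)
qed

subsection \<open>Cocycles with vanishing singular part\<close>

lemma cocycleD: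
  assumes "Y1 \<in> cocycles"
  shows cocycle_lin_left: "lin (\<lambda>u. Y1 u n v)"
    and cocycle_lin_right: "lin (\<lambda>v. Y1 u n v)"
    and cocycle_weight: "u \<in> G p \<Longrightarrow> v \<in> G q \<Longrightarrow> Y1 u n v \<in> G (p + q - n - 1)"
    and cocycle_vac: "Y1 vac n v = 0" "Y1 u n vac = 0"
    and cocycle_D: "D (Y1 u n v) = Y1 u n (D v) + Y1 (D u) n v"
    and cocycle_D_left: "Y1 (D u) n v = (- of_int n) \<odot> Y1 u (n - 1) v"
    and cocycle_dual: "v' \<in> graded_dual \<Longrightarrow>
      dual_series (\<lambda>m n. v' (Y1 u1 m (Y u2 n v)) + v' (Y u1 m (Y1 u2 n v)))
        (\<lambda>m n. v' (Y1 (Y u1 m u2) n v) + v' (Y (Y1 u1 m u2) n v))"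
    and cocycle_skew: "Y1 u n v = (\<Sum>j | Y1 v (n + int j) u \<noteq> 0.
           skew_term Y1 u n v j)"
proof -
  note c = assms[unfolded cocycles_def mem_Collect_eq]
  show "lin (\<lambda>u. Y1 u n v)" by (rule c[THEN conjunct1, rule_format])
  show "lin (\<lambda>v. Y1 u n v)" by (rule c[THEN conjunct2, THEN conjunct1, rule_format])
  show "u \<in> G p \<Longrightarrow> v \<in> G q \<Longrightarrow> Y1 u n v \<in> G (p + q - n - 1)" by (rule c[THEN conjunct2, THEN conjunct2, THEN conjunct2, THEN conjunct1, rule_format])
  show "Y1 vac n v = 0" "Y1 u n vac = 0"
    by (rule c[THEN conjunct2, THEN conjunct2, THEN conjunct2, THEN conjunct2, THEN conjunct1, rule_format], rule c[THEN conjunct2, THEN conjunct2, THEN conjunct2, THEN conjunct2, THEN conjunct2, THEN conjunct1, rule_format])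
  have "D (Y1 u n v) - Y1 u n (D v) = Y1 (D u) n v"
    by (rule c[THEN conjunct2, THEN conjunct2, THEN conjunct2, THEN conjunct2, THEN conjunct2, THEN conjunct2, THEN conjunct1, rule_format, THEN conjunct1])
  then show "D (Y1 u n v) = Y1 u n (D v) + Y1 (D u) n v" by (simp add: diff_eq_eq add.commute)
  show "Y1 (D u) n v = (- of_int n) \<odot> Y1 u (n - 1) v"
    by (rule c[THEN conjunct2, THEN conjunct2, THEN conjunct2, THEN conjunct2, THEN conjunct2, THEN conjunct2, THEN conjunct1, rule_format, THEN conjunct2])
  show "dual_series (\<lambda>m n. v' (Y1 u1 m (Y u2 n v)) + v' (Y u1 m (Y1 u2 n v)))
        (\<lambda>m n. v' (Y1 (Y u1 m u2) n v) + v' (Y (Y1 u1 m u2) n v))" if "v' \<in> graded_dual"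
    unfolding dual_series_def using that by (rule c[THEN conjunct2, THEN conjunct2, THEN conjunct2, THEN conjunct2, THEN conjunct2, THEN conjunct2, THEN conjunct2, THEN conjunct1, rule_format])
  show "Y1 u n v = (\<Sum>j | Y1 v (n + int j) u \<noteq> 0.
           skew_term Y1 u n v j)"
    by (rule c[THEN conjunct2, THEN conjunct2, THEN conjunct2, THEN conjunct2, THEN conjunct2, THEN conjunct2, THEN conjunct2, THEN conjunct2, rule_format])
qed

text \<open>Without a pole at z1 = z2 only finitely many product coefficients are nonzero. On the
  line m + n = c - 1 with m >= 0, the summand in which a mode of \<open>Y a\<close> acts last is
  zero, so the bound concerns \<open>Y1\<close> alone.\<close>

lemma cocycle_finite_support:
  assumes Y1: "Y1 \<in> cocycles" and ab: "\<And>m. m \<ge> 0 \<Longrightarrow> Y1 a m b = 0" and v': "v' \<in> graded_dual"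
  shows "\<exists>K. \<forall>i\<ge>K. int i + c \<ge> 0 \<longrightarrow> v' (Y1 a (int i + c) (dd i b \<cdot> w)) = 0"
proof -
  define P where "P m n = v' (Y1 a m (Y b n w)) + v' (Y a m (Y1 b n w))" for m n
  obtain R where R: "R \<in> rational_functions" "product_converges_to P R"
    "iterate_converges_to (\<lambda>m n. v' (Y1 (Y a m b) n w) + v' (Y (Y1 a m b) n w)) R"
    using cocycle_dual[OF Y1 v', of a b w] unfolding dual_series_def P_def by blast
  have "finite {(m, n). P m n \<noteq> 0}"
    by (rule product_coefficients_no_pole(1)[OF R(1,3) _ R(2)])
       (simp add: Y_nonneg ab linD(3)[OF cocycle_lin_left[OF Y1]] Y_left fun_0[OF v'])
  moreover have "inj (\<lambda>i. (int i + c, - int i - 1))" by (rule injI) simp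
  ultimately have "finite ((\<lambda>i. (int i + c, - int i - 1)) -` {(m, n). P m n \<noteq> 0})"
    by (rule finite_vimageI)
  then obtain K where "\<forall>i \<in> (\<lambda>i. (int i + c, - int i - 1)) -` {(m, n). P m n \<noteq> 0}. i < K"
    unfolding finite_nat_set_iff_bounded by blast
  then have K: "i < K" if "P (int i + c) (- int i - 1) \<noteq> 0" for i using that by simp
  have "v' (Y1 a (int i + c) (dd i b \<cdot> w)) = 0" if "i \<ge> K" "int i + c \<ge> 0" for i
  proof -
    have "P (int i + c) (- int i - 1) = 0" using K[of i] that(1) by fastforce
    then show ?thesis using that(2) by (simp add: P_def Y_eq_dd Y_nonneg fun_0[OF v'])
  qed
  then show ?thesis by blast
qed

lemma cocycle_singular_dd:
  assumes Y1: "Y1 \<in> cocycles" and ab: "\<And>m. m \<ge> 0 \<Longrightarrow> Y1 a m b = 0"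
  shows "m \<ge> 0 \<Longrightarrow> Y1 a m (dd i b) = 0"
proof (induction i arbitrary: m)
  case (Suc i)
  have "of_nat (Suc i) \<odot> Y1 a m (dd (Suc i) b) = Y1 a m (D (dd i b))"
    by (simp add: D_dd linD[OF cocycle_lin_right[OF Y1]] del: of_nat_Suc)
  also have "\<dots> = D (Y1 a m (dd i b)) + of_int m \<odot> Y1 a (m - 1) (dd i b)"
    using cocycle_D[OF Y1, of a m "dd i b"] cocycle_D_left[OF Y1, of a m "dd i b"] by simp
  \<comment> \<open>At m = 0 the mode m - 1 lies outside the induction hypothesis, but its
    coefficient is m.\<close>
  also have "\<dots> = 0"
    using Suc.IH[of m] Suc.IH[of "m - 1"] Suc.prems by (cases "m = 0") (simp_all add: D_lin)
  finally show ?case by (simp del: of_nat_Suc)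
qed (simp add: dd_0 ab)

text \<open>
  Let \<open>d\<close> be the weight of \<open>Y1 a m (dd i b \<cdot> dd j w)\<close>, the claim being known in smaller weights. Applying
  \<open>D\<close> in weight \<open>d - 1\<close> relates the modes of weight \<open>d\<close> by the translation relation above, and the
  absence of poles at \<open>a = b\<close> and at \<open>a = w\<close> makes the rows and columns finite.
\<close>

lemma cocycle_singular_mult:
  assumes Y1: "Y1 \<in> cocycles" and ab: "\<And>m. m \<ge> 0 \<Longrightarrow> Y1 a m b = 0" and aw: "\<And>m. m \<ge> 0 \<Longrightarrow> Y1 a m w = 0"
    and hom: "a \<in> G p" "b \<in> G q" "w \<in> G s"
    and m: "m \<ge> 0"
  shows "Y1 a m (b \<cdot> w) = 0"
proof -
  define W where "W = p + q + s"
  have weight: "Y1 a m (dd i b \<cdot> dd j w) \<in> G (W + int i + int j - m - 1)" for m i j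
  proof -
    have "dd i b \<cdot> dd j w \<in> G ((q + int i) + (s + int j) - (-1) - 1)"
      unfolding mult_def by (intro Y_weight dd_homogeneous hom)
    from cocycle_weight[OF Y1 hom(1) this, of m] show ?thesis by (simp add: W_def algebra_simps)
  qed
  have main: "\<forall>i j m. m \<ge> 0 \<longrightarrow> W + int i + int j - m - 1 < int d \<longrightarrow> Y1 a m (dd i b \<cdot> dd j w) = 0" for d
  proof (induction d)
    case 0
    show ?case
    proof (intro allI impI)
      fix i j m assume "W + int i + int j - m - 1 < int 0"
      then have "G (W + int i + int j - m - 1) = {0}" by (intro homogeneous_negative) simp
      with weight[of m i j] show "Y1 a m (dd i b \<cdot> dd j w) = 0" by simp
    qed
  next
    case (Suc d)
    \<comment> \<open>With this offset, m = i + j + c says exactly that the value of the mode has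
      weight d.\<close>
    define c where "c = W - 1 - int d"
    have "v' (Y1 a (int i + int j + c) (dd i b \<cdot> dd j w)) = 0"
      if v': "v' \<in> graded_dual" and ij: "int i + int j + c \<ge> 0" for v' i j
    proof (rule translation_relation_zero[where h = "\<lambda>i j. v' (Y1 a (int i + int j + c) (dd i b \<cdot> dd j w))" and c = c])
      fix i j :: nat assume ij: "int i + int j + c + 1 \<ge> 0"
      define m where "m = int i + int j + c + 1"
      have "Y1 a m (dd i b \<cdot> dd j w) = 0" using Suc ij by (auto simp: m_def c_def)
      then have "0 = Y1 a m (D (dd i b \<cdot> dd j w)) - of_int m \<odot> Y1 a (m - 1) (dd i b \<cdot> dd j w)"
        using cocycle_D[OF Y1, of a m "dd i b \<cdot> dd j w"] cocycle_D_left[OF Y1, of a m "dd i b \<cdot> dd j w"]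
        by (simp add: D_lin)
      then have "of_int m \<odot> Y1 a (m - 1) (dd i b \<cdot> dd j w)
          = of_nat (Suc i) \<odot> Y1 a m (dd (Suc i) b \<cdot> dd j w) + of_nat (Suc j) \<odot> Y1 a m (dd i b \<cdot> dd (Suc j) w)"
        by (simp add: D_mult D_dd mult_left mult_right linD[OF cocycle_lin_right[OF Y1]] del: of_nat_Suc)
      from arg_cong[OF this, of v']
      show "of_int (int i + int j + c + 1) * v' (Y1 a (int i + int j + c) (dd i b \<cdot> dd j w)) =
        of_nat (Suc i) * v' (Y1 a (int (Suc i) + int j + c) (dd (Suc i) b \<cdot> dd j w)) +
        of_nat (Suc j) * v' (Y1 a (int i + int (Suc j) + c) (dd i b \<cdot> dd (Suc j) w))"
        by (simp add: functionalD[OF v'] m_def algebra_simps)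
    next
      fix j
      obtain K where K: "\<forall>i\<ge>K. int i + (int j + c) \<ge> 0 \<longrightarrow> v' (Y1 a (int i + (int j + c)) (dd i b \<cdot> dd j w)) = 0"
        using cocycle_finite_support[OF Y1 ab v'] by blast
      show "\<exists>K. \<forall>i\<ge>K. v' (Y1 a (int i + int j + c) (dd i b \<cdot> dd j w)) = 0"
        \<comment> \<open>The maximum also forces the mode index to be nonnegative, where K bounds
          the support.\<close>
        by (rule exI[of _ "max K (nat (- (int j + c)))"]) (use K in \<open>auto simp: add.assoc\<close>)
    next
      fix i
      obtain K where K: "\<forall>j\<ge>K. int j + (int i + c) \<ge> 0 \<longrightarrow> v' (Y1 a (int j + (int i + c)) (dd j w \<cdot> dd i b)) = 0"
        using cocycle_finite_support[OF Y1 aw v'] by blast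
      show "\<exists>K. \<forall>j\<ge>K. v' (Y1 a (int i + int j + c) (dd i b \<cdot> dd j w)) = 0"
        by (rule exI[of _ "max K (nat (- (int i + c)))"])
           (use K in \<open>auto simp: add.assoc add.left_commute[of "int i"] mult_commute[of "dd i b"]\<close>)
    qed (rule ij)
    then have "Y1 a (int i + int j + c) (dd i b \<cdot> dd j w) = 0" if "int i + int j + c \<ge> 0" for i j
      using that by (intro graded_dual_separates) (simp add: fun_0)
    then have eq: "Y1 a m (dd i b \<cdot> dd j w) = 0" if "m \<ge> 0" "m = int i + int j + c" for m i j
      using that by blast
    show ?case
    proof (intro allI impI)
      fix i j m assume m: "m \<ge> (0::int)" "W + int i + int j - m - 1 < int (Suc d)"
      show "Y1 a m (dd i b \<cdot> dd j w) = 0"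
      proof (cases "W + int i + int j - m - 1 < int d")
        case False
        then show ?thesis using m by (intro eq) (auto simp: c_def)
      qed (use Suc m in blast)
    qed
  qed
  have "W + int 0 + int 0 - m - 1 < int (nat (W - m))" by simp
  with main m have "Y1 a m (dd 0 b \<cdot> dd 0 w) = 0" by blast
  then show ?thesis by (simp add: dd_0)
qed

text \<open>The passage to products works only in the right argument. It is applied twice: with a
  generator on the left, and, after skew symmetry has exchanged the arguments, with an arbitrary
  monomial on the left.\<close>

lemma cocycle_regular:
  assumes Y1: "Y1 \<in> cocycles"
    and gens: "\<And>i j n. i \<in> {1..r} \<Longrightarrow> j \<in> {1..r} \<Longrightarrow> n \<ge> 0 \<Longrightarrow> Y1 (\<iota> (e i)) n (\<iota> (e j)) = 0"
    and n: "n \<ge> 0"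
  shows "Y1 u n v = 0"
proof -
  have step: "\<forall>n\<ge>0. Y1 a n v = 0"
    if a: "a \<in> G p" and az: "\<And>j n. j \<in> {1..r} \<Longrightarrow> n \<ge> 0 \<Longrightarrow> Y1 a n (\<iota> (e j)) = 0" for a p v
  proof (induction v rule: free_induct)
    case subspace
    show ?case by (auto simp: subspace_def linD[OF cocycle_lin_right[OF Y1]])
  next
    case (gen k w n)
    \<comment> \<open>Since the second index is at least 1, the variable is a divided derivative of
      e_i and \<open>cocycle_singular_dd\<close> applies.\<close>
    have "k = (fst k, Suc (snd k - 1))" "fst k \<in> {1..r}" using gen(1) by (cases k, auto)+
    then obtain i m where k: "k = (i, Suc m)" "i \<in> {1..r}" by blast
    have "Y1 a n (gen k) = 0" if "n \<ge> 0" for n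
      unfolding k gen_eq_dd using az k that by (intro cocycle_singular_dd[OF Y1])
    then show ?case
      using gen k gen_homogeneous[of i "Suc m"] by (auto intro!: cocycle_singular_mult[OF Y1 _ _ a])
  qed (simp add: cocycle_vac[OF Y1])
  have e_hom: "\<iota> (e i) \<in> G 1" for i using \<iota>_bij by (auto simp: bij_betw_def)
  have left: "Y1 (\<iota> (e i)) n v = 0" if "i \<in> {1..r}" "n \<ge> 0" for i n v
    using step[OF e_hom] gens that by blast
  have right: "Y1 u n (\<iota> (e i)) = 0" if "i \<in> {1..r}" "n \<ge> 0" for i n u
    by (subst cocycle_skew[OF Y1]) (use left that in \<open>simp add: D_lin\<close>)
  show ?thesis
  proof (rule subspace_UNIV_if_monomials[where P = "\<lambda>u. Y1 u n v = 0"])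
    show "subspace {u. Y1 u n v = 0}" by (auto simp: subspace_def linD[OF cocycle_lin_left[OF Y1]])
    show "Y1 (monomial xs) n v = 0" for xs
      using step[OF monomial_homogeneous] right n by blast
  qed
qed

text \<open>Only mode -1 carries information, the lower modes following from it by translation
  covariance. Its constant-coefficient identity in (5) is the Hochschild condition, and skew
  symmetry reduces to symmetry of \<open>B\<close>.\<close>

lemma regular_cocycle_is_coboundary:
  assumes Y1: "Y1 \<in> cocycles" and reg: "\<And>u n v. n \<ge> 0 \<Longrightarrow> Y1 u n v = 0"
  shows "Y1 \<in> coboundaries"
proof -
  define B where "B u v = Y1 u (-1) v" for u v
  note B_left = linD[OF cocycle_lin_left[OF Y1, where n = "-1"], folded B_def]
  note B_right = linD[OF cocycle_lin_right[OF Y1, where n = "-1"], folded B_def]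
  have B_sym: "B u v = B v u" for u v
  proof -
    have sub: "{j. Y1 v (-1 + int j) u \<noteq> 0} \<subseteq> {0}"
    proof
      fix j assume j: "j \<in> {j. Y1 v (-1 + int j) u \<noteq> 0}"
      show "j \<in> {0}"
      proof (rule ccontr)
        assume "j \<notin> {0}"
        then have "-1 + int j \<ge> 0" by simp
        with reg j show False by blast
      qed
    qed
    have "B u v = (\<Sum>j | Y1 v (-1 + int j) u \<noteq> 0. ((-1) powi (-1 + int j + 1) / fact j) \<odot> (D ^^ j) (Y1 v (-1 + int j) u))"
      unfolding B_def by (rule cocycle_skew[OF Y1])
    also have "\<dots> = (\<Sum>j\<in>{0}. ((-1) powi (-1 + int j + 1) / fact j) \<odot> (D ^^ j) (Y1 v (-1 + int j) u))"
      by (rule sum.mono_neutral_left) (use sub in auto)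
    finally show ?thesis by (simp add: B_def)
  qed
  \<comment> \<open>Neither expansion has negative powers, so both can be compared at the
    origin.\<close>
  have hoch: "B u (v \<cdot> w) + u \<cdot> B v w = B (u \<cdot> v) w + B u v \<cdot> w" for u v w
  proof (rule graded_dual_separates)
    fix v' assume v': "v' \<in> graded_dual"
    obtain R where R: "product_converges_to (\<lambda>m n. v' (Y1 u m (Y v n w)) + v' (Y u m (Y1 v n w))) R"
      "iterate_converges_to (\<lambda>m n. v' (Y1 (Y u m v) n w) + v' (Y (Y1 u m v) n w)) R"
      using cocycle_dual[OF Y1 v', of u v w] unfolding dual_series_def by blast
    have zero: "Y1 u m 0 = 0" "Y1 0 m v = 0" for u m v
      by (simp_all add: linD[OF cocycle_lin_left[OF Y1]] linD[OF cocycle_lin_right[OF Y1]])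
    have "v' (Y1 u (-1) (Y v (-1) w)) + v' (Y u (-1) (Y1 v (-1) w))
        = v' (Y1 (Y u (-1) v) (-1) w) + v' (Y (Y1 u (-1) v) (-1) w)"
      by (rule constant_coefficients_agree[OF R(1) _ R(2)])
         (auto simp: reg Y_nonneg zero Y_left Y_right fun_0[OF v'])
    then show "v' (B u (v \<cdot> w) + u \<cdot> B v w) = v' (B (u \<cdot> v) w + B u v \<cdot> w)"
      by (simp add: B_def mult_def fun_add[OF v'])
  qed
  have lin: "lin (\<lambda>w. - B (gen k) w)" for k
    by (intro linI) (simp_all add: B_right)
  have sym: "gen k \<cdot> (- B (gen l) w) + (- B (gen k) (gen l \<cdot> w)) = gen l \<cdot> (- B (gen k) w) + (- B (gen l) (gen k \<cdot> w))" for k l w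
  proof -
    have neg: "gen k \<cdot> (- B (gen l) w) + (- B (gen k) (gen l \<cdot> w)) = - (B (gen k) (gen l \<cdot> w) + gen k \<cdot> B (gen l) w)" for k l
      by (simp add: mult_right)
    have "B (gen k) (gen l \<cdot> w) + gen k \<cdot> B (gen l) w = B (gen l) (gen k \<cdot> w) + gen l \<cdot> B (gen k) w"
      unfolding hoch B_sym[of "gen l" "gen k"] mult_commute[of "gen l" "gen k"] ..
    then show ?thesis unfolding neg by simp
  qed
  \<comment> \<open>This recursion is the coboundary equation with first argument
    \<open>gen k\<close> and \<open>\<phi> (gen k) = 0\<close>. Its consistency is
    \<open>hoch\<close> for (k, l) and (l, k), whose right-hand sides agree by symmetry.\<close>
  obtain \<phi> where \<phi>: "lin \<phi>" "\<phi> vac = 0"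
      "\<And>k w. k \<in> gens \<Longrightarrow> \<phi> (gen k \<cdot> w) = gen k \<cdot> \<phi> w + (- B (gen k) w)"
    using free_extension[of "\<lambda>k w. - B (gen k) w", OF lin sym] by blast
  note \<phi>_lin = linD[OF \<phi>(1)]
  have vac0: "B vac v = 0" "B v vac = 0" for v by (simp_all add: B_def cocycle_vac[OF Y1])
  have \<phi>_mult: "\<phi> (u \<cdot> v) = u \<cdot> \<phi> v + \<phi> u \<cdot> v - B u v" for u v
  proof (induction u rule: free_induct)
    case subspace
    show ?case by (auto simp: subspace_def \<phi>_lin mult_left B_left scale_right_distrib scale_right_diff_distrib)
  next
    case (gen k w)
    have "B (gen k \<cdot> w) v = B (gen k) (w \<cdot> v) + gen k \<cdot> B w v - B (gen k) w \<cdot> v"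
      using hoch[of "gen k" w v] by simp
    then show ?case using gen by (simp add: mult_assoc \<phi>(3) mult_left mult_right)
  qed (simp add: \<phi>(2) mult_left vac0)
  have \<phi>_gen: "\<phi> (gen (i, m)) = 0" if "i \<in> {1..r}" for i m
  proof (cases m)
    case 0
    then show ?thesis by (simp add: gen_zero \<phi>_lin)
  next
    case (Suc m')
    then show ?thesis using \<phi>(3)[of "(i, m)" vac] that by (simp add: \<phi>(2) mult_right vac0)
  qed
  have B_D: "D (B u v) = B (D u) v + B u (D v)" for u v
    using cocycle_D[OF Y1, of u "-1" v] by (simp add: B_def)
  \<comment> \<open>The defect of commutation with \<open>D\<close> is a derivation because
    \<open>D\<close> acts on \<open>B\<close> by the Leibniz rule (\<open>B_D\<close>). It kills all
    variables, since \<phi> kills the \<open>gen (i, m)\<close> for every m.\<close>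
  have "derivation (\<lambda>v. \<phi> (D v) - D (\<phi> v))"
    unfolding derivation_def
  proof (intro conjI allI linI)
    fix u v
    show "\<phi> (D (u \<cdot> v)) - D (\<phi> (u \<cdot> v)) = (\<phi> (D u) - D (\<phi> u)) \<cdot> v + u \<cdot> (\<phi> (D v) - D (\<phi> v))"
      by (simp add: D_mult \<phi>_mult \<phi>_lin D_lin B_D mult_left mult_right)
  qed (simp_all add: \<phi>_lin D_lin scale_right_diff_distrib)
  then have "\<phi> (D v) - D (\<phi> v) = 0" for v
    by (rule derivation_zeroI) (auto simp: D_gen \<phi>_lin \<phi>_gen D_lin)
  then have \<phi>_D: "\<phi> (D v) = D (\<phi> v)" for v by simp
  have \<phi>_G: "\<phi> v \<in> G (n + 0)" if "v \<in> G n" for v n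
  proof (rule lin_maps_homogeneous[OF \<phi>(1) _ that])
    show "\<phi> (monomial xs) \<in> G (wt xs + 0)" if "set xs \<subseteq> gens" for xs
      using that
    proof (induction xs)
      case (Cons k xs)
      have "B (gen k) (monomial xs) \<in> G (int (snd k) + wt xs)"
        using cocycle_weight[OF Y1 gen_homogeneous[of "fst k" "snd k"] monomial_homogeneous, of "-1" xs] by (simp add: B_def)
      moreover have "gen k \<cdot> \<phi> (monomial xs) \<in> G (int (snd k) + wt xs)"
        using Cons by (intro gen_mult_homogeneous) simp
      ultimately show ?case
        using Cons.prems subspace_diff[OF grading_subspace] by (simp add: \<phi>(3) wt_def case_prod_unfold)
    qed (simp add: \<phi>(2) subspace_0 grading_subspace)
  qed
  define Y\<phi> where "Y\<phi> u n v = Y (\<phi> u) n v - \<phi> (Y u n v) + Y u n (\<phi> v)" for u n v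
  \<comment> \<open>Replacing \<open>u\<close> by \<open>D u\<close> lowers the mode by one on both
    sides, up to the same nonzero factor.\<close>
  have neg: "Y1 u (- int j - 1) v = Y\<phi> u (- int j - 1) v" for j u v
  proof (induction j arbitrary: u)
    case 0
    show ?case using \<phi>_mult[of u v] by (simp add: Y\<phi>_def B_def mult_def)
  next
    case (Suc j)
    have "of_nat (Suc j) \<odot> Y1 u (- int (Suc j) - 1) v = Y1 (D u) (- int j - 1) v"
      using cocycle_D_left[OF Y1, of u "- int j - 1" v] by (simp add: algebra_simps)
    also have "\<dots> = Y\<phi> (D u) (- int j - 1) v" by (rule Suc.IH)
    also have "\<dots> = of_nat (Suc j) \<odot> Y\<phi> u (- int (Suc j) - 1) v"
      unfolding Y\<phi>_def \<phi>_D Y_D by (simp add: \<phi>_lin algebra_simps)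
    finally show ?case by (simp del: of_nat_Suc)
  qed
  have "Y1 u n v = Y\<phi> u n v" for u n v
  proof (cases "n \<ge> 0")
    case True
    then show ?thesis by (simp add: Y\<phi>_def reg Y_nonneg \<phi>_lin)
  next
    case False
    then show ?thesis using neg[of u "nat (- n - 1)" v] by simp
  qed
  then have "Y1 = Y\<phi>" by blast
  then show ?thesis
    unfolding coboundaries_def mem_Collect_eq Y\<phi>_def[abs_def]
    by (intro exI[of _ \<phi>] conjI allI) (use \<phi>(1,2) \<phi>_D \<phi>_G in auto)
qed

end

section \<open>Resummation of finite double sums\<close>

lemma sum_antidiagonal:
  fixes f :: "nat \<Rightarrow> nat \<Rightarrow> 'a :: comm_monoid_add"
  assumes "\<And>q s. q \<ge> N \<or> s \<ge> L \<Longrightarrow> f q s = 0"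
  shows "(\<Sum>q<N + L. \<Sum>s\<le>q. f (q - s) s) = (\<Sum>q<N. \<Sum>s<L. f q s)"
proof -
  have "(\<Sum>q<N + L. \<Sum>s\<le>q. f (q - s) s) = (\<Sum>(q, s)\<in>(SIGMA q:{..<N + L}. {..q}). f (q - s) s)"
    by (rule sum.Sigma) auto
  also have "\<dots> = (\<Sum>(q, s)\<in>{(q, s). q + s < N + L}. f q s)"
    by (rule sum.reindex_bij_witness[of _ "\<lambda>(q, s). (q + s, s)" "\<lambda>(q, s). (q - s, s)"]) auto
  also have "\<dots> = (\<Sum>(q, s)\<in>{..<N} \<times> {..<L}. f q s)"
  proof (rule sum.mono_neutral_right)
    show "finite {(q, s). q + s < N + L}"
      by (rule finite_subset[of _ "{..<N + L} \<times> {..<N + L}"]) auto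
    show "\<forall>i\<in>{(q, s). q + s < N + L} - {..<N} \<times> {..<L}. (case i of (q, s) \<Rightarrow> f q s) = 0"
      using assms by (clarsimp) (meson not_less)
  qed auto
  also have "\<dots> = (\<Sum>q<N. \<Sum>s<L. f q s)" by (rule sum.cartesian_product[symmetric])
  finally show ?thesis .
qed

lemma Suc_div_fact_Suc: "of_nat (Suc s) / fact (Suc s) = (1 / fact s :: complex)"
  by (simp del: of_nat_Suc)

lemma sum_truncate:
  fixes f :: "nat \<Rightarrow> 'a :: comm_monoid_add"
  assumes "\<And>q. q \<ge> N \<Longrightarrow> f q = 0" "N \<le> M"
  shows "sum f {..<M} = sum f {..<N}"
  by (rule sum.mono_neutral_right) (use assms in \<open>auto simp: not_less\<close>)

context heisenberg_level_zero
begin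

section \<open>Cocycles from pairs of families of derivations\<close>

text \<open>Serves the Leibniz expansion of \<open>family_mode\<close>: summation over q becomes
  summation over (q - s, s), and N + L is a range large enough to contain the whole support.\<close>

lemma sum_Leibniz:
  assumes g: "\<And>q. lin (g q)" and A: "\<And>q. q \<ge> N \<Longrightarrow> A q = 0"
    and W: "\<And>q s. q \<ge> N \<or> s \<ge> L \<Longrightarrow> W q s = 0"
  shows "(\<Sum>q<N + L. g q (A q + (\<Sum>s\<le>q. (1 / fact s) \<odot> W (q - s) s)))
    = (\<Sum>q<N. g q (A q) + (\<Sum>s<L. (1 / fact s) \<odot> g (q + s) (W q s)))"
proof -
  define f where "f q s = (1 / fact s) \<odot> g (q + s) (W q s)" for q s
  have "g q (A q + (\<Sum>s\<le>q. (1 / fact s) \<odot> W (q - s) s)) = g q (A q) + (\<Sum>s\<le>q. f (q - s) s)" for q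
    by (simp add: linD[OF g] f_def)
  then have "(\<Sum>q<N + L. g q (A q + (\<Sum>s\<le>q. (1 / fact s) \<odot> W (q - s) s)))
    = (\<Sum>q<N + L. g q (A q)) + (\<Sum>q<N + L. \<Sum>s\<le>q. f (q - s) s)"
    by (simp only: sum.distrib)
  also have "(\<Sum>q<N + L. g q (A q)) = (\<Sum>q<N. g q (A q))"
    by (rule sum_truncate) (simp_all add: A linD[OF g])
  also have "(\<Sum>q<N + L. \<Sum>s\<le>q. f (q - s) s) = (\<Sum>q<N. \<Sum>s<L. f q s)"
    by (rule sum_antidiagonal) (simp add: f_def W linD[OF g])
  finally show ?thesis by (simp only: f_def sum.distrib)
qed

text \<open>The model is the sequence of partial derivatives with respect to D^s e_i in a
  differential polynomial algebra, for which c = -1. The offset c measures the weight of what is put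
  in place of e_i.\<close>

definition shift_family :: "int \<Rightarrow> (nat \<Rightarrow> 'v \<Rightarrow> 'v) \<Rightarrow> bool" where
  "shift_family c \<alpha> \<longleftrightarrow> (\<forall>s. derivation (\<alpha> s)) \<and>
     (\<forall>s u. \<alpha> s (D u) = D (\<alpha> s u) + (if s = 0 then 0 else \<alpha> (s - 1) u)) \<and>
     (\<forall>u. \<exists>N. \<forall>s\<ge>N. \<alpha> s u = 0) \<and>
     (\<forall>s n. \<forall>u\<in>G n. \<alpha> s u \<in> G (n - int s + c))"

lemma shift_familyD:
  assumes "shift_family c \<alpha>"
  shows family_derivation: "derivation (\<alpha> s)"
    and family_D: "\<alpha> s (D u) = D (\<alpha> s u) + (if s = 0 then 0 else \<alpha> (s - 1) u)"
    and family_bound: "\<exists>N. \<forall>s\<ge>N. \<alpha> s u = 0"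
    and family_weight: "u \<in> G n \<Longrightarrow> \<alpha> s u \<in> G (n - int s + c)"
  using assms unfolding shift_family_def by blast+

lemmas family_lin = linD[OF derivation_lin[OF family_derivation]]

lemma family_common_bound:
  assumes "shift_family c \<alpha>" "finite U"
  obtains N where "\<And>s u. u \<in> U \<Longrightarrow> s \<ge> N \<Longrightarrow> \<alpha> s u = 0"
proof -
  obtain b where b: "\<And>u s. s \<ge> b u \<Longrightarrow> \<alpha> s u = 0" using family_bound[OF assms(1)] by metis
  show thesis
  proof (rule that[of "Max (insert 0 (b ` U))"])
    fix s u assume "u \<in> U" "s \<ge> Max (insert 0 (b ` U))"
    moreover have "b u \<le> Max (insert 0 (b ` U))" using assms(2) \<open>u \<in> U\<close> by (intro Max_ge) auto
    ultimately show "\<alpha> s u = 0" by (intro b) simp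
  qed
qed

text \<open>Moving \<open>\<alpha> q\<close> past D^j / j! gives the sum over s of (1/s!)
  D^(j-s)/(j-s)! applied after \<open>\<alpha> (q - s)\<close>. The terms with s > j are zero
  because their modes are nonnegative.\<close>

lemma family_mode:
  assumes "shift_family c \<alpha>"
  shows "\<alpha> q (Y u n v) = Y u n (\<alpha> q v) + (\<Sum>s\<le>q. (1 / fact s) \<odot> Y (\<alpha> (q - s) u) (n + int s) v)"
proof -
  have vac: "\<alpha> q (dd j u) = (\<Sum>s\<le>q. (1 / fact s) \<odot> Y (\<alpha> (q - s) u) (- int j - 1 + int s) vac)" for q j u
  proof (induction j arbitrary: q)
    case 0
    have "(\<Sum>s\<le>q. (1 / fact s) \<odot> Y (\<alpha> (q - s) u) (- int 0 - 1 + int s) vac)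
        = (\<Sum>s\<in>{0}. (1 / fact s) \<odot> Y (\<alpha> (q - s) u) (- int 0 - 1 + int s) vac)"
      by (rule sum.mono_neutral_right) (auto simp: Y_nonneg)
    then show ?case by (simp add: dd_0 creation)
  next
    case (Suc j)
    define n where "n = - int j - 1"
    define t where "t s = Y (\<alpha> (q - s) u) (n - 1 + int s) vac" for s
    have n: "of_nat (Suc j) = - (of_int n :: complex)" by (simp add: n_def)
    have "of_nat (Suc j) \<odot> \<alpha> q (dd (Suc j) u) = \<alpha> q (D (dd j u))"
      by (simp add: D_dd family_lin[OF assms])
    also have "\<dots> = D (\<alpha> q (dd j u)) + (if q = 0 then 0 else \<alpha> (q - 1) (dd j u))"
      by (rule family_D[OF assms])
    also have "D (\<alpha> q (dd j u)) = (\<Sum>s\<le>q. (- of_int (n + int s) / fact s) \<odot> t s)"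
      unfolding Suc.IH n_def[symmetric] D_lin t_def
      by (intro sum.cong refl) (simp add: D_Y D_vac Y_right diff_add_eq D_lin)
    also have "(if q = 0 then 0 else \<alpha> (q - 1) (dd j u)) = (\<Sum>s\<le>q. (of_nat s / fact s) \<odot> t s)"
    proof (cases q)
      case (Suc q')
      have "(\<Sum>s\<le>q. (of_nat s / fact s) \<odot> t s) = (\<Sum>s\<le>q'. (of_nat (Suc s) / fact (Suc s)) \<odot> t (Suc s))"
        unfolding Suc by (subst sum.atMost_Suc_shift) simp
      also have "\<dots> = (\<Sum>s\<le>q'. (1 / fact s) \<odot> Y (\<alpha> (q' - s) u) (n + int s) vac)"
        unfolding Suc_div_fact_Suc
        by (intro sum.cong refl) (simp add: t_def Suc)
      finally show ?thesis unfolding Suc.IH n_def[symmetric] by (simp add: Suc)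
    qed simp
    also have "(\<Sum>s\<le>q. (- of_int (n + int s) / fact s) \<odot> t s) + (\<Sum>s\<le>q. (of_nat s / fact s) \<odot> t s)
       = of_nat (Suc j) \<odot> (\<Sum>s\<le>q. (1 / fact s) \<odot> t s)"
      unfolding n sum.distrib[symmetric] scale_sum_right scale_left_distrib[symmetric]
      by (intro sum.cong refl) (simp add: add_divide_distrib[symmetric])
    finally have "\<alpha> q (dd (Suc j) u) = (\<Sum>s\<le>q. (1 / fact s) \<odot> t s)" by (simp del: of_nat_Suc)
    then show ?case by (simp add: t_def n_def algebra_simps)
  qed
  show ?thesis
  proof (cases "n \<ge> 0")
    case True
    then show ?thesis by (simp add: Y_nonneg family_lin[OF assms])
  next
    case False
    define j where "j = nat (- n - 1)"
    have n: "n = - int j - 1" using False by (simp add: j_def)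
    have "\<alpha> q (Y u n v) = \<alpha> q (dd j u) \<cdot> v + Y u n (\<alpha> q v)"
      by (simp add: n Y_eq_dd derivation_mult[OF family_derivation[OF assms]])
    also have "\<alpha> q (dd j u) \<cdot> v = (\<Sum>s\<le>q. (1 / fact s) \<odot> Y (\<alpha> (q - s) u) (n + int s) v)"
      unfolding vac mult_left n[symmetric] Y_eq_mult[symmetric] ..
    finally show ?thesis by (simp add: add.commute)
  qed
qed

definition family_order :: "(nat \<Rightarrow> 'v \<Rightarrow> 'v) \<Rightarrow> 'v \<Rightarrow> nat" where
  "family_order \<alpha> u = (LEAST N. \<forall>s\<ge>N. \<alpha> s u = 0)"

text \<open>
  The series is \<open>\<Sum>\<^sub>p\<^sub>,\<^sub>q (e\<^bsup>xD\<^esup> \<alpha>\<^sub>p u) (\<beta>\<^sub>q v) \<partial>\<^sub>z\<^bsup>p\<^esup> \<partial>\<^sub>w\<^bsup>q\<^esup> (z - w)\<^bsup>-1\<^esup>\<close> at \<open>z = x\<close>, \<open>w = 0\<close>: a bidifferential operator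
  with one contraction.
\<close>

definition contraction :: "(nat \<Rightarrow> 'v \<Rightarrow> 'v) \<Rightarrow> (nat \<Rightarrow> 'v \<Rightarrow> 'v) \<Rightarrow> 'v \<Rightarrow> int \<Rightarrow> 'v \<Rightarrow> 'v" where
  "contraction \<alpha> \<beta> u n v = (\<Sum>p<family_order \<alpha> u. \<Sum>q<family_order \<beta> v.
     ((-1) ^ p * fact (p + q)) \<odot> Y (\<alpha> p u) (n - int (p + q) - 1) (\<beta> q v))"

text \<open>The exact truncation orders vary with the vectors; here any bounds serve, so sums for
  several vectors can be taken over one range.\<close>

lemma contraction_eq:
  assumes "\<And>p. p \<ge> N \<Longrightarrow> \<alpha> p u = 0" "\<And>q. q \<ge> M \<Longrightarrow> \<beta> q v = 0"
  shows "contraction \<alpha> \<beta> u n v = (\<Sum>p<N. \<Sum>q<M.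
     ((-1) ^ p * fact (p + q)) \<odot> Y (\<alpha> p u) (n - int (p + q) - 1) (\<beta> q v))"
proof -
  have 1: "\<forall>s\<ge>family_order \<alpha> u. \<alpha> s u = 0" "family_order \<alpha> u \<le> N"
    unfolding family_order_def by (rule LeastI[of _ N], use assms in blast) (rule Least_le, use assms in blast)
  have 2: "\<forall>s\<ge>family_order \<beta> v. \<beta> s v = 0" "family_order \<beta> v \<le> M"
    unfolding family_order_def by (rule LeastI[of _ M], use assms in blast) (rule Least_le, use assms in blast)
  have "(\<Sum>p<N. \<Sum>q<M. ((-1) ^ p * fact (p + q)) \<odot> Y (\<alpha> p u) (n - int (p + q) - 1) (\<beta> q v))
    = (\<Sum>p<N. \<Sum>q<family_order \<beta> v. ((-1) ^ p * fact (p + q)) \<odot> Y (\<alpha> p u) (n - int (p + q) - 1) (\<beta> q v))"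
    by (intro sum.cong refl sum_truncate) (use 2 in \<open>auto simp: Y_right\<close>)
  also have "\<dots> = contraction \<alpha> \<beta> u n v"
    unfolding contraction_def by (rule sum_truncate) (use 1 in \<open>auto simp: Y_left\<close>)
  finally show ?thesis ..
qed

text \<open>Skew symmetry of \<open>Y\<close> itself: (e^(xD) a) b = e^(xD) (a e^(-xD) b), read off
  coefficient by coefficient. The induction replaces \<open>a\<close> by \<open>D a\<close> and uses
  the Leibniz rule.\<close>

lemma skew_base:
  assumes "J \<ge> nat (- n)"
  shows "Y a n b = (\<Sum>j<J. skew_term Y a n b j)"
proof -
  have lin_pow: "(D ^^ j) (u + v) = (D ^^ j) u + (D ^^ j) v" "(D ^^ j) (c \<odot> u) = c \<odot> (D ^^ j) u"
    "(D ^^ j) (u - v) = (D ^^ j) u - (D ^^ j) v" for j u v c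
    by (induction j arbitrary: u v) (auto simp: D_lin)
  have main: "dd k a \<cdot> b = (\<Sum>j\<le>k. ((-1) ^ (k - j) / fact j) \<odot> (D ^^ j) (dd (k - j) b \<cdot> a))" for k
  proof (induction k arbitrary: a)
    case 0
    show ?case by (simp add: dd_0 mult_commute)
  next
    case (Suc k)
    \<comment> \<open>The Leibniz rule produces \<open>t j\<close> with the weights j/j! and (Suc k
      - j)/j!, which add up to (Suc k)/j!.\<close>
    define t where "t j = ((-1) ^ (Suc k - j)) \<odot> (D ^^ j) (dd (Suc k - j) b \<cdot> a)" for j
    have "of_nat (Suc k) \<odot> (dd (Suc k) a \<cdot> b) = dd k (D a) \<cdot> b"
    proof -
      have "dd k (D a) = of_nat (Suc k) \<odot> dd (Suc k) a"
        unfolding dd_def Y_D by (simp add: algebra_simps)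
      then show ?thesis by (simp add: mult_left)
    qed
    also have "\<dots> = (\<Sum>j\<le>k. ((-1) ^ (k - j) / fact j) \<odot> (D ^^ j) (dd (k - j) b \<cdot> D a))"
      by (rule Suc.IH)
    also have "\<dots> = (\<Sum>j\<le>k. (1 / fact j) \<odot> t (Suc j) + (of_nat (Suc k - j) / fact j) \<odot> t j)"
    proof (rule sum.cong[OF refl])
      fix j assume "j \<in> {..k}"
      then have j: "Suc k - j = Suc (k - j)" by (simp add: Suc_diff_le)
      have "dd (k - j) b \<cdot> D a = D (dd (k - j) b \<cdot> a) - of_nat (Suc (k - j)) \<odot> (dd (Suc (k - j)) b \<cdot> a)"
        by (simp add: D_mult D_dd mult_left del: of_nat_Suc)
      then have "(D ^^ j) (dd (k - j) b \<cdot> D a) = (D ^^ Suc j) (dd (k - j) b \<cdot> a)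
          - of_nat (Suc (k - j)) \<odot> (D ^^ j) (dd (Suc (k - j)) b \<cdot> a)"
        by (simp add: lin_pow funpow_swap1 del: of_nat_Suc)
      then show "((-1) ^ (k - j) / fact j) \<odot> (D ^^ j) (dd (k - j) b \<cdot> D a)
          = (1 / fact j) \<odot> t (Suc j) + (of_nat (Suc k - j) / fact j) \<odot> t j"
        by (simp add: t_def j scale_right_diff_distrib mult.commute del: of_nat_Suc funpow.simps)
    qed
    also have "\<dots> = (\<Sum>j\<le>k. (1 / fact j) \<odot> t (Suc j)) + (\<Sum>j\<le>k. (of_nat (Suc k - j) / fact j) \<odot> t j)"
      by (rule sum.distrib)
    also have "(\<Sum>j\<le>k. (1 / fact j) \<odot> t (Suc j)) = (\<Sum>j\<le>Suc k. (of_nat j / fact j) \<odot> t j)"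
    proof -
      show ?thesis by (subst sum.atMost_Suc_shift) (simp only: Suc_div_fact_Suc, simp)
    qed
    also have "(\<Sum>j\<le>k. (of_nat (Suc k - j) / fact j) \<odot> t j) = (\<Sum>j\<le>Suc k. (of_nat (Suc k - j) / fact j) \<odot> t j)"
      by simp
    also have "(\<Sum>j\<le>Suc k. (of_nat j / fact j) \<odot> t j) + (\<Sum>j\<le>Suc k. (of_nat (Suc k - j) / fact j) \<odot> t j)
       = of_nat (Suc k) \<odot> (\<Sum>j\<le>Suc k. (1 / fact j) \<odot> t j)"
      unfolding sum.distrib[symmetric] scale_sum_right scale_left_distrib[symmetric] scale_scale
    proof (rule sum.cong[OF refl])
      fix j assume "j \<in> {..Suc k}"
      then have "of_nat j + of_nat (Suc k - j) = (of_nat (Suc k) :: complex)"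
        by (subst of_nat_add[symmetric]) simp
      then show "(of_nat j / fact j + of_nat (Suc k - j) / fact j) \<odot> t j = (of_nat (Suc k) * (1 / fact j)) \<odot> t j"
        by (simp only: add_divide_distrib[symmetric]) simp
    qed
    finally have "dd (Suc k) a \<cdot> b = (\<Sum>j\<le>Suc k. (1 / fact j) \<odot> t j)" by (simp only: scale_cancel_left of_nat_eq_0_iff) simp
    then show ?case by (simp add: t_def del: sum.atMost_Suc)
  qed
  show ?thesis
  proof (cases "n \<ge> 0")
    case True
    have "(D ^^ j) 0 = 0" for j by (induction j) (auto simp: D_lin)
    then show ?thesis using True by (simp add: Y_nonneg)
  next
    case False
    define k where "k = nat (- n - 1)"
    have n: "n = - int k - 1" using False by (simp add: k_def)
    have z: "(D ^^ j) 0 = 0" for j by (induction j) (auto simp: D_lin)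
    have "(\<Sum>j<J. skew_term Y a n b j)
      = (\<Sum>j<Suc k. skew_term Y a n b j)"
      by (rule sum_truncate) (use assms in \<open>auto simp: n Y_nonneg z\<close>)
    also have "\<dots> = (\<Sum>j\<le>k. ((-1) ^ (k - j) / fact j) \<odot> (D ^^ j) (dd (k - j) b \<cdot> a))"
      unfolding lessThan_Suc_atMost
    proof (rule sum.cong[OF refl])
      fix j assume "j \<in> {..k}"
      then have j: "n + int j = - int (k - j) - 1" by (simp add: n of_nat_diff)
      then have j': "n + int j + 1 = - int (k - j)" by simp
      have "((-1) powi (- int (k - j)) :: complex) = (-1) ^ (k - j)"
        by (simp only: power_int_minus power_int_of_nat) (simp add: power_inverse[symmetric])
      then show "skew_term Y a n b j
         = ((-1) ^ (k - j) / fact j) \<odot> (D ^^ j) (dd (k - j) b \<cdot> a)"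
        unfolding j' by (simp only: j Y_eq_dd)
    qed
    also have "\<dots> = Y a n b" unfolding n Y_eq_dd by (rule main[symmetric])
    finally show ?thesis ..
  qed
qed

end

text \<open>The offsets must sum to -1 for the contraction to shift weights as a vertex operator
  does: the factors p and q cancel against the pole order p + q + 1 of the kernel.\<close>

locale two_families = heisenberg_level_zero +
  fixes c c' :: int and \<alpha> \<beta> :: "nat \<Rightarrow> 'b \<Rightarrow> 'b"
  assumes \<alpha>: "shift_family c \<alpha>" and \<beta>: "shift_family c' \<beta>" and c: "c + c' = -1"
begin

abbreviation X where "X \<equiv> contraction \<alpha> \<beta>"

text \<open>The coefficient in d_z^p d_w^q (z - w)^(-1) = \<open>cf p q\<close> (z -
  w)^(-p-q-1).\<close>

abbreviation cf :: "nat \<Rightarrow> nat \<Rightarrow> complex" where "cf p q \<equiv> (-1) ^ p * fact (p + q)"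

definition common_bound :: "nat \<Rightarrow> 'b set \<Rightarrow> 'b set \<Rightarrow> bool" where
  "common_bound N U V \<longleftrightarrow> (\<forall>x\<in>U. \<forall>s\<ge>N. \<alpha> s x = 0) \<and> (\<forall>y\<in>V. \<forall>s\<ge>N. \<beta> s y = 0)"

lemma common_bound_exists:
  assumes "finite U" "finite V"
  obtains N where "common_bound N U V"
proof -
  obtain N where N: "\<And>s u. u \<in> U \<Longrightarrow> s \<ge> N \<Longrightarrow> \<alpha> s u = 0" using family_common_bound[OF \<alpha> assms(1)] by blast
  obtain M where M: "\<And>s u. u \<in> V \<Longrightarrow> s \<ge> M \<Longrightarrow> \<beta> s u = 0" using family_common_bound[OF \<beta> assms(2)] by blast
  have "common_bound (max N M) U V" by (simp add: common_bound_def N M)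
  then show thesis by (rule that)
qed

lemma common_boundD:
  assumes "common_bound N U V"
  shows "x \<in> U \<Longrightarrow> s \<ge> N \<Longrightarrow> \<alpha> s x = 0" and "y \<in> V \<Longrightarrow> s \<ge> N \<Longrightarrow> \<beta> s y = 0"
    and "x \<in> U \<Longrightarrow> y \<in> V \<Longrightarrow> X x n y = (\<Sum>p<N. \<Sum>q<N. cf p q \<odot> Y (\<alpha> p x) (n - int (p + q) - 1) (\<beta> q y))"
  using assms contraction_eq[of N \<alpha> x N \<beta> y n] by (auto simp: common_bound_def)

lemma contraction_lin_left: "lin (\<lambda>u. X u n v)"
proof (rule linI)
  fix u u' k
  define U where "U = {u, u', u + u', k \<odot> u}"
  have U: "u \<in> U" "u' \<in> U" "u + u' \<in> U" "k \<odot> u \<in> U" "finite U" by (simp_all add: U_def)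
  have V: "v \<in> {v}" "finite {v}" by simp_all
  obtain N where "common_bound N U {v}" by (rule common_bound_exists[OF U(5) V(2)])
  note N1 = common_boundD(1)[OF this] and N2 = common_boundD(2)[OF this] and N = common_boundD(3)[OF this]
  show "X (u + u') n v = X u n v + X u' n v"
    by (simp add: N U V family_lin[OF \<alpha>] Y_left scale_right_distrib sum.distrib)
  show "X (k \<odot> u) n v = k \<odot> X u n v"
    by (simp add: N U V family_lin[OF \<alpha>] Y_left scale_sum_right mult.left_commute mult.commute)
qed

lemma contraction_lin_right: "lin (\<lambda>v. X u n v)"
proof (rule linI)
  fix v v' k
  define V where "V = {v, v', v + v', k \<odot> v}"
  have V: "v \<in> V" "v' \<in> V" "v + v' \<in> V" "k \<odot> v \<in> V" "finite V" by (simp_all add: V_def)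
  have U: "u \<in> {u}" "finite {u}" by simp_all
  obtain N where "common_bound N {u} V" by (rule common_bound_exists[OF U(2) V(5)])
  note N1 = common_boundD(1)[OF this] and N2 = common_boundD(2)[OF this] and N = common_boundD(3)[OF this]
  show "X u n (v + v') = X u n v + X u n v'"
    by (simp add: N U V family_lin[OF \<beta>] Y_right scale_right_distrib sum.distrib)
  show "X u n (k \<odot> v) = k \<odot> X u n v"
    by (simp add: N U V family_lin[OF \<beta>] Y_right scale_sum_right mult.left_commute mult.commute)
qed

lemma contraction_truncation: "\<exists>N. \<forall>n\<ge>N. X u n v = 0"
proof -
  have fin: "finite {u}" "finite {v}" by simp_all
  obtain N where "common_bound N {u} {v}" by (rule common_bound_exists[OF fin])
  note N1 = common_boundD(1)[OF this] and N2 = common_boundD(2)[OF this] and N = common_boundD(3)[OF this]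
  show ?thesis
  proof (intro exI allI impI)
    fix n :: int assume "n \<ge> int (N + N)"
    then show "X u n v = 0" by (subst N) (auto intro!: sum.neutral simp: Y_nonneg)
  qed
qed

lemma contraction_weight:
  assumes "u \<in> G a" "v \<in> G b"
  shows "X u n v \<in> G (a + b - n - 1)"
proof -
  have "cf p q \<odot> Y (\<alpha> p u) (n - int (p + q) - 1) (\<beta> q v) \<in> G (a + b - n - 1)" for p q
  proof -
    have eq: "(a - int p + c) + (b - int q + c') - (n - int (p + q) - 1) - 1 = a + b - n - 1"
      using c by simp
    from Y_weight[OF family_weight[OF \<alpha> assms(1), of p] family_weight[OF \<beta> assms(2), of q], of "n - int (p + q) - 1"]
    show ?thesis unfolding eq by (rule subspace_scale[OF grading_subspace])
  qed
  then show ?thesis unfolding contraction_def by (intro subspace_sum[OF grading_subspace])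
qed

lemma contraction_vac: "X vac n v = 0" "X u n vac = 0"
proof -
  obtain M where "\<And>q. q \<ge> M \<Longrightarrow> \<beta> q v = 0" using family_bound[OF \<beta>] by blast
  then show "X vac n v = 0"
    by (subst contraction_eq[where N = 0 and M = M]) (auto simp: derivation_vac[OF family_derivation[OF \<alpha>]])
  obtain M where "\<And>q. q \<ge> M \<Longrightarrow> \<alpha> q u = 0" using family_bound[OF \<alpha>] by blast
  then show "X u n vac = 0"
    by (subst contraction_eq[where N = M and M = 0]) (auto simp: derivation_vac[OF family_derivation[OF \<beta>]])
qed

text \<open>Translation invariance of the kernel. The commutators bring in
  \<open>\<alpha> (p - 1)\<close> and \<open>\<beta> (q - 1)\<close>; shifting the index turns them
  into derivatives of the kernel in z and w, which differ only by sign.\<close>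

lemma contraction_D:
  shows contraction_D_left: "X (D u) n v = (- of_int n) \<odot> X u (n - 1) v"
    and contraction_D_bracket: "D (X u n v) - X u n (D v) = X (D u) n v"
proof -
  have fin: "finite {u, D u}" "finite {v, D v}" by simp_all
  obtain N where "common_bound N {u, D u} {v, D v}" by (rule common_bound_exists[OF fin])
  note N1 = common_boundD(1)[OF this] and N2 = common_boundD(2)[OF this] and N = common_boundD(3)[OF this]
  define t where "t p q = cf p q \<odot> Y (\<alpha> p u) (n - int (p + q) - 1 - 1) (\<beta> q v)" for p q
  \<comment> \<open>The ranges go to \<open>Suc N\<close> so that shifted sums can be completed to
    the same range by zero terms.\<close>
  have t0: "t N q = 0" "t p N = 0" for p q by (simp_all add: t_def N1 N2 Y_left Y_right)
  have Xt: "X u (n - 1) v = (\<Sum>p<Suc N. \<Sum>q<Suc N. t p q)"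
    unfolding t_def by (subst contraction_eq[where N = "Suc N" and M = "Suc N"]) (auto simp: N1 N2 algebra_simps)
  have main: "(\<Sum>p<Suc N. \<Sum>q<Suc N. (- of_int (n - int (p + q) - 1)) \<odot> t p q)
      - (\<Sum>p<Suc N. \<Sum>q<Suc N. of_nat (Suc (p + q)) \<odot> t p q) = (- of_int n) \<odot> X u (n - 1) v"
    unfolding Xt sum_subtractf[symmetric] scale_sum_right scale_left_diff_distrib[symmetric]
    by (intro sum.cong refl) (simp add: algebra_simps)
  have "X (D u) n v = (\<Sum>p<Suc N. \<Sum>q<Suc N. cf p q \<odot> Y (\<alpha> p (D u)) (n - int (p + q) - 1) (\<beta> q v))"
    by (intro contraction_eq) (auto simp: N1 N2)
  also have "\<dots> = (\<Sum>p<Suc N. \<Sum>q<Suc N. (- of_int (n - int (p + q) - 1)) \<odot> t p q) +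
     (\<Sum>p<Suc N. \<Sum>q<Suc N. cf p q \<odot> Y (if p = 0 then 0 else \<alpha> (p - 1) u) (n - int (p + q) - 1) (\<beta> q v))"
    unfolding sum.distrib[symmetric] t_def
    by (intro sum.cong refl) (simp add: family_D[OF \<alpha>] Y_left Y_D scale_right_distrib mult.commute)
  also have "(\<Sum>p<Suc N. \<Sum>q<Suc N. cf p q \<odot> Y (if p = 0 then 0 else \<alpha> (p - 1) u) (n - int (p + q) - 1) (\<beta> q v))
      = (\<Sum>p<N. \<Sum>q<Suc N. cf (Suc p) q \<odot> Y (\<alpha> p u) (n - int (Suc p + q) - 1) (\<beta> q v))"
    by (subst sum.lessThan_Suc_shift) (simp add: Y_left)
  also have "\<dots> = (\<Sum>p<N. \<Sum>q<Suc N. - (of_nat (Suc (p + q)) \<odot> t p q))"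
  proof (intro sum.cong refl)
    fix p q
    have "n - int (Suc p + q) - 1 = n - int (p + q) - 1 - 1" by simp
    moreover have "cf (Suc p) q = - (of_nat (Suc (p + q)) * cf p q)" by simp
    ultimately show "cf (Suc p) q \<odot> Y (\<alpha> p u) (n - int (Suc p + q) - 1) (\<beta> q v) = - (of_nat (Suc (p + q)) \<odot> t p q)"
      unfolding t_def by (simp only: scale_scale scale_minus_left)
  qed
  also have "\<dots> = - (\<Sum>p<Suc N. \<Sum>q<Suc N. of_nat (Suc (p + q)) \<odot> t p q)"
    by (simp add: sum_negf t0 del: sum.lessThan_Suc add: sum.lessThan_Suc[of _ N])
  finally have left: "X (D u) n v = (\<Sum>p<Suc N. \<Sum>q<Suc N. (- of_int (n - int (p + q) - 1)) \<odot> t p q) + - (\<Sum>p<Suc N. \<Sum>q<Suc N. of_nat (Suc (p + q)) \<odot> t p q)" .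
  then show "X (D u) n v = (- of_int n) \<odot> X u (n - 1) v" by (rule trans[OF _ trans[OF diff_conv_add_uminus[symmetric] main]])
  have "X u n (D v) = (\<Sum>p<Suc N. \<Sum>q<Suc N. cf p q \<odot> Y (\<alpha> p u) (n - int (p + q) - 1) (\<beta> q (D v)))"
    by (intro contraction_eq) (auto simp: N1 N2)
  also have "\<dots> = (\<Sum>p<Suc N. \<Sum>q<Suc N. cf p q \<odot> Y (\<alpha> p u) (n - int (p + q) - 1) (D (\<beta> q v))) +
     (\<Sum>p<Suc N. \<Sum>q<Suc N. cf p q \<odot> Y (\<alpha> p u) (n - int (p + q) - 1) (if q = 0 then 0 else \<beta> (q - 1) v))"
    unfolding sum.distrib[symmetric]
    by (intro sum.cong refl) (simp add: family_D[OF \<beta>] Y_right scale_right_distrib)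
  also have "(\<Sum>p<Suc N. \<Sum>q<Suc N. cf p q \<odot> Y (\<alpha> p u) (n - int (p + q) - 1) (if q = 0 then 0 else \<beta> (q - 1) v))
      = (\<Sum>p<Suc N. \<Sum>q<Suc N. of_nat (Suc (p + q)) \<odot> t p q)"
  proof (rule sum.cong[OF refl])
    fix p
    have "(\<Sum>q<Suc N. cf p q \<odot> Y (\<alpha> p u) (n - int (p + q) - 1) (if q = 0 then 0 else \<beta> (q - 1) v))
       = (\<Sum>q<N. cf p (Suc q) \<odot> Y (\<alpha> p u) (n - int (p + Suc q) - 1) (\<beta> q v))"
      by (subst sum.lessThan_Suc_shift) (simp add: Y_right)
    also have "\<dots> = (\<Sum>q<N. of_nat (Suc (p + q)) \<odot> t p q)"
    proof (intro sum.cong refl)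
      fix q
      have "n - int (p + Suc q) - 1 = n - int (p + q) - 1 - 1" by simp
      moreover have "cf p (Suc q) = of_nat (Suc (p + q)) * cf p q" by simp
      ultimately show "cf p (Suc q) \<odot> Y (\<alpha> p u) (n - int (p + Suc q) - 1) (\<beta> q v) = of_nat (Suc (p + q)) \<odot> t p q"
        unfolding t_def by (simp only: scale_scale)
    qed
    also have "\<dots> = (\<Sum>q<Suc N. of_nat (Suc (p + q)) \<odot> t p q)" by (simp add: t0)
    finally show "(\<Sum>q<Suc N. cf p q \<odot> Y (\<alpha> p u) (n - int (p + q) - 1) (if q = 0 then 0 else \<beta> (q - 1) v))
       = (\<Sum>q<Suc N. of_nat (Suc (p + q)) \<odot> t p q)" .
  qed
  finally have right: "X u n (D v) = (\<Sum>p<Suc N. \<Sum>q<Suc N. cf p q \<odot> Y (\<alpha> p u) (n - int (p + q) - 1) (D (\<beta> q v)))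
     + (\<Sum>p<Suc N. \<Sum>q<Suc N. of_nat (Suc (p + q)) \<odot> t p q)" .
  have "D (X u n v) = D (\<Sum>p<Suc N. \<Sum>q<Suc N. cf p q \<odot> Y (\<alpha> p u) (n - int (p + q) - 1) (\<beta> q v))"
    by (intro arg_cong[where f = D] contraction_eq) (auto simp: N1 N2)
  also have "\<dots> = (\<Sum>p<Suc N. \<Sum>q<Suc N. cf p q \<odot> Y (\<alpha> p u) (n - int (p + q) - 1) (D (\<beta> q v)))
    + (\<Sum>p<Suc N. \<Sum>q<Suc N. (- of_int (n - int (p + q) - 1)) \<odot> t p q)"
    unfolding sum.distrib[symmetric] t_def D_lin
    by (intro sum.cong refl) (simp add: D_Y scale_right_distrib mult.commute D_lin)
  finally have bracket: "D (X u n v) = (\<Sum>p<Suc N. \<Sum>q<Suc N. cf p q \<odot> Y (\<alpha> p u) (n - int (p + q) - 1) (D (\<beta> q v)))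
    + (\<Sum>p<Suc N. \<Sum>q<Suc N. (- of_int (n - int (p + q) - 1)) \<odot> t p q)" .
  show "D (X u n v) - X u n (D v) = X (D u) n v"
    unfolding bracket right left by (rule trans[OF add_diff_cancel_left diff_conv_add_uminus])
qed

end

section \<open>Skew symmetry and duality of contractions\<close>

lemma fact_add_divide: "fact (k + s) / fact s = (fact k * of_nat (k + s choose s) :: complex)"
  by (simp add: binomial_fact)

context heisenberg_level_zero
begin

lemma lin_D_power: "lin (D ^^ j)"
  by (intro linI; induction j) (simp_all add: D_lin)

lemma sum_nonzero_modes:
  assumes "\<And>n. n \<ge> N \<Longrightarrow> Z v n u = 0" "J \<ge> nat (N - n)"
  shows "(\<Sum>j | Z v (n + int j) u \<noteq> 0. c j \<odot> (D ^^ j) (Z v (n + int j) u))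
    = (\<Sum>j<J. c j \<odot> (D ^^ j) (Z v (n + int j) u))"
proof (rule sum.mono_neutral_left)
  show "{j. Z v (n + int j) u \<noteq> 0} \<subseteq> {..<J}"
  proof
    fix j assume "j \<in> {j. Z v (n + int j) u \<noteq> 0}"
    then have "\<not> n + int j \<ge> N" using assms(1) by auto
    then show "j \<in> {..<J}" using assms(2) by simp
  qed
qed (auto simp: linD[OF lin_D_power])

end

context two_families
begin

text \<open>\<open>skew_base\<close> applies to each pair \<open>\<alpha> q u\<close>,
  \<open>\<beta> p v\<close>, but 1/(z - w) is odd under exchange of the points. A contraction thus
  passes to minus the one with exchanged families, which is why the difference of the two is
  taken.\<close>

lemma contraction_skew:
  "\<exists>J0. \<forall>J\<ge>J0. X u n v = - (\<Sum>j<J. skew_term (contraction \<beta> \<alpha>) u n v j)"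
proof -
  have fin: "finite {u}" "finite {v}" by simp_all
  obtain N where "common_bound N {u} {v}" by (rule common_bound_exists[OF fin])
  note N1 = common_boundD(1)[OF this] and N2 = common_boundD(2)[OF this] and N = common_boundD(3)[OF this]
  have swap: "contraction \<beta> \<alpha> v m u = (\<Sum>p<N. \<Sum>q<N. cf p q \<odot> Y (\<beta> p v) (m - int (p + q) - 1) (\<alpha> q u))" for m
    by (rule contraction_eq) (simp_all add: N1 N2)
  have "X u n v = - (\<Sum>j<J. skew_term (contraction \<beta> \<alpha>) u n v j)"
    if J: "J \<ge> nat (- n) + 2 * N + 1" for J
  proof -
    define w where "w p q j = (D ^^ j) (Y (\<beta> p v) (n - int (p + q) - 1 + int j) (\<alpha> q u))" for p q j
    have "(\<Sum>j<J. skew_term (contraction \<beta> \<alpha>) u n v j)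
       = (\<Sum>j<J. \<Sum>p<N. \<Sum>q<N. (((-1) powi (n + int j + 1) / fact j) * cf p q) \<odot> w p q j)"
    proof (rule sum.cong[OF refl])
      fix j
      have "(D ^^ j) (contraction \<beta> \<alpha> v (n + int j) u) = (\<Sum>p<N. \<Sum>q<N. cf p q \<odot> w p q j)"
        unfolding swap linD[OF lin_D_power] w_def by (intro sum.cong refl) (simp add: algebra_simps)
      then show "skew_term (contraction \<beta> \<alpha>) u n v j
         = (\<Sum>p<N. \<Sum>q<N. (((-1) powi (n + int j + 1) / fact j) * cf p q) \<odot> w p q j)"
        by (simp only: scale_sum_right scale_scale)
    qed
    also have "\<dots> = (\<Sum>p<N. \<Sum>j<J. \<Sum>q<N. (((-1) powi (n + int j + 1) / fact j) * cf p q) \<odot> w p q j)"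
      by (rule sum.swap)
    also have "\<dots> = (\<Sum>p<N. \<Sum>q<N. \<Sum>j<J. (((-1) powi (n + int j + 1) / fact j) * cf p q) \<odot> w p q j)"
      by (intro sum.cong refl sum.swap)
    also have "\<dots> = (\<Sum>p<N. \<Sum>q<N. - (cf q p \<odot> Y (\<alpha> q u) (n - int (q + p) - 1) (\<beta> p v)))"
    proof (intro sum.cong refl)
      fix p q assume pq: "p \<in> {..<N}" "q \<in> {..<N}"
      define n' where "n' = n - int (p + q) - 1"
      \<comment> \<open>The kernel displaces the mode from n to n', and the parity of this
        displacement enters the sign.\<close>
      have sign: "(-1) powi (n + int j + 1) = (-1) ^ (p + q + 1) * ((-1) powi (n' + int j + 1) :: complex)" for j
      proof -
        have eq: "n + int j + 1 = int (p + q + 1) + (n' + int j + 1)" by (simp add: n'_def)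
        have "(-1) powi (int (p + q + 1) + (n' + int j + 1)) = (-1) powi int (p + q + 1) * ((-1) powi (n' + int j + 1) :: complex)"
          by (rule power_int_add) simp
        then show ?thesis unfolding eq[symmetric] power_int_of_nat .
      qed
      have "(\<Sum>j<J. (((-1) powi (n + int j + 1) / fact j) * cf p q) \<odot> w p q j)
        = ((-1) ^ (p + q + 1) * cf p q) \<odot> (\<Sum>j<J. skew_term Y (\<alpha> q u) n' (\<beta> p v) j)"
        unfolding scale_sum_right scale_scale w_def n'_def[symmetric] sign
        by (intro sum.cong refl) (simp add: mult_ac)
      also have "(\<Sum>j<J. skew_term Y (\<alpha> q u) n' (\<beta> p v) j)
          = Y (\<alpha> q u) n' (\<beta> p v)"
        by (rule skew_base[symmetric]) (use J pq in \<open>simp add: n'_def\<close>)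
      also have "(-1) ^ (p + q + 1) * cf p q = - cf q p"
      proof -
        have "(-1) ^ (p + q + 1) * ((-1) ^ p :: complex) = - ((-1) ^ q)"
          by (simp add: power_add power_mult_distrib[symmetric])
        then have "((-1) ^ (p + q + 1) * (-1) ^ p) * fact (p + q) = - ((-1) ^ q) * (fact (p + q) :: complex)" by (simp only:)
        then show ?thesis by (simp only: mult.assoc add.commute[of q p] mult_minus_left)
      qed
      finally show "(\<Sum>j<J. (((-1) powi (n + int j + 1) / fact j) * cf p q) \<odot> w p q j)
         = - (cf q p \<odot> Y (\<alpha> q u) (n - int (q + p) - 1) (\<beta> p v))"
        by (simp only: n'_def scale_minus_left add.commute[of q p])
    qed
    also have "\<dots> = - (\<Sum>q<N. \<Sum>p<N. cf q p \<odot> Y (\<alpha> q u) (n - int (q + p) - 1) (\<beta> p v))"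
      unfolding sum_negf by (subst sum.swap) (rule refl)
    also have "\<dots> = - X u n v" by (subst N) simp_all
    finally show ?thesis by simp
  qed
  then show ?thesis by blast
qed

text \<open>By the Leibniz rule, \<open>\<beta> q\<close> meets \<open>v\<close> or
  \<open>u2\<close>. In the latter case 1/s! turns the factorial of the kernel into the binomial
  coefficient of (z1 - z2)^(-p-q-1) expanded in z2/z1.\<close>

lemma contraction_product:
  assumes "common_bound N {u1, u2} {u2, v}"
  shows "X u1 m (Y u2 n v) = (\<Sum>p<N. \<Sum>q<N. cf p q \<odot>
    (Y (\<alpha> p u1) (m - int (p + q) - 1) (Y u2 n (\<beta> q v)) +
     (\<Sum>s<nat (- n). of_nat (p + q + s choose s) \<odot>
        Y (\<alpha> p u1) (m - int (p + q) - int s - 1) (Y (\<beta> q u2) (n + int s) v))))"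
proof -
  define L where "L = nat (- n)"
  note N = common_boundD(1,2)[OF assms]
  have \<beta>Y: "\<beta> q (Y u2 n v) = Y u2 n (\<beta> q v) + (\<Sum>s\<le>q. (1 / fact s) \<odot> Y (\<beta> (q - s) u2) (n + int s) v)" for q
    by (rule family_mode[OF \<beta>])
  have zero: "Y (\<beta> q u2) (n + int s) v = 0" if "q \<ge> N \<or> s \<ge> L" for q s
    using that by (auto simp: N Y_left Y_nonneg L_def)
  have "X u1 m (Y u2 n v) = (\<Sum>p<N. \<Sum>q<N + L. cf p q \<odot> Y (\<alpha> p u1) (m - int (p + q) - 1) (\<beta> q (Y u2 n v)))"
  proof (rule contraction_eq)
    fix q assume "q \<ge> N + L"
    then have "q - s \<ge> N \<or> s \<ge> L" for s by arith
    then have "Y (\<beta> (q - s) u2) (n + int s) v = 0" for s by (intro zero)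
    with \<open>q \<ge> N + L\<close> show "\<beta> q (Y u2 n v) = 0" by (simp add: \<beta>Y N Y_right)
  qed (simp add: N)
  also have "\<dots> = (\<Sum>p<N. \<Sum>q<N. cf p q \<odot> Y (\<alpha> p u1) (m - int (p + q) - 1) (Y u2 n (\<beta> q v)) +
     (\<Sum>s<L. (1 / fact s) \<odot> (cf p (q + s) \<odot>
        Y (\<alpha> p u1) (m - int (p + (q + s)) - 1) (Y (\<beta> q u2) (n + int s) v))))"
    unfolding \<beta>Y
    by (intro sum.cong refl sum_Leibniz linI) (simp_all add: N zero Y_right scale_right_distrib mult.commute)
  also have "\<dots> = (\<Sum>p<N. \<Sum>q<N. cf p q \<odot> Y (\<alpha> p u1) (m - int (p + q) - 1) (Y u2 n (\<beta> q v)) +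
     (\<Sum>s<L. cf p q \<odot> (of_nat (p + q + s choose s) \<odot>
        Y (\<alpha> p u1) (m - int (p + q) - int s - 1) (Y (\<beta> q u2) (n + int s) v))))"
  proof -
    have "1 / fact s * cf p (q + s) = (-1) ^ p * (fact (p + q + s) / fact s)" for p q s by (simp add: add.assoc)
    then have "1 / fact s * cf p (q + s) = cf p q * of_nat (p + q + s choose s)" for p q s
      unfolding fact_add_divide by (simp only: mult.assoc)
    moreover have "m - int (p + (q + s)) - 1 = m - int (p + q) - int s - 1" for p q s by simp
    ultimately show ?thesis by (simp only: scale_scale)
  qed
  finally show ?thesis
    unfolding L_def by (simp only: scale_right_distrib scale_sum_right)
qed

text \<open>Here \<open>\<alpha> p\<close> meets \<open>u2\<close> or \<open>u1\<close>. In the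
  latter case the points are z1 and 0, and the signed binomials are those of z1^(-p-q-1) expanded in
  (z1 - z2)/z2.\<close>

lemma contraction_iterate:
  assumes "common_bound N {u1, u2} {u2, v}"
  shows "X (Y u1 m u2) n v = (\<Sum>p<N. \<Sum>q<N. cf p q \<odot>
    (Y (Y u1 m (\<alpha> p u2)) (n - int (p + q) - 1) (\<beta> q v) +
     (\<Sum>s<nat (- m). (of_nat (p + q + s choose s) * (-1) ^ s) \<odot>
        Y (Y (\<alpha> p u1) (m + int s) u2) (n - int (p + q) - int s - 1) (\<beta> q v))))"
proof -
  define L where "L = nat (- m)"
  note N = common_boundD(1,2)[OF assms]
  have \<alpha>Y: "\<alpha> p (Y u1 m u2) = Y u1 m (\<alpha> p u2) + (\<Sum>s\<le>p. (1 / fact s) \<odot> Y (\<alpha> (p - s) u1) (m + int s) u2)" for p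
    by (rule family_mode[OF \<alpha>])
  have zero: "Y (\<alpha> p u1) (m + int s) u2 = 0" if "p \<ge> N \<or> s \<ge> L" for p s
    using that by (auto simp: N Y_left Y_nonneg L_def)
  have "X (Y u1 m u2) n v = (\<Sum>p<N + L. \<Sum>q<N. cf p q \<odot> Y (\<alpha> p (Y u1 m u2)) (n - int (p + q) - 1) (\<beta> q v))"
  proof (rule contraction_eq)
    fix p assume "p \<ge> N + L"
    then have "p - s \<ge> N \<or> s \<ge> L" for s by arith
    then have "Y (\<alpha> (p - s) u1) (m + int s) u2 = 0" for s by (intro zero)
    with \<open>p \<ge> N + L\<close> show "\<alpha> p (Y u1 m u2) = 0" by (simp add: \<alpha>Y N Y_right)
  qed (simp add: N)
  also have "\<dots> = (\<Sum>q<N. \<Sum>p<N + L. cf p q \<odot> Y (\<alpha> p (Y u1 m u2)) (n - int (p + q) - 1) (\<beta> q v))"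
    by (rule sum.swap)
  also have "\<dots> = (\<Sum>q<N. \<Sum>p<N. cf p q \<odot> Y (Y u1 m (\<alpha> p u2)) (n - int (p + q) - 1) (\<beta> q v) +
     (\<Sum>s<L. (1 / fact s) \<odot> (cf (p + s) q \<odot>
        Y (Y (\<alpha> p u1) (m + int s) u2) (n - int (p + s + q) - 1) (\<beta> q v))))"
    unfolding \<alpha>Y
    by (intro sum.cong refl sum_Leibniz linI) (simp_all add: N zero Y_left Y_right scale_right_distrib mult.commute)
  also have "\<dots> = (\<Sum>q<N. \<Sum>p<N. cf p q \<odot> Y (Y u1 m (\<alpha> p u2)) (n - int (p + q) - 1) (\<beta> q v) +
     (\<Sum>s<L. cf p q \<odot> ((of_nat (p + q + s choose s) * (-1) ^ s) \<odot>
        Y (Y (\<alpha> p u1) (m + int s) u2) (n - int (p + q) - int s - 1) (\<beta> q v))))"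
  proof -
    have "1 / fact s * cf (p + s) q = (-1) ^ p * (fact (p + q + s) / fact s) * (-1) ^ s" for p q s
      by (simp add: power_add add_ac)
    then have "1 / fact s * cf (p + s) q = cf p q * (of_nat (p + q + s choose s) * (-1) ^ s)" for p q s
      unfolding fact_add_divide by (simp only: mult.assoc)
    moreover have "n - int (p + s + q) - 1 = n - int (p + q) - int s - 1" for p q s by simp
    ultimately show ?thesis by (simp only: scale_scale)
  qed
  finally show ?thesis
    unfolding L_def by (subst sum.swap) (simp only: scale_right_distrib scale_sum_right)
qed

text \<open>
  Writing \<open>\<Pi>\<^sub>i\<^sub>j\<close> for the contraction of the \<open>i\<close>th with the \<open>j\<close>th of the three fields, both double series
  are expansions of \<open>\<Pi>\<^sub>1\<^sub>3 + \<Pi>\<^sub>1\<^sub>2 + \<Pi>\<^sub>2\<^sub>3\<close>; these are correlators of \<open>Y\<close> divided by powers of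
  \<open>z\<^sub>1\<close>, \<open>z\<^sub>1 - z\<^sub>2\<close> and \<open>z\<^sub>2\<close> respectively.
\<close>

lemma contraction_dual:
  assumes v': "v' \<in> graded_dual"
  shows "dual_series (\<lambda>m n. v' (X u1 m (Y u2 n v)) + v' (Y u1 m (X u2 n v)))
    (\<lambda>m n. v' (X (Y u1 m u2) n v) + v' (Y (X u1 m u2) n v))"
proof -
  have base: "dual_series (\<lambda>m n. v' (Y a m (Y b n w))) (\<lambda>m n. v' (Y (Y a m b) n w))" for a b w
    using duality[of v' a b w] v' unfolding dual_series_def graded_dual_def by blast
  have fin: "finite {u1, u2}" "finite {u2, v}" by simp_all
  obtain N where N: "common_bound N {u1, u2} {u2, v}" by (rule common_bound_exists[OF fin])
  define P where "P p q m n = v' (Y (\<alpha> p u1) (m - int (p + q) - 1) (Y u2 n (\<beta> q v)))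
    + (\<Sum>s<nat (- n). of_nat (p + q + s choose s) * v' (Y (\<alpha> p u1) (m - int (p + q) - int s - 1) (Y (\<beta> q u2) (n + int s) v)))
    + v' (Y u1 m (Y (\<alpha> p u2) (n - int (p + q) - 1) (\<beta> q v)))" for p q m n
  define Q where "Q p q m n =
    (\<Sum>s<nat (- m). of_nat (p + q + s choose s) * (-1) ^ s * v' (Y (Y (\<alpha> p u1) (m + int s) u2) (n - int (p + q) - int s - 1) (\<beta> q v)))
    + v' (Y (Y (\<alpha> p u1) (m - int (p + q) - 1) (\<beta> q u2)) n v)
    + v' (Y (Y u1 m (\<alpha> p u2)) (n - int (p + q) - 1) (\<beta> q v))" for p q m n
  have PQ: "dual_series (P p q) (Q p q)" for p q
    unfolding P_def[abs_def] Q_def[abs_def]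
    by (intro dual_series_add dual_series_divide_first[OF base] dual_series_divide_diff[OF base]
          dual_series_divide_second[OF base])
       (simp_all add: Y_nonneg Y_left Y_right fun_0[OF v'])
  have "dual_series (\<lambda>m n. \<Sum>p<N. \<Sum>q<N. cf p q * P p q m n) (\<lambda>m n. \<Sum>p<N. \<Sum>q<N. cf p q * Q p q m n)"
    by (intro dual_series_sum dual_series_scale PQ)
  moreover have "v' (X u1 m (Y u2 n v)) + v' (Y u1 m (X u2 n v)) = (\<Sum>p<N. \<Sum>q<N. cf p q * P p q m n)" for m n
  proof -
    have "Y u1 m (X u2 n v) = (\<Sum>p<N. \<Sum>q<N. cf p q \<odot> Y u1 m (Y (\<alpha> p u2) (n - int (p + q) - 1) (\<beta> q v)))"
      by (simp add: common_boundD(3)[OF N] Y_right)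
    then show ?thesis
      unfolding contraction_product[OF N] P_def
      by (simp only: functionalD[OF v'] sum.distrib[symmetric] distrib_left[symmetric])
  qed
  moreover have "v' (X (Y u1 m u2) n v) + v' (Y (X u1 m u2) n v) = (\<Sum>p<N. \<Sum>q<N. cf p q * Q p q m n)" for m n
  proof -
    have "Y (X u1 m u2) n v = (\<Sum>p<N. \<Sum>q<N. cf p q \<odot> Y (Y (\<alpha> p u1) (m - int (p + q) - 1) (\<beta> q u2)) n v)"
      by (simp add: common_boundD(3)[OF N] Y_left)
    then show ?thesis
      unfolding contraction_iterate[OF N] Q_def
      by (simp only: functionalD[OF v'] sum.distrib[symmetric] distrib_left[symmetric] add_ac)
  qed
  ultimately show ?thesis by simp
qed

text \<open>Every cocycle condition except skew symmetry holds for each contraction separately; the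
  difference restores the sign in \<open>contraction_skew\<close>.\<close>

lemma antisymmetrized_contraction_cocycle:
  "(\<lambda>u n v. X u n v - contraction \<beta> \<alpha> u n v) \<in> cocycles"
proof -
  interpret S: two_families scaleH form r e scale G Y vac \<iota> c' c \<beta> \<alpha>
    by unfold_locales (use \<alpha> \<beta> c in auto)
  define Z where "Z u n v = X u n v - S.X u n v" for u n v
  have left: "lin (\<lambda>u. Z u n v)" for n v
    unfolding Z_def
    by (rule linI) (simp_all add: linD[OF contraction_lin_left] linD[OF S.contraction_lin_left] scale_right_diff_distrib)
  have right: "lin (\<lambda>v. Z u n v)" for u n
    unfolding Z_def
    by (rule linI) (simp_all add: linD[OF contraction_lin_right] linD[OF S.contraction_lin_right] scale_right_diff_distrib)
  have trunc: "\<exists>N. \<forall>n\<ge>N. Z u n v = 0" for u v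
  proof -
    obtain N N' where "\<forall>n\<ge>N. X u n v = 0" "\<forall>n\<ge>N'. S.X u n v = 0"
      using contraction_truncation S.contraction_truncation by blast
    then have "\<forall>n\<ge>max N N'. Z u n v = 0" by (simp add: Z_def)
    then show ?thesis by blast
  qed
  have weight: "Z u n v \<in> G (p + q - n - 1)" if "u \<in> G p" "v \<in> G q" for u v p q n
    unfolding Z_def
    by (intro subspace_diff[OF grading_subspace] contraction_weight S.contraction_weight that)
  have "D (Z u n v) - Z u n (D v) = (D (X u n v) - X u n (D v)) - (D (S.X u n v) - S.X u n (D v))" for u n v
    by (simp add: Z_def D_lin)
  then have D: "D (Z u n v) - Z u n (D v) = Z (D u) n v" for u n v
    unfolding contraction_D_bracket S.contraction_D_bracket by (simp only: Z_def)
  have D': "Z (D u) n v = (- of_int n) \<odot> Z u (n - 1) v" for u n v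
    by (simp only: Z_def contraction_D_left S.contraction_D_left scale_right_diff_distrib)
  have dual: "dual_series (\<lambda>m n. v' (Z u1 m (Y u2 n v)) + v' (Y u1 m (Z u2 n v)))
      (\<lambda>m n. v' (Z (Y u1 m u2) n v) + v' (Y (Z u1 m u2) n v))" if v': "v' \<in> graded_dual" for v' u1 u2 v
    using dual_series_add[OF contraction_dual[OF v', of u1 u2 v] dual_series_scale[OF S.contraction_dual[OF v', of u1 u2 v], of "-1"]]
    by (simp add: Z_def functionalD[OF v'] Y_left Y_right algebra_simps)
  have skew: "Z u n v = (\<Sum>j | Z v (n + int j) u \<noteq> 0. skew_term Z u n v j)" for u n v
  proof -
    obtain J1 where J1: "\<And>J. J \<ge> J1 \<Longrightarrow> X u n v = - (\<Sum>j<J. skew_term S.X u n v j)"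
      using contraction_skew by blast
    obtain J2 where J2: "\<And>J. J \<ge> J2 \<Longrightarrow> S.X u n v = - (\<Sum>j<J. skew_term X u n v j)"
      using S.contraction_skew by blast
    obtain N where N: "\<And>n. n \<ge> N \<Longrightarrow> Z v n u = 0" using trunc by blast
    \<comment> \<open>One range long enough for both contractions and for the support of
      \<open>Z\<close>.\<close>
    define J where "J = J1 + J2 + nat (N - n)"
    have "Z u n v = (\<Sum>j<J. skew_term Z u n v j)"
      unfolding Z_def J1[of J, unfolded J_def, simplified, folded J_def] J2[of J, unfolded J_def, simplified, folded J_def]
      by (simp add: linD[OF lin_D_power] scale_right_diff_distrib sum_subtractf)
    also have "\<dots> = (\<Sum>j | Z v (n + int j) u \<noteq> 0. skew_term Z u n v j)"
      by (rule sum_nonzero_modes[symmetric, where N = N]) (erule N, simp only: J_def le_add2)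
    finally show ?thesis .
  qed
  have "Z \<in> cocycles"
    unfolding cocycles_def mem_Collect_eq
  proof (intro conjI allI ballI)
    show "Z vac n v = 0" "Z u n vac = 0" for u n v
      by (simp_all add: Z_def contraction_vac S.contraction_vac)
    show "\<exists>R\<in>rational_functions. product_converges_to (\<lambda>m n. v' (Z u1 m (Y u2 n v)) + v' (Y u1 m (Z u2 n v))) R \<and>
       iterate_converges_to (\<lambda>m n. v' (Z (Y u1 m u2) n v) + v' (Y (Z u1 m u2) n v)) R" if "v' \<in> graded_dual" for v' u1 u2 v
      using dual[OF that, of u1 u2 v] unfolding dual_series_def .
  qed (fact left right trunc weight D D' skew)+
  then show ?thesis by (simp add: Z_def[abs_def])
qed

end

section \<open>The dimension count\<close>

lemma choose_two_sum: "(Suc r choose 2) = \<Sum>{1..r}" "(r choose 2) = (\<Sum>j = 1..r. j - 1)"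
  by (induction r) (simp_all add: numeral_2_eq_2)

text \<open>The entries a_ij with i < j and the M_ij^k with i < j number binom(r,2) (r + 1) = 3
  binom(r+1, 3). The diagonal entries a_ii add r.\<close>

lemma dimension_identity: "(r + 1 choose 2) + (r choose 2) * r = 3 * (r + 1 choose 3) + r"
proof (induction r)
  case (Suc r)
  have 2: "(Suc (Suc r) choose 2) = Suc r + (Suc r choose 2)" "(Suc r choose 2) = r + (r choose 2)"
    and 3: "(Suc (Suc r) choose 3) = (Suc r choose 2) + (Suc r choose 3)"
    by (simp_all add: numeral_2_eq_2 numeral_3_eq_3)
  have "even (r * (r - 1))" by (cases r) auto
  then have "2 * (r choose 2) = r * (r - 1)" by (simp only: choose_two dvd_mult_div_cancel)
  then have "2 * (r choose 2) + r = r * r" by (cases r) auto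
  then show ?case using Suc by (simp add: 2 3 algebra_simps)
qed (simp add: numeral_2_eq_2 numeral_3_eq_3)

section \<open>Explicit families of derivations and the basic cocycles\<close>

context heisenberg_level_zero
begin

text \<open>T imitates the sequence \<open>gen (i, m)\<close>: \<open>\<alpha> 0\<close> commutes
  with \<open>D\<close> and puts T in place of e_i with its derivatives, while
  \<open>\<alpha> s\<close> lowers the index by s. For s >= m truncated subtraction meets
  \<open>T 0 = 0\<close>, which gives finiteness.\<close>

lemma derivation_family_exists:
  assumes T0: "T 0 = 0" and TD: "\<And>m. D (T m) = of_nat m \<odot> T (Suc m)"
    and TG: "\<And>m. m \<ge> 1 \<Longrightarrow> T m \<in> G (int m + c)"
  obtains \<alpha> where "shift_family c \<alpha>"
    "\<And>s j m. j \<in> {1..r} \<Longrightarrow> \<alpha> s (gen (j, m)) = (if j = i then (1 / fact s) \<odot> T (m - s) else 0)"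
proof -
  define h where "h s k = (if fst k = i then (1 / fact s :: complex) \<odot> T (snd k - s) else 0)" for s :: nat and k :: "nat \<times> nat"
  have "\<exists>f. derivation f \<and> (\<forall>k\<in>gens. f (gen k) = h s k)" for s
    by (rule derivation_exists[of "h s"]) blast
  then have "\<exists>\<alpha>. \<forall>s. derivation (\<alpha> s) \<and> (\<forall>k\<in>gens. \<alpha> s (gen k) = h s k)" by (intro choice allI)
  then obtain \<alpha> where \<alpha>: "\<And>s. derivation (\<alpha> s)" "\<And>s k. k \<in> gens \<Longrightarrow> \<alpha> s (gen k) = h s k"
    by blast
  note lin = linD[OF derivation_lin[OF \<alpha>(1)]]
  have \<alpha>gen: "\<alpha> s (gen (j, m)) = (if j = i then (1 / fact s) \<odot> T (m - s) else 0)" if "j \<in> {1..r}" for s j m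
  proof (cases m)
    case 0
    then show ?thesis by (simp add: gen_zero lin T0)
  next
    case (Suc m')
    then show ?thesis using \<alpha>(2)[of "(j, m)" s] that by (simp add: h_def)
  qed
  \<comment> \<open>The defect of the commutation relation is a derivation, so it only has to vanish
    on the variables.\<close>
  have D: "\<alpha> s (D u) - D (\<alpha> s u) - (if s = 0 then 0 else \<alpha> (s - 1) u) = 0" for s u
  proof (rule derivation_zeroI[where f = "\<lambda>u. \<alpha> s (D u) - D (\<alpha> s u) - (if s = 0 then 0 else \<alpha> (s - 1) u)"])
    show "derivation (\<lambda>u. \<alpha> s (D u) - D (\<alpha> s u) - (if s = 0 then 0 else \<alpha> (s - 1) u))"
      unfolding derivation_def
    proof (intro conjI allI linI)
      fix u v
      show "\<alpha> s (D (u \<cdot> v)) - D (\<alpha> s (u \<cdot> v)) - (if s = 0 then 0 else \<alpha> (s - 1) (u \<cdot> v))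
        = (\<alpha> s (D u) - D (\<alpha> s u) - (if s = 0 then 0 else \<alpha> (s - 1) u)) \<cdot> v
        + u \<cdot> (\<alpha> s (D v) - D (\<alpha> s v) - (if s = 0 then 0 else \<alpha> (s - 1) v))"
        by (simp add: D_mult derivation_mult[OF \<alpha>(1)] lin D_lin mult_left mult_right)
    qed (simp_all add: lin D_lin scale_right_diff_distrib)
    fix k assume "k \<in> gens"
    then obtain j m where k: "k = (j, m)" "j \<in> {1..r}" "m \<ge> 1" by auto
    show "\<alpha> s (D (gen k)) - D (\<alpha> s (gen k)) - (if s = 0 then 0 else \<alpha> (s - 1) (gen k)) = 0"
    proof (cases "j = i")
      case False
      then show ?thesis using k by (simp add: D_gen lin \<alpha>gen D_lin)
    next
      case i: True
      show ?thesis
      proof (cases "s \<le> m")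
        case True
        then obtain t where m: "m = s + t" using le_Suc_ex by blast
        show ?thesis
        proof (cases s)
          case 0
          then show ?thesis using k i by (simp add: D_gen lin \<alpha>gen TD)
        next
          case (Suc s')
          have "of_nat (Suc s') / fact (Suc s') = (1 / fact s' :: complex)" by (rule Suc_div_fact_Suc)
          then have "(of_nat m / fact s :: complex) = of_nat t / fact s + 1 / fact s'"
            by (simp only: m of_nat_add add_divide_distrib Suc add.commute)
          then have "(of_nat m / fact s) \<odot> T (Suc t) = (of_nat t / fact s) \<odot> T (Suc t) + (1 / fact s') \<odot> T (Suc t)"
            by (simp only: scale_left_distrib)
          moreover have "Suc m - s = Suc t" "m - s = t" "m - s' = Suc t" "s - 1 = s'" using m Suc by auto
          ultimately show ?thesis using k i Suc by (simp add: D_gen lin \<alpha>gen D_lin TD del: of_nat_Suc fact_Suc)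
        qed
      next
        case False
        then have "Suc m - s = 0" "m - s = 0" "m - (s - 1) = 0" by auto
        then show ?thesis using k i by (simp add: D_gen lin \<alpha>gen D_lin T0)
      qed
    qed
  qed
  have bound: "\<exists>N. \<forall>s\<ge>N. \<alpha> s u = 0" for u
  proof (induction u rule: free_induct)
    case subspace
    have add: "\<exists>N. \<forall>s\<ge>N. \<alpha> s (u + v) = 0" if uv: "\<exists>N. \<forall>s\<ge>N. \<alpha> s u = 0" "\<exists>N. \<forall>s\<ge>N. \<alpha> s v = 0" for u v
    proof -
      obtain N M where "\<forall>s\<ge>N. \<alpha> s u = 0" "\<forall>s\<ge>M. \<alpha> s v = 0" using uv by blast
      then have "\<forall>s\<ge>max N M. \<alpha> s (u + v) = 0" by (simp add: lin)
      then show ?thesis by blast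
    qed
    have "\<exists>N. \<forall>s\<ge>N. \<alpha> s (k \<odot> u) = 0" if "\<exists>N. \<forall>s\<ge>N. \<alpha> s u = 0" for u k
      using that by (auto simp: lin)
    then show ?case using add by (simp add: subspace_def lin)
  next
    case (gen k w)
    obtain j m where k: "k = (j, m)" "j \<in> {1..r}" using gen(1) by auto
    obtain N where N: "\<forall>s\<ge>N. \<alpha> s w = 0" using gen(3) by blast
    have "\<alpha> s (gen k \<cdot> w) = 0" if "s \<ge> max N m" for s
      using N k that by (simp add: derivation_mult[OF \<alpha>(1)] \<alpha>gen T0 mult_left mult_right)
    then show ?case by blast
  qed (simp add: derivation_vac[OF \<alpha>(1)])
  have weight: "\<alpha> s u \<in> G (n + (- int s + c))" if u: "u \<in> G n" for s n u
  proof (rule lin_maps_homogeneous[OF derivation_lin[OF \<alpha>(1)] _ u])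
    show "\<alpha> s (monomial xs) \<in> G (wt xs + (- int s + c))" if "set xs \<subseteq> gens" for xs
      using that
    proof (induction xs)
      case Nil
      show ?case by (simp add: derivation_vac[OF \<alpha>(1)] subspace_0[OF grading_subspace])
    next
      case (Cons k xs)
      obtain j m where k: "k = (j, m)" "j \<in> {1..r}" using Cons.prems by (cases k) auto
      have "\<alpha> s (gen k) \<in> G (int m + (- int s + c))"
      proof (cases "j = i \<and> m > s")
        case True
        then have "T (m - s) \<in> G (int (m - s) + c)" by (intro TG) linarith
        then show ?thesis using True k by (simp add: \<alpha>gen of_nat_diff subspace_scale[OF grading_subspace] algebra_simps)
      next
        case False
        then have "\<alpha> s (gen k) = 0" using k by (auto simp: \<alpha>gen T0)
        then show ?thesis by (simp add: subspace_0[OF grading_subspace])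
      qed
      from Y_weight[OF this monomial_homogeneous, of "-1" xs]
      have 1: "\<alpha> s (gen k) \<cdot> monomial xs \<in> G (int m + wt xs + (- int s + c))"
        by (simp add: mult_def algebra_simps)
      have "gen k \<cdot> \<alpha> s (monomial xs) \<in> G (int (snd k) + (wt xs + (- int s + c)))"
        by (rule gen_mult_homogeneous) (use Cons in simp)
      then have 2: "gen k \<cdot> \<alpha> s (monomial xs) \<in> G (int m + wt xs + (- int s + c))"
        by (simp add: k add.assoc)
      show ?case
        using subspace_add[OF grading_subspace 1 2] k by (simp add: derivation_mult[OF \<alpha>(1)] wt_def)
    qed
  qed
  have "shift_family c \<alpha>"
    unfolding shift_family_def
  proof (intro conjI allI ballI)
    show "\<alpha> s (D u) = D (\<alpha> s u) + (if s = 0 then 0 else \<alpha> (s - 1) u)" for s u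
      using D[of s u] by (simp add: algebra_simps split: if_splits)
    show "\<alpha> s u \<in> G (n - int s + c)" if "u \<in> G n" for s n u
      using weight[OF that] by (simp add: algebra_simps)
  qed (fact \<alpha>(1) bound)+
  then show thesis using \<alpha>gen by (rule that)
qed

text \<open>Delaying a family by one index raises its offset by one. This brings two families of
  offset -1 to the total -1 required of a pair.\<close>

lemma shift_family_Suc:
  assumes "shift_family c \<alpha>"
  shows "shift_family (c + 1) (\<lambda>s. if s = 0 then (\<lambda>_. 0) else \<alpha> (s - 1))"
  unfolding shift_family_def
proof (intro conjI allI ballI)
  show "derivation (if s = 0 then (\<lambda>_. 0) else \<alpha> (s - 1))" for s
    using family_derivation[OF assms] by (auto simp: derivation_def mult_left mult_right intro!: linI)
  show "(if s = 0 then (\<lambda>_. 0) else \<alpha> (s - 1)) (D u) = D ((if s = 0 then (\<lambda>_. 0) else \<alpha> (s - 1)) u)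
     + (if s = 0 then 0 else (if s - 1 = 0 then (\<lambda>_. 0) else \<alpha> (s - 1 - 1)) u)" for s u
    by (simp add: D_lin family_D[OF assms])
  show "\<exists>N. \<forall>s\<ge>N. (if s = 0 then (\<lambda>_. 0) else \<alpha> (s - 1)) u = 0" for u
  proof -
    obtain N where N: "\<forall>s\<ge>N. \<alpha> s u = 0" using family_bound[OF assms] by blast
    show ?thesis by (rule exI[of _ "Suc N"]) (use N in auto)
  qed
  show "(if s = 0 then (\<lambda>_. 0) else \<alpha> (s - 1)) u \<in> G (n - int s + (c + 1))" if "u \<in> G n" for s n u
  proof (cases s)
    case (Suc t)
    then show ?thesis using family_weight[OF assms that, of t] by (simp add: algebra_simps)
  qed (simp add: subspace_0[OF grading_subspace])
qed

text \<open>With T concentrated at m = 1, \<open>\<alpha> s\<close> is the partial derivative with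
  respect to D^s e_i.\<close>

lemma vac_family_exists:
  obtains \<alpha> where "shift_family (-1) \<alpha>"
    "\<And>s j. j \<in> {1..r} \<Longrightarrow> \<alpha> s (\<iota> (e j)) = (if j = i \<and> s = 0 then vac else 0)"
proof -
  define T where "T m = (if m = 1 then vac else 0)" for m :: nat
  obtain \<alpha> where \<alpha>: "shift_family (-1) \<alpha>"
      "\<And>s j m. j \<in> {1..r} \<Longrightarrow> \<alpha> s (gen (j, m)) = (if j = i then (1 / fact s) \<odot> T (m - s) else 0)"
    by (rule derivation_family_exists[of T "-1" i]) (auto simp: T_def D_vac D_lin vac_weight subspace_0[OF grading_subspace])
  then have "\<alpha> s (\<iota> (e j)) = (if j = i \<and> s = 0 then vac else 0)" if "j \<in> {1..r}" for s j
    using that \<alpha>(2)[of j s 1] by (auto simp: gen_one[symmetric] T_def)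
  with \<alpha>(1) show thesis by (rule that)
qed

text \<open>\<open>\<alpha> 0\<close> is the derivation commuting with \<open>D\<close> that sends
  e_i to e_k and the other generators to 0. Weights are preserved at s = 0, so the offset is
  0.\<close>

lemma generator_family_exists:
  obtains \<alpha> where "shift_family 0 \<alpha>"
    "\<And>s j. j \<in> {1..r} \<Longrightarrow> \<alpha> s (\<iota> (e j)) = (if j = i \<and> s = 0 then \<iota> (e k) else 0)"
proof -
  define T where "T m = gen (k, m)" for m :: nat
  obtain \<alpha> where \<alpha>: "shift_family 0 \<alpha>"
      "\<And>s j m. j \<in> {1..r} \<Longrightarrow> \<alpha> s (gen (j, m)) = (if j = i then (1 / fact s) \<odot> T (m - s) else 0)"
    by (rule derivation_family_exists[of T 0 i]) (auto simp: T_def gen_zero D_gen gen_homogeneous)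
  then have "\<alpha> s (\<iota> (e j)) = (if j = i \<and> s = 0 then \<iota> (e k) else 0)" if "j \<in> {1..r}" for s j
    using that \<alpha>(2)[of j s 1] by (cases s) (auto simp: gen_one[symmetric] T_def gen_zero)
  with \<alpha>(1) show thesis by (rule that)
qed

text \<open>One family turns e_i into e_k, the other turns e_j into the vacuum, so e_i and e_j
  contract to e_k / (z - w); the exchanged contraction supplies the opposite entry.\<close>

lemma bracket_cocycle:
  "\<exists>Z. Z \<in> cocycles \<and> (\<forall>a\<in>{1..r}. \<forall>b\<in>{1..r}. \<forall>n\<ge>0. Z (\<iota> (e a)) n (\<iota> (e b)) =
       (of_bool (n = 0) * (of_bool (a = i \<and> b = j) - of_bool (b = i \<and> a = j))) \<odot> \<iota> (e k))"
proof -
  obtain \<alpha> where alpha: "shift_family 0 \<alpha>"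
    "\<And>s j. j \<in> {1..r} \<Longrightarrow> \<alpha> s (\<iota> (e j)) = (if j = i \<and> s = 0 then \<iota> (e k) else 0)"
    by (rule generator_family_exists[of i k]) blast
  obtain \<beta> where beta: "shift_family (-1) \<beta>"
    "\<And>s l. l \<in> {1..r} \<Longrightarrow> \<beta> s (\<iota> (e l)) = (if l = j \<and> s = 0 then vac else 0)"
    by (rule vac_family_exists[of j]) blast
  interpret two_families scaleH form r e scale G Y vac \<iota> 0 "-1" \<alpha> \<beta>
    by unfold_locales (use alpha beta in auto)
  show ?thesis
  proof (rule exI, intro conjI ballI allI impI)
    show "(\<lambda>u n v. X u n v - contraction \<beta> \<alpha> u n v) \<in> cocycles"
      by (rule antisymmetrized_contraction_cocycle)
    fix a b n assume ab: "a \<in> {1..r}" "b \<in> {1..r}" "n \<ge> (0::int)"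
    have 1: "X (\<iota> (e a)) n (\<iota> (e b)) = (of_bool (n = 0) * of_bool (a = i \<and> b = j)) \<odot> \<iota> (e k)"
      by (subst contraction_eq[where N = 1 and M = 1])
         (use ab in \<open>auto simp: alpha beta Y_left Y_right creation\<close>)
    have 2: "contraction \<beta> \<alpha> (\<iota> (e a)) n (\<iota> (e b)) = (of_bool (n = 0) * of_bool (b = i \<and> a = j)) \<odot> \<iota> (e k)"
      by (subst contraction_eq[where N = 1 and M = 1])
         (use ab in \<open>auto simp: alpha beta Y_left Y_right Y_vac\<close>)
    show "X (\<iota> (e a)) n (\<iota> (e b)) - contraction \<beta> \<alpha> (\<iota> (e a)) n (\<iota> (e b)) =
      (of_bool (n = 0) * (of_bool (a = i \<and> b = j) - of_bool (b = i \<and> a = j))) \<odot> \<iota> (e k)"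
      unfolding 1 2 by (simp only: scale_left_diff_distrib right_diff_distrib)
  qed
qed

text \<open>Both families produce the vacuum, with total offset -2, so the second is delayed. The
  kernel becomes d_w (z - w)^(-1) = (z - w)^(-2), which is even; subtracting the exchanged
  contraction therefore yields a symmetric form.\<close>

lemma form_cocycle:
  "\<exists>Z. Z \<in> cocycles \<and> (\<forall>a\<in>{1..r}. \<forall>b\<in>{1..r}. \<forall>n\<ge>0. Z (\<iota> (e a)) n (\<iota> (e b)) =
       (of_bool (n = 1) * (of_bool (a = i \<and> b = j) + of_bool (b = i \<and> a = j))) \<odot> vac)"
proof -
  obtain \<alpha> where alpha: "shift_family (-1) \<alpha>"
    "\<And>s l. l \<in> {1..r} \<Longrightarrow> \<alpha> s (\<iota> (e l)) = (if l = i \<and> s = 0 then vac else 0)"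
    by (rule vac_family_exists[of i]) blast
  obtain \<beta>' where \<beta>': "shift_family (-1) \<beta>'"
    "\<And>s l. l \<in> {1..r} \<Longrightarrow> \<beta>' s (\<iota> (e l)) = (if l = j \<and> s = 0 then vac else 0)"
    by (rule vac_family_exists[of j]) blast
  define \<beta> where "\<beta> = (\<lambda>s. if s = 0 then (\<lambda>_. 0) else \<beta>' (s - 1))"
  have beta: "shift_family 0 \<beta>" using shift_family_Suc[OF \<beta>'(1)] by (simp add: \<beta>_def)
  have \<beta>e: "\<beta> s (\<iota> (e l)) = (if l = j \<and> s = 1 then vac else 0)" if "l \<in> {1..r}" for s l
    using that by (cases s) (auto simp: \<beta>_def \<beta>')
  interpret two_families scaleH form r e scale G Y vac \<iota> "-1" 0 \<alpha> \<beta>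
    by unfold_locales (use alpha beta in auto)
  have vv: "Y vac m vac = (if m = -1 then vac else 0)" for m by (rule Y_vac)
  show ?thesis
  proof (rule exI, intro conjI ballI allI impI)
    show "(\<lambda>u n v. X u n v - contraction \<beta> \<alpha> u n v) \<in> cocycles"
      by (rule antisymmetrized_contraction_cocycle)
    fix a b n assume ab: "a \<in> {1..r}" "b \<in> {1..r}" "n \<ge> (0::int)"
    have 1: "X (\<iota> (e a)) n (\<iota> (e b)) = (of_bool (n = 1) * of_bool (a = i \<and> b = j)) \<odot> vac"
      by (subst contraction_eq[where N = 1 and M = 2])
         (use ab in \<open>auto simp: alpha \<beta>e Y_left Y_right vv numeral_2_eq_2\<close>)
    have 2: "contraction \<beta> \<alpha> (\<iota> (e a)) n (\<iota> (e b)) = - ((of_bool (n = 1) * of_bool (b = i \<and> a = j)) \<odot> vac)"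
      by (subst contraction_eq[where N = 2 and M = 1])
         (use ab in \<open>auto simp: alpha \<beta>e Y_left Y_right vv numeral_2_eq_2\<close>)
    show "X (\<iota> (e a)) n (\<iota> (e b)) - contraction \<beta> \<alpha> (\<iota> (e a)) n (\<iota> (e b)) =
      (of_bool (n = 1) * (of_bool (a = i \<and> b = j) + of_bool (b = i \<and> a = j))) \<odot> vac"
      unfolding 1 2 by (simp only: diff_minus_eq_add scale_left_distrib distrib_left)
  qed
qed

section \<open>The singular part determines the class\<close>

lemma zero_cocycle: "(\<lambda>u n v. 0) \<in> cocycles"
  unfolding cocycles_def mem_Collect_eq
proof (intro conjI allI ballI)
  fix v' u1 u2 v assume v': "v' \<in> graded_dual"
  show "\<exists>R\<in>rational_functions. product_converges_to (\<lambda>m n. v' 0 + v' (Y u1 m 0)) R \<and>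
       iterate_converges_to (\<lambda>m n. v' 0 + v' (Y 0 n v)) R"
    using dual_series_zero unfolding dual_series_def by (simp add: Y_left Y_right fun_0[OF v'])
qed (auto intro: linI simp: subspace_0[OF grading_subspace] D_lin)

lemma cocycles_add_scale:
  assumes Z: "Z \<in> cocycles" and Z': "Z' \<in> cocycles"
  shows "(\<lambda>u n v. Z u n v + k \<odot> Z' u n v) \<in> cocycles"
proof -
  define S where "S u n v = Z u n v + k \<odot> Z' u n v" for u n v
  note lin = linD[OF cocycle_lin_left[OF Z]] linD[OF cocycle_lin_left[OF Z']]
    linD[OF cocycle_lin_right[OF Z]] linD[OF cocycle_lin_right[OF Z']]
  have left: "lin (\<lambda>u. S u n v)" and right: "lin (\<lambda>v. S u n v)" for u n v
    unfolding S_def by (rule linI; simp add: lin scale_right_distrib mult.commute)+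
  have trunc: "\<exists>N. \<forall>n\<ge>N. W u n v = 0" if "W \<in> cocycles" for W u v
    by (rule that[unfolded cocycles_def mem_Collect_eq, THEN conjunct2, THEN conjunct2, THEN conjunct1, rule_format])
  have weight: "S u n v \<in> G (p + q - n - 1)" if "u \<in> G p" "v \<in> G q" for u v p q n
    unfolding S_def
    by (intro subspace_add[OF grading_subspace] subspace_scale[OF grading_subspace]
        cocycle_weight[OF Z] cocycle_weight[OF Z'] that)
  have D: "D (S u n v) - S u n (D v) = S (D u) n v" for u n v
    by (simp add: S_def D_lin cocycle_D[OF Z] cocycle_D[OF Z'] scale_right_distrib)
  have D': "S (D u) n v = (- of_int n) \<odot> S u (n - 1) v" for u n v
    unfolding S_def cocycle_D_left[OF Z] cocycle_D_left[OF Z'] by (simp add: scale_right_distrib mult.commute)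
  have dual: "dual_series (\<lambda>m n. v' (S u1 m (Y u2 n v)) + v' (Y u1 m (S u2 n v)))
      (\<lambda>m n. v' (S (Y u1 m u2) n v) + v' (Y (S u1 m u2) n v))" if v': "v' \<in> graded_dual" for v' u1 u2 v
    using dual_series_add[OF cocycle_dual[OF Z v', of u1 u2 v] dual_series_scale[OF cocycle_dual[OF Z' v', of u1 u2 v], of k]]
    by (simp add: S_def functionalD[OF v'] Y_left Y_right algebra_simps)
  have skew: "S u n v = (\<Sum>j | S v (n + int j) u \<noteq> 0. skew_term S u n v j)" for u n v
  proof -
    obtain N N' where N: "\<forall>n\<ge>N. Z v n u = 0" "\<forall>n\<ge>N'. Z' v n u = 0" using trunc Z Z' by blast
    \<comment> \<open>Skew symmetry sums over supports, which differ for \<open>Z\<close>,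
      \<open>Z'\<close> and \<open>S\<close>; a common initial segment makes the sums
      comparable.\<close>
    define J where "J = nat (max N N' - n)"
    have 0: "\<And>n. n \<ge> max N N' \<Longrightarrow> Z v n u = 0" "\<And>n. n \<ge> max N N' \<Longrightarrow> Z' v n u = 0"
      "\<And>n. n \<ge> max N N' \<Longrightarrow> S v n u = 0" using N by (simp_all add: S_def)
    have modes: "Z u n v = (\<Sum>j<J. skew_term Z u n v j)"
      "Z' u n v = (\<Sum>j<J. skew_term Z' u n v j)"
      by (rule trans[OF cocycle_skew[OF Z] sum_nonzero_modes[where N = "max N N'"]],
          erule 0, simp only: J_def order_refl,
          rule trans[OF cocycle_skew[OF Z'] sum_nonzero_modes[where N = "max N N'"]],
          erule 0, simp only: J_def order_refl)
    have "S u n v = (\<Sum>j<J. skew_term Z u n v j)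
       + k \<odot> (\<Sum>j<J. skew_term Z' u n v j)"
      unfolding modes[symmetric] by (rule S_def)
    also have "\<dots> = (\<Sum>j<J. skew_term S u n v j)"
      unfolding S_def by (simp add: linD[OF lin_D_power] scale_right_distrib sum.distrib scale_sum_right mult.commute)
    also have "\<dots> = (\<Sum>j | S v (n + int j) u \<noteq> 0. skew_term S u n v j)"
      by (rule sum_nonzero_modes[symmetric, of "max N N'"]) (simp_all add: 0 J_def)
    finally show ?thesis .
  qed
  have "S \<in> cocycles"
    unfolding cocycles_def mem_Collect_eq
  proof (intro conjI allI ballI)
    show "S vac n v = 0" "S u n vac = 0" for u n v
      by (simp_all add: S_def cocycle_vac[OF Z] cocycle_vac[OF Z'])
    show "\<exists>N. \<forall>n\<ge>N. S u n v = 0" for u v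
    proof -
      obtain N N' where N: "\<forall>n\<ge>N. Z u n v = 0" "\<forall>n\<ge>N'. Z' u n v = 0" using trunc Z Z' by blast
      then have "\<forall>n\<ge>max N N'. S u n v = 0" by (simp add: S_def)
      then show ?thesis by blast
    qed
    show "\<exists>R\<in>rational_functions. product_converges_to (\<lambda>m n. v' (S u1 m (Y u2 n v)) + v' (Y u1 m (S u2 n v))) R \<and>
       iterate_converges_to (\<lambda>m n. v' (S (Y u1 m u2) n v) + v' (Y (S u1 m u2) n v)) R" if "v' \<in> graded_dual" for v' u1 u2 v
      using dual[OF that, of u1 u2 v] unfolding dual_series_def .
  qed (fact left right weight D D' skew)+
  then show ?thesis by (simp add: S_def[abs_def])
qed

lemma cocycles_sum:
  assumes "\<And>x. x \<in> S \<Longrightarrow> Z x \<in> cocycles"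
  shows "(\<lambda>u n v. \<Sum>x\<in>S. k x \<odot> Z x u n v) \<in> cocycles"
  using assms
proof (induction S rule: infinite_finite_induct)
  case (insert x S)
  then have "(\<lambda>u n v. (\<Sum>x\<in>S. k x \<odot> Z x u n v) + k x \<odot> Z x u n v) \<in> cocycles"
    by (intro cocycles_add_scale) auto
  then show ?case using insert by (simp add: add.commute)
qed (simp_all add: zero_cocycle)

lemma cocycles_diff:
  assumes "Z \<in> cocycles" "Z' \<in> cocycles"
  shows "Z - Z' \<in> cocycles"
proof -
  have "Z - Z' = (\<lambda>u n v. Z u n v + (-1) \<odot> Z' u n v)" by (auto simp: fun_eq_iff)
  then show ?thesis using cocycles_add_scale[OF assms, of "-1"] by simp
qed

lemma coboundary_regular:
  assumes "Z \<in> coboundaries" "n \<ge> 0"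
  shows "Z u n v = 0"
  using assms unfolding coboundaries_def by (auto simp: Y_nonneg linD)

end

section \<open>Coordinates on the space of families\<close>

text \<open>The larger index of a pair comes first. Third component 0 marks an entry a_ij with i <=
  j, and a third component in 1..r marks M_ij^k with i < j, so the two kinds are disjoint.\<close>

definition structure_indices :: "nat \<Rightarrow> ((nat \<times> nat) \<times> nat) set" where
  "structure_indices r = (SIGMA j:{1..r}. {1..j}) \<times> {0} \<union> (SIGMA j:{1..r}. {1..<j}) \<times> {1..r}"

lemma finite_structure_indices: "finite (structure_indices r)"
  by (auto simp: structure_indices_def)

lemma card_structure_indices: "card (structure_indices r) = (r + 1 choose 2) + (r choose 2) * r"
proof -
  have "card ((SIGMA j:{1..r}. {1..j}) \<times> {0::nat}) = (r + 1 choose 2)"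
    unfolding Suc_eq_plus1[symmetric] choose_two_sum(1) by (simp add: card_cartesian_product)
  moreover have "card ((SIGMA j:{1..r}. {1..<j}) \<times> {1..r}) = (r choose 2) * r"
    unfolding choose_two_sum(2) by (simp add: card_cartesian_product)
  moreover have "finite ((SIGMA j:{1..r}. {1..j}) \<times> {0::nat})" "finite ((SIGMA j:{1..r}. {1..<j}) \<times> {1..r})"
    by auto
  moreover have "((SIGMA j:{1..r}. {1..j}) \<times> {0}) \<inter> ((SIGMA j:{1..r}. {1..<j}) \<times> {1..r}) = {}" by auto
  ultimately show ?thesis unfolding structure_indices_def by (simp only: card_Un_disjoint)
qed

definition family_of_coordinates ::
    "nat \<Rightarrow> ((nat \<times> nat) \<times> nat \<Rightarrow> complex) \<Rightarrow> (nat \<Rightarrow> nat \<Rightarrow> complex) \<times> (nat \<Rightarrow> nat \<Rightarrow> nat \<Rightarrow> complex)" where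
  "family_of_coordinates r x =
     (\<lambda>i j. if {i, j} \<subseteq> {1..r} then x ((max i j, min i j), 0) else 0,
      \<lambda>i j k. if {i, j, k} \<subseteq> {1..r} then
          (if i < j then x ((j, i), k) else if j < i then - x ((i, j), k) else 0) else 0)"

lemma family_of_coordinates_structure: "family_of_coordinates r x \<in> structure_families r"
  by (auto simp: family_of_coordinates_def structure_families_def max.commute min.commute)

lemma structure_familiesD:
  assumes "(a, M) \<in> structure_families r"
  shows "i \<in> {1..r} \<Longrightarrow> j \<in> {1..r} \<Longrightarrow> a i j = a j i"
    and "i \<in> {1..r} \<Longrightarrow> j \<in> {1..r} \<Longrightarrow> k \<in> {1..r} \<Longrightarrow> M i j k = - M j i k"
    and "\<not> {i, j} \<subseteq> {1..r} \<Longrightarrow> a i j = 0"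
    and "\<not> {i, j, k} \<subseteq> {1..r} \<Longrightarrow> M i j k = 0"
proof -
  note c = assms[unfolded structure_families_def mem_Collect_eq prod.case]
  show "i \<in> {1..r} \<Longrightarrow> j \<in> {1..r} \<Longrightarrow> a i j = a j i"
    by (rule c[THEN conjunct1, rule_format])
  show "i \<in> {1..r} \<Longrightarrow> j \<in> {1..r} \<Longrightarrow> k \<in> {1..r} \<Longrightarrow> M i j k = - M j i k"
    by (rule c[THEN conjunct2, THEN conjunct1, rule_format])
  show "\<not> {i, j} \<subseteq> {1..r} \<Longrightarrow> a i j = 0"
    by (rule c[THEN conjunct2, THEN conjunct2, THEN conjunct1, rule_format])
  show "\<not> {i, j, k} \<subseteq> {1..r} \<Longrightarrow> M i j k = 0"
    by (rule c[THEN conjunct2, THEN conjunct2, THEN conjunct2, rule_format])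
qed

lemma family_of_coordinates_surj:
  assumes "f \<in> structure_families r"
  obtains x where "f = family_of_coordinates r x"
proof -
  obtain a M where f: "f = (a, M)" by fastforce
  note aM = structure_familiesD[OF assms[unfolded f]]
  define x where "x = (\<lambda>((j, i), k). if k = (0::nat) then a i j else M i j k)"
  have "a i j = fst (family_of_coordinates r x) i j" for i j
    using aM(1)[of i j] aM(3)[of i j] by (auto simp: family_of_coordinates_def x_def max_def min_def)
  moreover have "M i j k = snd (family_of_coordinates r x) i j k" for i j k
  proof (cases "{i, j, k} \<subseteq> {1..r}")
    case True
    \<comment> \<open>Since k is not 0, \<open>x\<close> reads an entry of M; on the diagonal the
      antisymmetry forces the value 0.\<close>
    then have *: "M i j k = - M j i k" "k \<noteq> 0" using aM(2)[of i j k] by auto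
    have "i < j \<or> j < i \<or> i = j" by linarith
    then show ?thesis using True * by (auto simp: family_of_coordinates_def x_def)
  next
    case False
    then show ?thesis using aM(4)[OF False] by (auto simp: family_of_coordinates_def)
  qed
  ultimately have "f = family_of_coordinates r x" unfolding f by (auto simp: prod_eq_iff fun_eq_iff)
  then show thesis by (rule that)
qed

lemma family_of_coordinates_eq_iff:
  "family_of_coordinates r x = family_of_coordinates r y \<longleftrightarrow> (\<forall>s \<in> structure_indices r. x s = y s)"
proof
  assume eq: "family_of_coordinates r x = family_of_coordinates r y"
  show "\<forall>s \<in> structure_indices r. x s = y s"
  proof
    fix s assume s: "s \<in> structure_indices r"
    obtain i j k where sk: "s = ((j, i), k)" by (metis prod.exhaust)
    have 1: "fst (family_of_coordinates r x) i j = fst (family_of_coordinates r y) i j"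
      and 2: "snd (family_of_coordinates r x) i j k = snd (family_of_coordinates r y) i j k" by (simp_all add: eq)
    show "x s = y s"
      using s 1 2 unfolding sk structure_indices_def
      by (auto simp: family_of_coordinates_def max_def min_def split: if_splits)
  qed
next
  assume eq: "\<forall>s \<in> structure_indices r. x s = y s"
  have 1: "x ((max i j, min i j), 0) = y ((max i j, min i j), 0)" if "{i, j} \<subseteq> {1..r}" for i j
    using that by (intro eq[rule_format]) (auto simp: structure_indices_def)
  have 2: "x ((j, i), k) = y ((j, i), k)" if "{i, j, k} \<subseteq> {1..r}" "i < j" for i j k
    using that by (intro eq[rule_format]) (auto simp: structure_indices_def)
  have "fst (family_of_coordinates r x) i j = fst (family_of_coordinates r y) i j" for i j
    using 1[of i j] by (simp add: family_of_coordinates_def)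
  moreover have "snd (family_of_coordinates r x) i j k = snd (family_of_coordinates r y) i j k" for i j k
    using 2[of i j k] 2[of j i k] by (auto simp: family_of_coordinates_def)
  ultimately show "family_of_coordinates r x = family_of_coordinates r y"
    by (auto simp: prod_eq_iff fun_eq_iff)
qed

lemma family_of_coordinates_sum:
  "(\<lambda>i j. \<Sum>t\<in>S. c t * fst (family_of_coordinates r (x t)) i j,
    \<lambda>i j k. \<Sum>t\<in>S. c t * snd (family_of_coordinates r (x t)) i j k)
   = family_of_coordinates r (\<lambda>s. \<Sum>t\<in>S. c t * x t s)"
  by (auto simp: family_of_coordinates_def fun_eq_iff sum_negf)

section \<open>From singular parts to cohomology classes\<close>

context heisenberg_level_zero
begin

lemma has_singular_part_sum:
  assumes "\<And>t. t \<in> S \<Longrightarrow> has_singular_part (b t) (f t)"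
  shows "has_singular_part (\<lambda>u n v. \<Sum>t\<in>S. c t \<odot> b t u n v)
    (\<lambda>i j. \<Sum>t\<in>S. c t * fst (f t) i j, \<lambda>i j k. \<Sum>t\<in>S. c t * snd (f t) i j k)"
proof -
  have f: "(\<forall>n\<ge>2. b t (\<iota> (e i)) n (\<iota> (e j)) = 0) \<and> b t (\<iota> (e i)) 1 (\<iota> (e j)) = fst (f t) i j \<odot> vac \<and>
     b t (\<iota> (e i)) 0 (\<iota> (e j)) = (\<Sum>k = 1..r. snd (f t) i j k \<odot> \<iota> (e k))"
    if "t \<in> S" "i \<in> {1..r}" "j \<in> {1..r}" for t i j
    using assms[OF that(1)] that(2,3) unfolding has_singular_part_def case_prod_unfold by blast
  show ?thesis
    unfolding has_singular_part_def prod.case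
  proof (intro ballI conjI allI impI)
    fix i j assume ij: "i \<in> {1..r}" "j \<in> {1..r}"
    show "(\<Sum>t\<in>S. c t \<odot> b t (\<iota> (e i)) n (\<iota> (e j))) = 0" if "n \<ge> 2" for n
      using f[OF _ ij] that by (intro sum.neutral ballI) simp
    show "(\<Sum>t\<in>S. c t \<odot> b t (\<iota> (e i)) 1 (\<iota> (e j))) = (\<Sum>t\<in>S. c t * fst (f t) i j) \<odot> vac"
      unfolding scale_sum_left by (intro sum.cong refl) (use f[OF _ ij] in simp)
    have "(\<Sum>t\<in>S. c t \<odot> b t (\<iota> (e i)) 0 (\<iota> (e j))) = (\<Sum>t\<in>S. \<Sum>k = 1..r. (c t * snd (f t) i j k) \<odot> \<iota> (e k))"
      by (intro sum.cong refl) (use f[OF _ ij] in \<open>simp add: scale_sum_right\<close>)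
    also have "\<dots> = (\<Sum>k = 1..r. \<Sum>t\<in>S. (c t * snd (f t) i j k) \<odot> \<iota> (e k))" by (rule sum.swap)
    finally show "(\<Sum>t\<in>S. c t \<odot> b t (\<iota> (e i)) 0 (\<iota> (e j))) = (\<Sum>k = 1..r. (\<Sum>t\<in>S. c t * snd (f t) i j k) \<odot> \<iota> (e k))"
      by (simp only: scale_sum_left)
  qed
qed

lemma basic_cocycle_exists:
  assumes "s \<in> structure_indices r"
  shows "\<exists>Z. Z \<in> cocycles \<and> has_singular_part Z (family_of_coordinates r (\<lambda>t. of_bool (t = s)))"
proof -
  obtain i j k where s: "s = ((j, i), k)" by (metis prod.exhaust)
  define a M where "a = fst (family_of_coordinates r (\<lambda>t. of_bool (t = s)))"
    and "M = snd (family_of_coordinates r (\<lambda>t. of_bool (t = s)))"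
  have "\<exists>Z. Z \<in> cocycles \<and> has_singular_part Z (a, M)"
  proof (cases "k = 0")
    case True
    with assms have ij: "i \<le> j" "{i, j} \<subseteq> {1..r}" unfolding s structure_indices_def by auto
    obtain Z where Z: "Z \<in> cocycles"
      "\<forall>p\<in>{1..r}. \<forall>q\<in>{1..r}. \<forall>n\<ge>0. Z (\<iota> (e p)) n (\<iota> (e q)) =
         (of_bool (n = 1) * (of_bool (p = i \<and> q = j) + of_bool (q = i \<and> p = j))) \<odot> vac"
      using form_cocycle[of i j] by blast
    \<comment> \<open>A diagonal entry is counted twice by the symmetric form, hence the factor
      1/2.\<close>
    define c where "c = (if i = j then 1 / 2 else 1 :: complex)"
    have a: "a p q = c * (of_bool (p = i \<and> q = j) + of_bool (q = i \<and> p = j))"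
      if "p \<in> {1..r}" "q \<in> {1..r}" for p q
    proof -
      have "a p q = of_bool (max p q = j \<and> min p q = i)"
        using that True by (simp add: a_def family_of_coordinates_def s)
      also have "(max p q = j \<and> min p q = i) \<longleftrightarrow> p = i \<and> q = j \<or> q = i \<and> p = j"
        using ij(1) by linarith
      also have "of_bool (p = i \<and> q = j \<or> q = i \<and> p = j) = c * (of_bool (p = i \<and> q = j) + of_bool (q = i \<and> p = j))"
        by (cases "i = j") (auto simp: c_def)
      finally show ?thesis .
    qed
    have M: "(\<Sum>l = 1..r. M p q l \<odot> \<iota> (e l)) = 0" for p q
    proof (intro sum.neutral ballI)
      fix l assume "l \<in> {1..r}"
      then have "M p q l = 0" using True by (simp add: M_def family_of_coordinates_def s)
      then show "M p q l \<odot> \<iota> (e l) = 0" by simp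
    qed
    have "has_singular_part (\<lambda>u n v. 0 + c \<odot> Z u n v) (a, M)"
      unfolding has_singular_part_def prod.case M by (intro ballI conjI allI impI) (simp_all add: Z(2) a)
    with cocycles_add_scale[OF zero_cocycle Z(1)] show ?thesis by blast
  next
    case False
    with assms have ij: "i < j" "{i, j, k} \<subseteq> {1..r}" unfolding s structure_indices_def by auto
    obtain Z where Z: "Z \<in> cocycles"
      "\<forall>p\<in>{1..r}. \<forall>q\<in>{1..r}. \<forall>n\<ge>0. Z (\<iota> (e p)) n (\<iota> (e q)) =
         (of_bool (n = 0) * (of_bool (p = i \<and> q = j) - of_bool (q = i \<and> p = j))) \<odot> \<iota> (e k)"
      using bracket_cocycle[of i j k] by blast
    have a: "a p q = 0" for p q using False by (simp add: a_def family_of_coordinates_def s)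
    have M: "M p q l = (if l = k then of_bool (p = i \<and> q = j) - of_bool (q = i \<and> p = j) else 0)"
      if "p \<in> {1..r}" "q \<in> {1..r}" "l \<in> {1..r}" for p q l
      using ij that by (auto simp: M_def family_of_coordinates_def s)
    have "(\<Sum>l = 1..r. M p q l \<odot> \<iota> (e l)) = (of_bool (p = i \<and> q = j) - of_bool (q = i \<and> p = j)) \<odot> \<iota> (e k)"
      if "p \<in> {1..r}" "q \<in> {1..r}" for p q
    proof -
      have "(\<Sum>l = 1..r. M p q l \<odot> \<iota> (e l)) = (\<Sum>l\<in>{k}. M p q l \<odot> \<iota> (e l))"
        by (rule sum.mono_neutral_right) (use ij M[OF that] in auto)
      then show ?thesis using ij M[OF that, of k] by simp
    qed
    then have "has_singular_part Z (a, M)" by (simp add: has_singular_part_def Z(2) a)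
    with Z(1) show ?thesis by blast
  qed
  then show ?thesis by (simp add: a_def M_def)
qed

lemma structure_cocycle_exists:
  assumes "f \<in> structure_families r"
  shows "\<exists>Z \<in> cocycles. has_singular_part Z f"
proof -
  obtain x where f: "f = family_of_coordinates r x" by (rule family_of_coordinates_surj[OF assms])
  have "\<exists>b. \<forall>s\<in>structure_indices r. b s \<in> cocycles \<and> has_singular_part (b s) (family_of_coordinates r (\<lambda>t. of_bool (t = s)))"
    by (intro bchoice ballI basic_cocycle_exists)
  then obtain b where b: "\<And>s. s \<in> structure_indices r \<Longrightarrow> b s \<in> cocycles"
      "\<And>s. s \<in> structure_indices r \<Longrightarrow> has_singular_part (b s) (family_of_coordinates r (\<lambda>t. of_bool (t = s)))"
    by blast
  have "f = family_of_coordinates r (\<lambda>t. \<Sum>s\<in>structure_indices r. x s * of_bool (t = s))"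
    unfolding f family_of_coordinates_eq_iff by (simp add: finite_structure_indices)
  then have "has_singular_part (\<lambda>u n v. \<Sum>s\<in>structure_indices r. x s \<odot> b s u n v) f"
    unfolding family_of_coordinates_sum[symmetric] using has_singular_part_sum[OF b(2)] by simp
  moreover have "(\<lambda>u n v. \<Sum>s\<in>structure_indices r. x s \<odot> b s u n v) \<in> cocycles"
    by (rule cocycles_sum[OF b(1)])
  ultimately show ?thesis by blast
qed

lemma vac_nonzero: "vac \<noteq> 0"
proof -
  have "vac \<in> monomial ` monomial_indices r"
    by (intro image_eqI[of _ _ "[]"]) (simp_all add: monomial_indices_def)
  moreover have "x \<noteq> 0" if "x \<in> monomial ` monomial_indices r" for x
    using that dependent_zero monomials(2) by blast
  ultimately show ?thesis by blast
qed

lemma homogeneous_zero_eq: "v \<in> G 0 \<Longrightarrow> \<exists>k. v = k \<odot> vac"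
proof -
  assume v: "v \<in> G 0"
  have "{xs \<in> monomial_indices r. wt xs = 0} \<subseteq> {[]}"
  proof
    fix xs assume xs: "xs \<in> {xs \<in> monomial_indices r. wt xs = 0}"
    show "xs \<in> {[]}"
    proof (cases xs)
      case (Cons k ys)
      have "wt ys \<ge> 0" unfolding wt_def by (intro sum_list_nonneg) auto
      moreover have "snd k \<ge> 1" using xs Cons by (auto simp: monomial_indices_def)
      ultimately show ?thesis using xs Cons by (simp add: wt_def case_prod_unfold)
    qed simp
  qed
  then have "monomial ` {xs \<in> monomial_indices r. wt xs = 0} \<subseteq> {vac}" by auto
  from span_mono[OF this] homogeneous_span[OF v] have "v \<in> span {vac}" by blast
  then show ?thesis by (auto simp: span_singleton)
qed

lemma \<iota>_sum: "\<iota> (\<Sum>k\<in>S. scaleH (c k) (h k)) = (\<Sum>k\<in>S. c k \<odot> \<iota> (h k))"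
proof -
  interpret i: Vector_Spaces.linear scaleH scale \<iota> by (rule \<iota>_linear)
  show ?thesis by (simp add: i.sum i.scale)
qed

lemma homogeneous_one_eq: "v \<in> G 1 \<Longrightarrow> \<exists>k. v = (\<Sum>l = 1..r. k l \<odot> \<iota> (e l))"
proof -
  assume "v \<in> G 1"
  then obtain h where v: "v = \<iota> h" using \<iota>_bij by (auto simp: bij_betw_def)
  have "h \<in> H.span (e ` {1..r})" using H.e_span by simp
  then obtain u where "h = (\<Sum>x\<in>e ` {1..r}. scaleH (u x) x)"
    by (auto simp: H.span_finite)
  then have "h = (\<Sum>l = 1..r. scaleH (u (e l)) (e l))"
    unfolding sum.reindex[OF H.e_inj] o_def .
  then have "v = (\<Sum>l = 1..r. u (e l) \<odot> \<iota> (e l))" unfolding v by (simp add: \<iota>_sum)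
  then show ?thesis by (rule exI[of _ "\<lambda>l. u (e l)"])
qed

lemma generator_coefficients_unique:
  assumes "(\<Sum>l = 1..r. c l \<odot> \<iota> (e l)) = (\<Sum>l = 1..r. d l \<odot> \<iota> (e l))" "k \<in> {1..r}"
  shows "c k = d k"
proof -
  interpret i: Vector_Spaces.linear scaleH scale \<iota> by (rule \<iota>_linear)
  have "\<iota> (\<Sum>l = 1..r. scaleH (c l) (e l)) = \<iota> (\<Sum>l = 1..r. scaleH (d l) (e l))"
    using assms(1) by (simp add: \<iota>_sum)
  then have "(\<Sum>l = 1..r. scaleH (c l) (e l)) = (\<Sum>l = 1..r. scaleH (d l) (e l))"
    using \<iota>_bij by (auto simp: bij_betw_def dest: injD)
  then have "(\<Sum>l = 1..r. scaleH (c l - d l) (e l)) = 0"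
    by (simp add: H.scale_left_diff_distrib sum_subtractf)
  moreover define u where "u x = c (inv_into {1..r} e x) - d (inv_into {1..r} e x)" for x
  have "(\<Sum>x\<in>e ` {1..r}. scaleH (u x) x) = (\<Sum>l = 1..r. scaleH (c l - d l) (e l))"
    unfolding sum.reindex[OF H.e_inj] o_def u_def by (intro sum.cong refl) (simp only: inv_into_f_f[OF H.e_inj])
  ultimately have "(\<Sum>x\<in>e ` {1..r}. scaleH (u x) x) = 0" by simp
  then have "u (e k) = 0"
    using H.independentD[OF H.e_independent, of "e ` {1..r}" u "e k"] assms(2) by simp
  then show ?thesis unfolding u_def inv_into_f_f[OF H.e_inj assms(2)] by simp
qed

text \<open>Weight 1 - n leaves nothing for n >= 2, a multiple of \<open>vac\<close> for n = 1 and a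
  combination of generators for n = 0. In the skew symmetry of mode 0 the correction term is
  \<open>D\<close> of a multiple of \<open>vac\<close>, so M is exactly antisymmetric.\<close>

lemma singular_part_exists:
  assumes Z: "Z \<in> cocycles"
  shows "\<exists>f \<in> structure_families r. has_singular_part Z f"
proof -
  have e_hom: "\<iota> (e i) \<in> G 1" for i using \<iota>_bij by (auto simp: bij_betw_def)
  have weight: "Z (\<iota> (e i)) n (\<iota> (e j)) \<in> G (1 - n)" for i j n
    using cocycle_weight[OF Z e_hom e_hom, where n = n] by simp
  have ge2: "Z (\<iota> (e i)) n (\<iota> (e j)) = 0" if "n \<ge> 2" for i j n
    using weight[where i = i and n = n and j = j] homogeneous_negative[of "1 - n"] that by simp
  define a where "a i j = (if {i, j} \<subseteq> {1..r} then SOME k. Z (\<iota> (e i)) 1 (\<iota> (e j)) = k \<odot> vac else 0)" for i j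
  define M where "M i j k = (if {i, j, k} \<subseteq> {1..r} then
      (SOME m. Z (\<iota> (e i)) 0 (\<iota> (e j)) = (\<Sum>l = 1..r. m l \<odot> \<iota> (e l))) k else 0)" for i j k
  have a: "Z (\<iota> (e i)) 1 (\<iota> (e j)) = a i j \<odot> vac" if "i \<in> {1..r}" "j \<in> {1..r}" for i j
  proof -
    have "\<exists>k. Z (\<iota> (e i)) 1 (\<iota> (e j)) = k \<odot> vac"
      using weight[where i = i and n = 1 and j = j] by (intro homogeneous_zero_eq) simp
    from someI_ex[OF this] show ?thesis using that by (simp add: a_def)
  qed
  have M: "Z (\<iota> (e i)) 0 (\<iota> (e j)) = (\<Sum>k = 1..r. M i j k \<odot> \<iota> (e k))" if "i \<in> {1..r}" "j \<in> {1..r}" for i j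
  proof -
    have "\<exists>m. Z (\<iota> (e i)) 0 (\<iota> (e j)) = (\<Sum>l = 1..r. m l \<odot> \<iota> (e l))"
      using weight[where i = i and n = 0 and j = j] by (intro homogeneous_one_eq) simp
    from someI_ex[OF this] show ?thesis using that by (simp add: M_def)
  qed
  have skew: "Z (\<iota> (e i)) n (\<iota> (e j)) = (\<Sum>t<J. ((-1) powi (n + int t + 1) / fact t) \<odot> (D ^^ t) (Z (\<iota> (e j)) (n + int t) (\<iota> (e i))))"
    if "J = nat (2 - n)" for i j n J
    by (rule trans[OF cocycle_skew[OF Z] sum_nonzero_modes[where N = 2]], erule ge2, simp only: that order_refl)
  have a_sym: "a i j = a j i" if "i \<in> {1..r}" "j \<in> {1..r}" for i j
  proof -
    have "Z (\<iota> (e i)) 1 (\<iota> (e j)) = Z (\<iota> (e j)) 1 (\<iota> (e i))"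
      by (subst skew[OF refl]) simp
    then show ?thesis using that vac_nonzero by (simp add: a)
  qed
  have M_skew: "M i j k = - M j i k" if "i \<in> {1..r}" "j \<in> {1..r}" "k \<in> {1..r}" for i j k
  proof -
    have "Z (\<iota> (e i)) 0 (\<iota> (e j)) = - Z (\<iota> (e j)) 0 (\<iota> (e i)) + D (Z (\<iota> (e j)) 1 (\<iota> (e i)))"
      by (subst skew[OF refl]) (simp add: numeral_2_eq_2)
    also have "D (Z (\<iota> (e j)) 1 (\<iota> (e i))) = 0" using that by (simp add: a D_lin D_vac)
    finally have "(\<Sum>k = 1..r. M i j k \<odot> \<iota> (e k)) = (\<Sum>k = 1..r. (- M j i k) \<odot> \<iota> (e k))"
      using that by (simp add: M sum_negf)
    then show ?thesis using that(3) by (rule generator_coefficients_unique)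
  qed
  have "(a, M) \<in> structure_families r"
    unfolding structure_families_def mem_Collect_eq prod.case
  proof (intro conjI ballI allI impI)
    show "a i j = 0" if "\<not> {i, j} \<subseteq> {1..r}" for i j using that unfolding a_def by (rule if_not_P)
    show "M i j k = 0" if "\<not> {i, j, k} \<subseteq> {1..r}" for i j k using that unfolding M_def by (rule if_not_P)
  qed (fact a_sym M_skew)+
  moreover have "has_singular_part Z (a, M)"
    unfolding has_singular_part_def prod.case using ge2 a M by blast
  ultimately show ?thesis by blast
qed

lemma singular_part_agree:
  assumes f: "f \<in> structure_families r" "has_singular_part Z f"
    and g: "g \<in> structure_families r" "has_singular_part Z' g"
  shows "f = g \<longleftrightarrow> (\<forall>i\<in>{1..r}. \<forall>j\<in>{1..r}. \<forall>n\<ge>0. Z (\<iota> (e i)) n (\<iota> (e j)) = Z' (\<iota> (e i)) n (\<iota> (e j)))"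
proof -
  obtain a M b N where fg: "f = (a, M)" "g = (b, N)" by fastforce
  have Z: "n \<ge> 2 \<Longrightarrow> Z (\<iota> (e i)) n (\<iota> (e j)) = 0" "Z (\<iota> (e i)) 1 (\<iota> (e j)) = a i j \<odot> vac"
    "Z (\<iota> (e i)) 0 (\<iota> (e j)) = (\<Sum>k = 1..r. M i j k \<odot> \<iota> (e k))"
    and Z': "n \<ge> 2 \<Longrightarrow> Z' (\<iota> (e i)) n (\<iota> (e j)) = 0" "Z' (\<iota> (e i)) 1 (\<iota> (e j)) = b i j \<odot> vac"
    "Z' (\<iota> (e i)) 0 (\<iota> (e j)) = (\<Sum>k = 1..r. N i j k \<odot> \<iota> (e k))"
    if "i \<in> {1..r}" "j \<in> {1..r}" for i j n
    using f(2) g(2) that unfolding fg has_singular_part_def by auto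
  show ?thesis
  proof
    assume "f = g"
    then have ab: "a = b" "M = N" using fg by auto
    show "\<forall>i\<in>{1..r}. \<forall>j\<in>{1..r}. \<forall>n\<ge>0. Z (\<iota> (e i)) n (\<iota> (e j)) = Z' (\<iota> (e i)) n (\<iota> (e j))"
    proof (intro ballI allI impI)
      fix i j and n :: int assume ij: "i \<in> {1..r}" "j \<in> {1..r}" and n: "n \<ge> 0"
      have "n = 0 \<or> n = 1 \<or> n \<ge> 2" using n by linarith
      then show "Z (\<iota> (e i)) n (\<iota> (e j)) = Z' (\<iota> (e i)) n (\<iota> (e j))"
        using Z[OF ij] Z'[OF ij] ab by auto
    qed
  next
    assume eq: "\<forall>i\<in>{1..r}. \<forall>j\<in>{1..r}. \<forall>n\<ge>0. Z (\<iota> (e i)) n (\<iota> (e j)) = Z' (\<iota> (e i)) n (\<iota> (e j))"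
    have "a i j = b i j" for i j
    proof (cases "{i, j} \<subseteq> {1..r}")
      case True
      then have ij: "i \<in> {1..r}" "j \<in> {1..r}" by auto
      have "Z (\<iota> (e i)) 1 (\<iota> (e j)) = Z' (\<iota> (e i)) 1 (\<iota> (e j))" using eq ij by simp
      then show ?thesis using vac_nonzero unfolding Z(2)[OF ij] Z'(2)[OF ij] by simp
    next
      case False
      then have "a i j = 0" "b i j = 0"
        using structure_familiesD(3)[OF f(1)[unfolded fg]] structure_familiesD(3)[OF g(1)[unfolded fg]] by simp_all
      then show ?thesis by simp
    qed
    moreover have "M i j k = N i j k" for i j k
    proof (cases "{i, j, k} \<subseteq> {1..r}")
      case True
      then have ij: "i \<in> {1..r}" "j \<in> {1..r}" and k: "k \<in> {1..r}" by auto
      have "Z (\<iota> (e i)) 0 (\<iota> (e j)) = Z' (\<iota> (e i)) 0 (\<iota> (e j))" using eq ij by simp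
      then show ?thesis unfolding Z(3)[OF ij] Z'(3)[OF ij] by (rule generator_coefficients_unique[OF _ k])
    next
      case False
      then have "M i j k = 0" "N i j k = 0"
        using structure_familiesD(4)[OF f(1)[unfolded fg]] structure_familiesD(4)[OF g(1)[unfolded fg]] by simp_all
      then show ?thesis by simp
    qed
    ultimately show "f = g" unfolding fg by (simp add: fun_eq_iff)
  qed
qed

text \<open>A coboundary has no singular modes. Conversely the difference of two cocycles with equal
  singular parts is a cocycle regular on generators, hence regular everywhere, hence a
  coboundary.\<close>

lemma cohomologous_iff_singular_part:
  assumes Z: "Z \<in> cocycles" "Z' \<in> cocycles"
    and f: "f \<in> structure_families r" "has_singular_part Z f"
    and g: "g \<in> structure_families r" "has_singular_part Z' g"
  shows "Z - Z' \<in> coboundaries \<longleftrightarrow> f = g"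
  unfolding singular_part_agree[OF f g]
proof
  assume "Z - Z' \<in> coboundaries"
  from coboundary_regular[OF this]
  show "\<forall>i\<in>{1..r}. \<forall>j\<in>{1..r}. \<forall>n\<ge>0. Z (\<iota> (e i)) n (\<iota> (e j)) = Z' (\<iota> (e i)) n (\<iota> (e j))"
    by simp
next
  assume eq: "\<forall>i\<in>{1..r}. \<forall>j\<in>{1..r}. \<forall>n\<ge>0. Z (\<iota> (e i)) n (\<iota> (e j)) = Z' (\<iota> (e i)) n (\<iota> (e j))"
  have diff: "Z - Z' \<in> cocycles" by (rule cocycles_diff[OF Z])
  show "Z - Z' \<in> coboundaries"
    by (rule regular_cocycle_is_coboundary[OF diff], rule cocycle_regular[OF diff]) (use eq in auto)
qed

definition singular_part :: "('v \<Rightarrow> int \<Rightarrow> 'v \<Rightarrow> 'v) \<Rightarrow> (nat \<Rightarrow> nat \<Rightarrow> complex) \<times> (nat \<Rightarrow> nat \<Rightarrow> nat \<Rightarrow> complex)" where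
  "singular_part Z = (SOME f. f \<in> structure_families r \<and> has_singular_part Z f)"

lemma singular_part:
  assumes "Z \<in> cocycles"
  shows "singular_part Z \<in> structure_families r" "has_singular_part Z (singular_part Z)"
proof -
  have "\<exists>f. f \<in> structure_families r \<and> has_singular_part Z f" using singular_part_exists[OF assms] by blast
  from someI_ex[OF this] show "singular_part Z \<in> structure_families r" "has_singular_part Z (singular_part Z)"
    unfolding singular_part_def by blast+
qed

lemma singular_part_eqI:
  assumes "f \<in> structure_families r" "has_singular_part Z f" "Z \<in> cocycles"
  shows "singular_part Z = f"
  using singular_part_agree[OF singular_part[OF assms(3)] assms(1,2)] by blast

lemma cohomology_class: "Z \<in> cocycles \<Longrightarrow>
    cohomologous `` {Z} = {Z' \<in> cocycles. singular_part Z' = singular_part Z}"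
  unfolding cohomologous_def
  using cohomologous_iff_singular_part[OF _ _ singular_part singular_part] by auto

lemma H2_half_bij:
  "\<exists>\<Phi>. bij_betw \<Phi> H2_half (structure_families r) \<and>
     (\<forall>Z\<in>cocycles. has_singular_part Z (\<Phi> (cohomologous `` {Z})))"
proof -
  \<comment> \<open>Classes are the fibres of \<open>singular_part\<close>, so the chosen
    representative does not affect the value.\<close>
  define \<Phi> where "\<Phi> C = singular_part (SOME Z. Z \<in> C)" for C
  have \<Phi>: "\<Phi> (cohomologous `` {Z}) = singular_part Z" if "Z \<in> cocycles" for Z
  proof -
    have "Z \<in> cohomologous `` {Z}" using that by (simp add: cohomology_class)
    then have "(SOME Z'. Z' \<in> cohomologous `` {Z}) \<in> cohomologous `` {Z}"
      by (rule someI[where P = "\<lambda>Z'. Z' \<in> cohomologous `` {Z}"])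
    then show ?thesis using that by (simp add: \<Phi>_def cohomology_class)
  qed
  have "bij_betw \<Phi> H2_half (structure_families r)"
  proof (rule bij_betw_imageI)
    show "inj_on \<Phi> H2_half"
    proof (rule inj_onI)
      fix C C' assume C: "C \<in> H2_half" "C' \<in> H2_half" and eq: "\<Phi> C = \<Phi> C'"
      obtain Z Z' where Z: "Z \<in> cocycles" "C = cohomologous `` {Z}" "Z' \<in> cocycles" "C' = cohomologous `` {Z'}"
        using C unfolding H2_half_def quotient_def by blast
      with eq have "singular_part Z = singular_part Z'" by (simp add: \<Phi>)
      then show "C = C'" using Z by (simp add: cohomology_class)
    qed
    show "\<Phi> ` H2_half = structure_families r"
    proof
      show "\<Phi> ` H2_half \<subseteq> structure_families r"
        unfolding H2_half_def quotient_def using \<Phi> singular_part(1) by auto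
      show "structure_families r \<subseteq> \<Phi> ` H2_half"
      proof
        fix f assume f: "f \<in> structure_families r"
        from f structure_cocycle_exists obtain Z where Z: "Z \<in> cocycles" "has_singular_part Z f" by blast
        then have "\<Phi> (cohomologous `` {Z}) = f" using f by (simp add: \<Phi> singular_part_eqI)
        moreover have "cohomologous `` {Z} \<in> H2_half" unfolding H2_half_def by (rule quotientI[OF Z(1)])
        ultimately show "f \<in> \<Phi> ` H2_half" by blast
      qed
    qed
  qed
  then show ?thesis using \<Phi> singular_part(2) by auto
qed

text \<open>The basis consists of cocycles whose singular part has a single coordinate 1; the
  coefficients of a class are then the coordinates of its singular part, enumerated by
  \<open>h\<close>.\<close>

lemma H2_half_dimension: "H2_half_has_dim ((r + 1 choose 2) + (r choose 2) * r)"
proof -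
  define d where "d = (r + 1 choose 2) + (r choose 2) * r"
  have card: "card (structure_indices r) = d" unfolding d_def by (rule card_structure_indices)
  obtain h where h: "bij_betw h {..<d} (structure_indices r)"
    using ex_bij_betw_nat_finite[OF finite_structure_indices[of r]] by (auto simp: card atLeast0LessThan)
  define \<delta> where "\<delta> t s = (of_bool (h t = s) :: complex)" for t s
  have "\<exists>Z. Z \<in> cocycles \<and> has_singular_part Z (family_of_coordinates r (\<delta> t))" for t
    using structure_cocycle_exists[OF family_of_coordinates_structure] by blast
  then have "\<exists>b. \<forall>t. b t \<in> cocycles \<and> has_singular_part (b t) (family_of_coordinates r (\<delta> t))"
    by (intro choice allI)
  then obtain b where b: "\<And>t. b t \<in> cocycles" "\<And>t. has_singular_part (b t) (family_of_coordinates r (\<delta> t))"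
    by blast
  have sum_fun: "(\<Sum>i<m. (\<lambda>u n v. c i \<odot> b i u n v)) = (\<lambda>u n v. \<Sum>i<m. c i \<odot> b i u n v)" for c :: "nat \<Rightarrow> complex" and m
    by (induction m) (auto simp: fun_eq_iff)
  \<comment> \<open>This equivalence determines all d coefficients, and so gives existence and
    uniqueness at once.\<close>
  have key: "Z - (\<Sum>i<d. (\<lambda>u n v. c i \<odot> b i u n v)) \<in> coboundaries \<longleftrightarrow> (\<forall>t<d. c t = x (h t))"
    if Z: "Z \<in> cocycles" and x: "singular_part Z = family_of_coordinates r x" for Z c x
  proof -
    define S where "S = (\<lambda>u n v. \<Sum>i<d. c i \<odot> b i u n v)"
    have "has_singular_part S (family_of_coordinates r (\<lambda>s. \<Sum>t<d. c t * \<delta> t s))"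
      unfolding S_def family_of_coordinates_sum[symmetric] by (rule has_singular_part_sum[OF b(2)])
    moreover have "S \<in> cocycles" unfolding S_def by (intro cocycles_sum b)
    ultimately have "Z - S \<in> coboundaries \<longleftrightarrow>
        family_of_coordinates r x = family_of_coordinates r (\<lambda>s. \<Sum>t<d. c t * \<delta> t s)"
      using cohomologous_iff_singular_part[OF Z _ singular_part[OF Z] family_of_coordinates_structure] x by metis
    also have "\<dots> \<longleftrightarrow> (\<forall>s\<in>h ` {..<d}. x s = (\<Sum>t<d. c t * \<delta> t s))"
      unfolding family_of_coordinates_eq_iff using h by (simp add: bij_betw_def)
    also have "\<dots> \<longleftrightarrow> (\<forall>t<d. c t = x (h t))"
    proof -
      have "(\<Sum>t<d. c t * \<delta> t (h s)) = c s" if "s < d" for s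
      proof -
        have "(\<Sum>t<d. c t * \<delta> t (h s)) = (\<Sum>t\<in>{s}. c t * \<delta> t (h s))"
          by (rule sum.mono_neutral_right)
             (use that h in \<open>auto simp: \<delta>_def bij_betw_def dest: inj_onD\<close>)
        then show ?thesis by (simp add: \<delta>_def)
      qed
      then show ?thesis by (auto simp: eq_commute)
    qed
    finally show ?thesis unfolding sum_fun S_def .
  qed
  show ?thesis
    unfolding H2_half_has_dim_def d_def[symmetric]
  proof (intro exI[of _ b] conjI allI impI ballI b(1))
    fix Z assume Z: "Z \<in> cocycles"
    obtain x where x: "singular_part Z = family_of_coordinates r x"
      by (rule family_of_coordinates_surj[OF singular_part(1)[OF Z]])
    show "\<exists>!c. (\<forall>i\<ge>d. c i = 0) \<and> Z - (\<Sum>i<d. (\<lambda>u n v. c i \<odot> b i u n v)) \<in> coboundaries"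
      unfolding key[OF Z x]
    proof (rule ex1I[of _ "\<lambda>t. if t < d then x (h t) else 0"])
      fix c assume "(\<forall>i\<ge>d. c i = 0) \<and> (\<forall>t<d. c t = x (h t))"
      then show "c = (\<lambda>t. if t < d then x (h t) else 0)" by (auto simp: fun_eq_iff)
    qed simp
  qed
qed

end

theorem mainTheorem10:
  fixes scaleH :: "complex \<Rightarrow> 'h :: ab_group_add \<Rightarrow> 'h"
    and form :: "'h \<Rightarrow> 'h \<Rightarrow> complex"
    and r :: nat
    and e :: "nat \<Rightarrow> 'h"
    and scale :: "complex \<Rightarrow> 'v :: ab_group_add \<Rightarrow> 'v"
    and G :: "int \<Rightarrow> 'v set"
    and Y :: "'v \<Rightarrow> int \<Rightarrow> 'v \<Rightarrow> 'v"
    and vac :: 'v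
    and \<iota> :: "'h \<Rightarrow> 'v"
  assumes "heisenberg_vertex_algebra scaleH form r e scale G Y vac \<iota> 0"
  defines "Z \<equiv> grading_restricted_vertex_algebra.cocycles scale G Y vac"
    and "cohom \<equiv> grading_restricted_vertex_algebra.cohomologous scale G Y vac"
    and "H2 \<equiv> grading_restricted_vertex_algebra.H2_half scale G Y vac"
  shows "(\<exists>\<Phi>. bij_betw \<Phi> H2 (structure_families r) \<and>
            (\<forall>Y1 \<in> Z. heisenberg_vertex_algebra.has_singular_part r e scale vac \<iota>
                         Y1 (\<Phi> (cohom `` {Y1})))) \<and>
         grading_restricted_vertex_algebra.H2_half_has_dim scale G Y vac
           ((r + 1 choose 2) + (r choose 2) * r) \<and>
         (r + 1 choose 2) + (r choose 2) * r = 3 * (r + 1 choose 3) + r"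
proof -
  interpret heisenberg_vertex_algebra scaleH form r e scale G Y vac \<iota> 0 by (rule assms(1))
  interpret heisenberg_level_zero scaleH form r e scale G Y vac \<iota> ..
  show ?thesis
    unfolding Z_def cohom_def H2_def using H2_half_bij H2_half_dimension dimension_identity by blast
qed

end
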